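(* Let $\nu, m_1, m_2, t$ be positive integers with $m_1\ge m_2\ge t+1$ and $2\nu\ge 2m_1+m_2+t+3$. Suppose $\mathcal F_1\subseteq\mathcal P_{m_1}$ and $\mathcal F_2\subseteq\mathcal P_{m_2}$ are non-trivial cross $t$-intersecting families such that $|\mathcal F_1|\cdot|\mathcal F_2|$ is maximum among all pairs of non-trivial cross $t$-intersecting families $\mathcal F_1\subseteq\mathcal P_{m_1}$, $\mathcal F_2\subseteq\mathcal P_{m_2}$. (i) If $m_2>2t$ or $(m_1,m_2,t)\in\{(2,2,1),(3,2,1)\}$, then there exist $M\in\mathcal P_{m_2+1}$ and a $t$-dimensional subspace $T\subseteq M$ such that either $\mathcal F_1=\mathcal C_1(M,T;m_1,t)$ and $\mathcal F_2=\mathcal C_2(M,T;m_2)$; or $m_1=m_2$ and $\mathcal F_1=\mathcal C_2(M,T;m_1)$, $\mathcal F_2=\mathcal C_1(M,T;m_2,t)$. (ii) If $m_2\le 2t$ and $(m_1,m_2,t)\notin\{(2,2,1),(3,2,1)\}$, then there exists $S\in\mathcal P_{t+1}$ such that either $\mathcal F_1=\mathcal C_3(S;m_1)$ and $\mathcal F_2=\mathcal C_4(S;m_2,t)$; or $m_1=m_2$ and $\mathcal F_1=\mathcal C_4(S;m_1,t)$, $\mathcal F_2=\mathcal C_3(S;m_2)$.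
   Context: Let $q$ be a prime power, $\nu\ge 1$ an integer, and $f$ a non-degenerate alternating bilinear form on $V=\mathbb F_q^{2\nu}$. A subspace $W\le V$ is totally isotropic if $f(x,y)=0$ for all $x,y\in W$ (maximal totally isotropic subspaces have dimension $\nu$). For $0\le m\le \nu$, $\mathcal P_m$ denotes the set of all $m$-dimensional totally isotropic subspaces of $V$. For a subspace $A$ and integer $k$, ${A\brack k}$ denotes the set of $k$-dimensional subspaces of $A$. Families $\mathcal F_1\subseteq\mathcal P_{m_1}$ and $\mathcal F_2\subseteq\mathcal P_{m_2}$ are called cross $t$-intersecting if $\dim(F_1\cap F_2)\ge t$ for all $F_1\in\mathcal F_1$, $F_2\in\mathcal F_2$; they are trivial if some $t$-dimensional totally isotropic subspace is contained in every member of $\mathcal F_1\cup\mathcal F_2$, and non-trivial otherwise. For $M\in\mathcal P_{m+1}$ (where $m$ is the relevant dimension), a $t$-dimensional subspace $T\subseteq M$, $S\in\mathcal P_{t+1}$, and integers $a,b$: $\mathcal C_1(M,T;a,t)=\{F\in\mathcal P_{a}: T\subseteq F,\ \dim(F\cap M)\ge t+1\}$; $\mathcal C_2(M,T;b)=\{F\in\mathcal P_{b}: T\subseteq F\}\cup{M\brack b}$ (here $\dim M=b+1$); $\mathcal C_3(S;a)=\{F\in\mathcal P_{a}: S\subseteq F\}$; $\mathcal C_4(S;b,t)=\{F\in\mathcal P_{b}: \dim(F\cap S)\ge t\}$. In (i), first alternative, $M\in\mathcal P_{m_2+1}$ is used for both families; in the second alternative ($m_1=m_2$), also $M\in\mathcal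 P_{m_2+1}=\mathcal P_{m_1+1}$. *)

theory Defs
  imports "HOL-Analysis.Analysis"
begin

text \<open>Vectors of V = F_q^{2 nu} are elements of type 'a^'n, with 'a a finite field
  (so q = CARD('a) is a prime power) and CARD('n) = 2 nu.  Subspaces and dimensions
  are those of the library vector space interpretation vec (scalar multiplication *s).\<close>

definition symplectic_form :: "('a::field^'n \<Rightarrow> 'a^'n \<Rightarrow> 'a) \<Rightarrow> bool" where
  "symplectic_form f \<longleftrightarrow>
     (\<forall>x y z. f (x + y) z = f x z + f y z) \<and>
     (\<forall>x y z. f x (y + z) = f x y + f x z) \<and>
     (\<forall>c x y. f (c *s x) y = c * f x y) \<and>
     (\<forall>c x y. f x (c *s y) = c * f x y) \<and>
     (\<forall>x. f x x = 0) \<and>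
     (\<forall>x. (\<forall>y. f x y = 0) \<longrightarrow> x = 0)"

definition totally_isotropic :: "('a::field^'n \<Rightarrow> 'a^'n \<Rightarrow> 'a) \<Rightarrow> ('a^'n) set \<Rightarrow> bool" where
  "totally_isotropic f W \<longleftrightarrow> vec.subspace W \<and> (\<forall>x\<in>W. \<forall>y\<in>W. f x y = 0)"

definition Pm :: "('a::field^'n \<Rightarrow> 'a^'n \<Rightarrow> 'a) \<Rightarrow> nat \<Rightarrow> ('a^'n) set set" where
  "Pm f m = {W. totally_isotropic f W \<and> vec.dim W = m}"

definition subspaces_of :: "('a::field^'n) set \<Rightarrow> nat \<Rightarrow> ('a^'n) set set" where
  "subspaces_of A k = {W. vec.subspace W \<and> W \<subseteq> A \<and> vec.dim W = k}"

definition cross_t_intersecting ::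
  "nat \<Rightarrow> ('a::field^'n) set set \<Rightarrow> ('a^'n) set set \<Rightarrow> bool" where
  "cross_t_intersecting t F1 F2 \<longleftrightarrow> (\<forall>A\<in>F1. \<forall>B\<in>F2. vec.dim (A \<inter> B) \<ge> t)"

definition trivial_pair ::
  "('a::field^'n \<Rightarrow> 'a^'n \<Rightarrow> 'a) \<Rightarrow> nat \<Rightarrow> ('a^'n) set set \<Rightarrow> ('a^'n) set set \<Rightarrow> bool" where
  "trivial_pair f t F1 F2 \<longleftrightarrow> (\<exists>T\<in>Pm f t. \<forall>F\<in>F1 \<union> F2. T \<subseteq> F)"

definition C1 :: "('a::field^'n \<Rightarrow> 'a^'n \<Rightarrow> 'a) \<Rightarrow> ('a^'n) set \<Rightarrow> ('a^'n) set \<Rightarrow> nat \<Rightarrow> nat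
    \<Rightarrow> ('a^'n) set set" where
  "C1 f M T a t = {F \<in> Pm f a. T \<subseteq> F \<and> vec.dim (F \<inter> M) \<ge> t + 1}"

definition C2 :: "('a::field^'n \<Rightarrow> 'a^'n \<Rightarrow> 'a) \<Rightarrow> ('a^'n) set \<Rightarrow> ('a^'n) set \<Rightarrow> nat
    \<Rightarrow> ('a^'n) set set" where
  "C2 f M T b = {F \<in> Pm f b. T \<subseteq> F} \<union> subspaces_of M b"

definition C3 :: "('a::field^'n \<Rightarrow> 'a^'n \<Rightarrow> 'a) \<Rightarrow> ('a^'n) set \<Rightarrow> nat \<Rightarrow> ('a^'n) set set" where
  "C3 f S a = {F \<in> Pm f a. S \<subseteq> F}"

definition C4 :: "('a::field^'n \<Rightarrow> 'a^'n \<Rightarrow> 'a) \<Rightarrow> ('a^'n) set \<Rightarrow> nat \<Rightarrow> nat \<Rightarrow> ('a^'n) set set" where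
  "C4 f S b t = {F \<in> Pm f b. vec.dim (F \<inter> S) \<ge> t}"

end

(*
Write [k] = 1 + q + ... + q^(k-1) and N(s, m) for the number of m-dimensional totally isotropic
subspaces above a fixed s-dimensional one, so that N(s, m) [m - s] = [2 nu - 2 s] N(s + 1, m).
If neither all members of F1 nor all members of F2 contain a common t-space, branching along
minimal covers bounds |F1| |F2| by 2 N(t+1, m1) N(t, m2).  Otherwise let T lie in all members
of F1, say.  The (t+1)-dimensional covers of F2 above T span a subspace M of T + B for every B in F2
not containing T.  If M = T + B, the pair sits inside (C1, C2); if all members of F1 contain one
cover S, it sits inside (C3, C4); in all other cases |F1| / N(t+1, m1) is essentially at most
[m2 - t] and |F2| / N(t, m2) is essentially 1, which is beaten by (C1, C2), whose product is about
[m2 - t + 1] N(t+1, m1) N(t, m2).  The product for (C3, C4) is about [t + 1] N(t+1, m1) N(t, m2),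
so only m2 = 2 t requires a comparison of lower order terms.  When T lies in all members of F2 and
m2 < m1, the same bounds with the roles exchanged lose a factor [m2 - t] / [m1 - t].
*)
theory Submission
  imports Defs
begin

section \<open>Counting subspaces over a finite field\<close>

text \<open>Sizes are measured in units of N(t+1, m1) N(t, m2). Passing from N(s+1, m) to N(s, m)
  gains at least q^(2 nu - s - m), which for s = t, m = m1 is at least q^(m1+m2+3) by hypothesis.
  Its first m1 + m2 factors pay for the powers of q lost in branching; the other 3 pay for the
  factors 2 in [k+1] <= 2 q^k, a bound that is nearly sharp at q = 2. In these units the two
  extremal pairs reach at least [m2-t+1] - 1/8 and [t+1] - 1/8, while with T in F1 or no such T the
  rejected cases give at most 2, 2/3 [m2-t+1] or [m2-t] + 5/8. For k >= 1, [k+1] >= 3 and [k+1] >=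
  [k] + 2 separate these values. For m2 = 2t the leading coefficients agree. What decides is the
  overlap inside C1, which costs at least q[t] [m1-t-1] / [2 nu-2t-2] relative to N(t+1, m1),
  against the hyperplanes added in C2 and the overlap in C4. For t = 1 the condition in favour of
  (C3, C4) is close to [m1-2] > 1 + 1/q + 1/q^2, which fails for m1 = 2 and m1 = 3 and holds from m1
  = 4 on: this is the origin of the two exceptional triples.\<close>

definition qint :: "real \<Rightarrow> nat \<Rightarrow> real" where
  "qint q k = (\<Sum>i<k. q ^ i)"

lemma qint_0 [simp]: "qint q 0 = 0"
  and qint_Suc: "qint q (Suc k) = qint q k + q ^ k"
  by (simp_all add: qint_def)

lemma qint_1 [simp]: "qint q (Suc 0) = 1"
  by (simp add: qint_Suc)

lemma qint_mult: "(q - 1) * qint q k = q ^ k - 1"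
  by (induction k) (auto simp: qint_Suc algebra_simps)

text \<open>Each further basis vector \<open>b\<close> multiplies the size of the span by the size
  of the field, since \<open>(c, y)\<close> and \<open>c *s b + y\<close> determine each
  other.\<close>

lemma card_subspace:
  fixes X :: "('a::{finite,field}^'n) set"
  assumes "vec.subspace X"
  shows "card X = CARD('a) ^ vec.dim X"
proof -
  have *: "card (vec.span B) = CARD('a) ^ card B"
    if "finite B" "vec.independent B" for B :: "('a^'n) set"
    using that
  proof (induction B rule: finite_induct)
    case (insert b B)
    then have b: "b \<notin> vec.span B" "vec.independent B"
      by (auto simp: vec.independent_insert)
    let ?g = "\<lambda>(c, y). c *s b + y"
    have "vec.span (insert b B) = ?g ` (UNIV \<times> vec.span B)"
    proof (intro equalityI subsetI)
      fix x assume "x \<in> vec.span (insert b B)"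
      then obtain k where "x - k *s b \<in> vec.span B"
        by (auto simp: vec.span_insert)
      then show "x \<in> ?g ` (UNIV \<times> vec.span B)"
        by (intro image_eqI[of _ _ "(k, x - k *s b)"]) auto
    next
      fix x assume "x \<in> ?g ` (UNIV \<times> vec.span B)"
      then obtain c y where "x = c *s b + y" "y \<in> vec.span B" by auto
      then show "x \<in> vec.span (insert b B)"
        unfolding vec.span_insert by (auto intro!: exI[of _ c])
    qed
    moreover have "inj_on ?g (UNIV \<times> vec.span B)"
    proof (rule inj_onI, clarify)
      fix c y c' y'
      assume y: "y \<in> vec.span B" "y' \<in> vec.span B" and eq: "c *s b + y = c' *s b + y'"
      have "(c - c') *s b = y' - y"
        using eq by (simp add: vec.scale_left_diff_distrib algebra_simps)
      then have "(c - c') *s b \<in> vec.span B"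
        using y by (simp add: vec.span_diff)
      moreover have "d = 0" if "d *s b \<in> vec.span B" for d
        using b vec.span_scale[OF that, of "inverse d"] by (cases "d = 0") auto
      ultimately have "c = c'" by fastforce
      with eq show "c = c' \<and> y = y'" by simp
    qed
    ultimately show ?case
      using insert b by (simp add: card_image card_cartesian_product)
  qed auto
  obtain B where "finite B" "vec.independent B" "vec.span B = X" "card B = vec.dim X"
    using vec.basis_subspace_exists[OF assms] by metis
  with *[of B] show ?thesis by simp
qed

lemma dim_span_Un:
  fixes U W :: "('a::field^'n) set"
  assumes "vec.subspace U" "vec.subspace W"
  shows "vec.dim (vec.span (U \<union> W)) + vec.dim (U \<inter> W) = vec.dim U + vec.dim W"
proof -
  have "vec.span (U \<union> W) = {x + y |x y. x \<in> U \<and> y \<in> W}"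
    using assms by (auto simp: vec.span_Un vec.span_eq_iff[THEN iffD2])
  then show ?thesis
    using vec.dim_sums_Int[OF assms] by simp
qed

lemma dim_inter_ge:
  fixes U W X :: "('a::field^'n) set"
  assumes "vec.subspace U" "vec.subspace W" "vec.subspace X" "U \<subseteq> X" "W \<subseteq> X"
  shows "vec.dim U + vec.dim W \<le> vec.dim X + vec.dim (U \<inter> W)"
proof -
  have "vec.span (U \<union> W) \<subseteq> X"
    using assms by (simp add: vec.span_minimal)
  then have "vec.dim (vec.span (U \<union> W)) \<le> vec.dim X"
    by (rule vec.dim_subset)
  then show ?thesis
    using dim_span_Un[OF assms(1,2)] by linarith
qed

text \<open>These are the points of the quotient of \<open>X\<close> by \<open>U\<close>, the unit
  of every double count and of every branching step; \<open>X\<close> is \<open>UNIV\<close> where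
  only the dimension of the extension matters.\<close>

definition exts :: "('a::field^'n) set \<Rightarrow> ('a^'n) set \<Rightarrow> ('a^'n) set set" where
  "exts U X = {S. vec.subspace S \<and> U \<subseteq> S \<and> S \<subseteq> X \<and> vec.dim S = vec.dim U + 1}"

lemma span_insert_exts:
  fixes U X :: "('a::field^'n) set"
  assumes "vec.subspace U" "vec.subspace X" "U \<subseteq> X" "x \<in> X" "x \<notin> U"
  shows "vec.span (insert x U) \<in> exts U X"
proof -
  have "vec.dim (vec.span (insert x U)) = vec.dim U + 1"
    using assms by (simp add: vec.dim_insert vec.span_eq_iff[THEN iffD2])
  moreover have "vec.span (insert x U) \<subseteq> X"
    using assms by (intro vec.span_minimal) auto
  moreover have "U \<subseteq> vec.span (insert x U)"
    using vec.span_superset[of "insert x U"] by blast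
  ultimately show ?thesis by (simp add: exts_def)
qed

text \<open>One vector outside \<open>U\<close> determines the extension; this makes the sets
  \<open>S - U\<close> of the next count pairwise disjoint.\<close>

lemma exts_eq_span:
  fixes U X :: "('a::field^'n) set"
  assumes "vec.subspace U" "S \<in> exts U X" "x \<in> S" "x \<notin> U"
  shows "S = vec.span (insert x U)"
proof -
  have S: "vec.subspace S" "U \<subseteq> S" "vec.dim S = vec.dim U + 1"
    using assms by (auto simp: exts_def)
  have *: "vec.span (insert x U) \<in> exts U S"
    using assms S by (intro span_insert_exts) auto
  then show ?thesis
    using vec.subspace_dim_equal[of "vec.span (insert x U)" S] S by (simp add: exts_def)
qed

text \<open>The sets \<open>S - U\<close> partition \<open>X - U\<close>, and each of them has
  q^(s+1) - q^s elements.\<close>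

lemma card_exts:
  fixes U X :: "('a::{finite,field}^'n) set"
  assumes U: "vec.subspace U" and X: "vec.subspace X" and "U \<subseteq> X"
  shows "real (card (exts U X)) = qint (real CARD('a)) (vec.dim X - vec.dim U)"
proof -
  define q where "q = real CARD('a)"
  define s n where "s = vec.dim U" and "n = vec.dim X"
  have sn: "s \<le> n" using vec.dim_subset[OF \<open>U \<subseteq> X\<close>] by (simp add: s_def n_def)
  have "card {0::'a, 1} \<le> CARD('a)" by (rule card_mono) auto
  then have q: "q \<ge> 2" by (simp add: q_def)
  have eq: "X - U = (\<Union>S\<in>exts U X. S - U)"
  proof (intro equalityI subsetI)
    fix x assume x: "x \<in> X - U"
    then have "vec.span (insert x U) \<in> exts U X"
      using assms by (intro span_insert_exts) auto
    moreover have "x \<in> vec.span (insert x U)" by (simp add: vec.span_base)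
    ultimately show "x \<in> (\<Union>S\<in>exts U X. S - U)" using x by blast
  qed (auto simp: exts_def)
  have cd: "real (card (S - U)) = q ^ vec.dim S - q ^ s"
    if "vec.subspace S" "U \<subseteq> S" for S
  proof -
    have "card (S - U) = card S - card U" using that by (simp add: card_Diff_subset)
    moreover have "card U \<le> card S" using that by (simp add: card_mono)
    ultimately show ?thesis
      by (simp add: card_subspace[OF U] card_subspace[OF that(1)] q_def s_def)
  qed
  have "card (\<Union>S\<in>exts U X. S - U) = (\<Sum>S\<in>exts U X. card (S - U))"
  proof (rule card_UN_disjoint)
    show "\<forall>S\<in>exts U X. \<forall>S'\<in>exts U X. S \<noteq> S' \<longrightarrow> (S - U) \<inter> (S' - U) = {}"
    proof (intro ballI impI equals0I)
      fix S S' x assume "S \<in> exts U X" "S' \<in> exts U X" "S \<noteq> S'" "x \<in> (S - U) \<inter> (S' - U)"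
      then show False using exts_eq_span[OF U, of S X x] exts_eq_span[OF U, of S' X x] by auto
    qed
  qed auto
  also have "real \<dots> = (\<Sum>S\<in>exts U X. q ^ (s + 1) - q ^ s)"
    unfolding of_nat_sum by (rule sum.cong) (auto simp: cd exts_def s_def)
  finally have "q ^ n - q ^ s = real (card (exts U X)) * (q ^ (s + 1) - q ^ s)"
    using cd[OF X \<open>U \<subseteq> X\<close>] eq by (simp add: n_def)
  then have "q ^ s * (q ^ (n - s) - 1) = q ^ s * ((q - 1) * real (card (exts U X)))"
    using sn by (simp add: algebra_simps flip: power_add)
  then have "(q - 1) * qint q (n - s) = (q - 1) * real (card (exts U X))"
    using q by (simp add: qint_mult)
  then show ?thesis using q by (simp add: q_def n_def s_def)
qed

text \<open>Double count of the pairs \<open>(S, F)\<close> with \<open>S\<close> between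
  \<open>U\<close> and \<open>F\<close>. The container \<open>X\<close> is left open because totally
  isotropic members are counted with \<open>X = perp U\<close>.\<close>

lemma sum_card_above_exts:
  fixes \<G> :: "('a::{finite,field}^'n) set set"
  assumes "vec.subspace U"
    and G: "\<And>F. F \<in> \<G> \<Longrightarrow> U \<subseteq> F \<Longrightarrow> vec.subspace F \<and> vec.dim F = m \<and> F \<subseteq> X"
  shows "(\<Sum>S\<in>exts U X. real (card {F \<in> \<G>. S \<subseteq> F})) =
    real (card {F \<in> \<G>. U \<subseteq> F}) * qint (real CARD('a)) (m - vec.dim U)"
proof -
  have "(\<Sum>S\<in>exts U X. real (card {F \<in> \<G>. S \<subseteq> F})) =
    (\<Sum>S\<in>exts U X. \<Sum>F\<in>{F \<in> \<G>. U \<subseteq> F}. if S \<subseteq> F then 1 else 0)"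
  proof (rule sum.cong)
    fix S assume "S \<in> exts U X"
    then have "{F \<in> \<G>. S \<subseteq> F} = {F \<in> {F \<in> \<G>. U \<subseteq> F}. S \<subseteq> F}" by (auto simp: exts_def)
    then show "real (card {F \<in> \<G>. S \<subseteq> F}) = (\<Sum>F\<in>{F \<in> \<G>. U \<subseteq> F}. if S \<subseteq> F then 1 else 0)"
      by (simp add: sum.If_cases Int_def)
  qed simp
  also have "\<dots> = (\<Sum>F\<in>{F \<in> \<G>. U \<subseteq> F}. \<Sum>S\<in>exts U X. if S \<subseteq> F then 1 else 0)"
    by (rule sum.swap)
  also have "\<dots> = (\<Sum>F\<in>{F \<in> \<G>. U \<subseteq> F}. qint (real CARD('a)) (m - vec.dim U))"
  proof (rule sum.cong)
    fix F assume F: "F \<in> {F \<in> \<G>. U \<subseteq> F}"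
    then have "{S \<in> exts U X. S \<subseteq> F} = exts U F" using G[of F] by (auto simp: exts_def)
    then have "(\<Sum>S\<in>exts U X. if S \<subseteq> F then 1 else 0) = real (card (exts U F))"
      by (simp add: sum.If_cases Int_def)
    then show "(\<Sum>S\<in>exts U X. if S \<subseteq> F then 1 else 0) = qint (real CARD('a)) (m - vec.dim U)"
      using card_exts[of U F] assms F G[of F] by simp
  qed simp
  finally show ?thesis by simp
qed

text \<open>The Gaussian binomial coefficient, given by the recursion that the double count over
  \<open>exts\<close> produces.\<close>

fun qbinom :: "real \<Rightarrow> nat \<Rightarrow> nat \<Rightarrow> real" where
  "qbinom q n 0 = 1"
| "qbinom q n (Suc k) = qint q n * qbinom q (n - 1) k / qint q (Suc k)"

lemma qint_pos: "q > 0 \<Longrightarrow> k > 0 \<Longrightarrow> qint q k > 0"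
  unfolding qint_def by (rule sum_pos) auto

lemma qint_nonneg: "q \<ge> 0 \<Longrightarrow> qint q k \<ge> 0"
  unfolding qint_def by (rule sum_nonneg) auto

text \<open>Induction on the dimension still missing: replacing \<open>U\<close> by its extensions
  in the double count gives exactly the recursion of \<open>qbinom\<close>.\<close>

lemma card_subspaces_between:
  fixes U X :: "('a::{finite,field}^'n) set"
  assumes "vec.subspace U" and X: "vec.subspace X" and "U \<subseteq> X" "vec.dim U \<le> k"
  shows "real (card {W. vec.subspace W \<and> U \<subseteq> W \<and> W \<subseteq> X \<and> vec.dim W = k}) =
    qbinom (real CARD('a)) (vec.dim X - vec.dim U) (k - vec.dim U)"
  using assms(1,3,4)
proof (induction "k - vec.dim U" arbitrary: U)
  case 0
  then have "W = U" if "vec.subspace W" "U \<subseteq> W" "vec.dim W = k" for W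
    using vec.subspace_dim_equal[of U W] that by simp
  then have "{W. vec.subspace W \<and> U \<subseteq> W \<and> W \<subseteq> X \<and> vec.dim W = k} = {U}"
    using 0 by auto
  then show ?case using 0 by simp
next
  case (Suc j)
  define \<G> where "\<G> = {W. vec.subspace W \<and> W \<subseteq> X \<and> vec.dim W = k}"
  have q: "real CARD('a) > 0" by simp
  have eq: "{F \<in> \<G>. S \<subseteq> F} = {W. vec.subspace W \<and> S \<subseteq> W \<and> W \<subseteq> X \<and> vec.dim W = k}" for S
    by (auto simp: \<G>_def)
  have "real (card {F \<in> \<G>. S \<subseteq> F}) = qbinom (real CARD('a)) (vec.dim X - vec.dim U - 1) j"
    if "S \<in> exts U X" for S
  proof -
    have j: "j = k - vec.dim S" using Suc.hyps that by (auto simp: exts_def)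
    show ?thesis
      unfolding eq using Suc.hyps(1)[OF j] that j Suc.hyps(2) by (auto simp: exts_def)
  qed
  then have "real (card {F \<in> \<G>. U \<subseteq> F}) * qint (real CARD('a)) (k - vec.dim U) =
     real (card (exts U X)) * qbinom (real CARD('a)) (vec.dim X - vec.dim U - 1) j"
    using sum_card_above_exts[of U \<G> k X] Suc.prems by (simp add: \<G>_def)
  moreover have "k - vec.dim U = Suc j" using Suc.hyps by simp
  ultimately show ?case
    using qint_pos[OF q, of "Suc j"] card_exts[OF Suc.prems(1) X Suc.prems(2)]
    by (simp add: field_simps flip: eq)
qed

lemma qbinom_self [simp]: "q > 0 \<Longrightarrow> qbinom q k k = 1"
proof (induction k)
  case (Suc k)
  then show ?case using qint_pos[of q "Suc k"] by simp
qed simp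

lemma qbinom_Suc_right:
  assumes "q > 0" "k \<le> n"
  shows "qbinom q n (Suc k) * qint q (Suc k) = qbinom q n k * qint q (n - k)"
  using assms(2)
proof (induction k arbitrary: n)
  case (Suc k)
  have pos: "qint q (Suc k) > 0" "qint q (Suc (Suc k)) > 0"
    using qint_pos[OF assms(1)] by simp_all
  have *: "qbinom q (n - 1) (Suc k) * qint q (Suc k) = qbinom q (n - 1) k * qint q (n - 1 - k)"
    using Suc by (intro Suc.IH) simp
  have "qbinom q n (Suc (Suc k)) * qint q (Suc (Suc k)) = qint q n * qbinom q (n - 1) (Suc k)"
    using pos by (simp del: qbinom.simps add: qbinom.simps(2)[of q n "Suc k"])
  also have "\<dots> = qint q n * (qbinom q (n - 1) k * qint q (n - 1 - k)) / qint q (Suc k)"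
    unfolding *[symmetric] using pos by (simp del: qbinom.simps)
  also have "\<dots> = qbinom q n (Suc k) * qint q (n - Suc k)" by simp
  finally show ?case .
qed (use assms in auto)

text \<open>Compares consecutive upper indices; this ratio controls how the binomial factor grows
  with the dimension of a cover.\<close>

lemma qbinom_Suc_left:
  assumes "q > 0" "k \<le> n"
  shows "qbinom q (Suc n) k * qint q (Suc n - k) = qint q (Suc n) * qbinom q n k"
proof (cases k)
  case (Suc j)
  then have "qbinom q (Suc n) (Suc j) * qint q (Suc n - Suc j) =
    qint q (Suc n) * (qbinom q n j * qint q (n - j)) / qint q (Suc j)"
    by (simp add: field_simps)
  also have "\<dots> = qint q (Suc n) * qbinom q n (Suc j)"
    using qbinom_Suc_right[of q j n] assms Suc qint_pos[OF assms(1), of "Suc j"]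
    by (simp add: field_simps)
  finally show ?thesis using Suc by simp
qed simp

lemma qbinom_nonneg: "q > 0 \<Longrightarrow> qbinom q n k \<ge> 0"
  by (induction k arbitrary: n) (auto simp: qint_nonneg)

lemma qbinom_hyperplanes: "q > 0 \<Longrightarrow> qbinom q (Suc k) k = qint q (Suc k)"
  using qbinom_Suc_left[of q k k] by (simp add: qint_Suc)

section \<open>Branching over the extensions of a subspace\<close>

lemma dim_strict_mono:
  fixes U W :: "('a::field^'n) set"
  assumes "vec.subspace U" "vec.subspace W" "U \<subset> W"
  shows "vec.dim U < vec.dim W"
  using vec.subspace_dim_equal[of U W] assms by (auto simp: not_le[symmetric])

lemma ex_subspace_between:
  fixes U X :: "('a::field^'n) set"
  assumes "vec.subspace U" "vec.subspace X" "U \<subseteq> X" "vec.dim U \<le> k" "k \<le> vec.dim X"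
  shows "\<exists>W. vec.subspace W \<and> U \<subseteq> W \<and> W \<subseteq> X \<and> vec.dim W = k"
  using assms(4,5)
proof (induction k rule: dec_induct)
  case base
  then show ?case using assms by auto
next
  case (step k)
  then obtain W where W: "vec.subspace W" "U \<subseteq> W" "W \<subseteq> X" "vec.dim W = k"
    using assms by force
  then have "W \<noteq> X" using step by auto
  then obtain x where "x \<in> X" "x \<notin> W" using W by blast
  from span_insert_exts[OF W(1) assms(2) W(3) this] W show ?case
    by (auto simp: exts_def intro!: exI[of _ "vec.span (insert x W)"])
qed

text \<open>A subspace \<open>F \<supseteq> U\<close> that meets \<open>B\<close> in dimension at least \<open>t\<close> must leave \<open>U\<close> inside every
  subspace \<open>Y\<close> with \<open>U \<inter> B \<subseteq> Y \<subseteq> B\<close> of codimension \<open>t - 1 - dim (U \<inter> B)\<close> in \<open>B\<close>, so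
  \<open>Z = U + Y\<close> works.\<close>

lemma ex_branching_space:
  fixes U B :: "('a::field^'n) set"
  assumes U: "vec.subspace U" and B: "vec.subspace B"
    and tB: "t \<le> vec.dim B" and lt: "vec.dim (U \<inter> B) < t"
  obtains Z where "vec.subspace Z" "U \<subseteq> Z" "vec.dim Z = vec.dim U + (vec.dim B - t + 1)"
    "\<forall>F. vec.subspace F \<longrightarrow> U \<subseteq> F \<longrightarrow> t \<le> vec.dim (F \<inter> B) \<longrightarrow> (\<exists>S\<in>exts U Z. S \<subseteq> F)"
proof -
  have UB: "vec.subspace (U \<inter> B)" using U B by (rule vec.subspace_inter)
  obtain Y where Y: "vec.subspace Y" "U \<inter> B \<subseteq> Y" "Y \<subseteq> B"
    "vec.dim Y = vec.dim (U \<inter> B) + (vec.dim B - t + 1)"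
    using ex_subspace_between[OF UB B, of "vec.dim (U \<inter> B) + (vec.dim B - t + 1)"] lt tB
    by force
  have UY: "U \<inter> Y = U \<inter> B" using Y by auto
  define Z where "Z = vec.span (U \<union> Y)"
  have Z: "vec.subspace Z" "U \<subseteq> Z" "Y \<subseteq> Z"
    using vec.span_superset[of "U \<union> Y"] by (auto simp: Z_def)
  have "vec.dim Z = vec.dim U + (vec.dim B - t + 1)"
    using dim_span_Un[OF U Y(1)] Y(4) UY by (simp add: Z_def)
  moreover have "\<exists>S\<in>exts U Z. S \<subseteq> F"
    if F: "vec.subspace F" "U \<subseteq> F" "t \<le> vec.dim (F \<inter> B)" for F
  proof -
    have "vec.dim (F \<inter> B) + vec.dim Y \<le> vec.dim B + vec.dim ((F \<inter> B) \<inter> Y)"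
      using F B Y by (intro dim_inter_ge vec.subspace_inter) auto
    then have "vec.dim (U \<inter> B) < vec.dim ((F \<inter> B) \<inter> Y)" using F Y tB by linarith
    then have "\<not> (F \<inter> B) \<inter> Y \<subseteq> U \<inter> B" using vec.dim_subset leD by blast
    then obtain y where y: "y \<in> F" "y \<in> Y" "y \<in> B" "y \<notin> U" by blast
    have "vec.span (insert y U) \<in> exts U Z"
      using U Z y by (intro span_insert_exts) auto
    moreover have "vec.span (insert y U) \<subseteq> F"
      using F y by (intro vec.span_minimal) auto
    ultimately show ?thesis by blast
  qed
  ultimately show ?thesis using that Z by blast
qed

lemma card_UN_le_sum:
  assumes "finite I" "A \<subseteq> (\<Union>i\<in>I. B i)" "\<And>i. i \<in> I \<Longrightarrow> finite (B i)"
  shows "real (card A) \<le> (\<Sum>i\<in>I. real (card (B i)))"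
proof -
  have "card A \<le> card (\<Union>i\<in>I. B i)" using assms by (intro card_mono) auto
  also have "\<dots> \<le> (\<Sum>i\<in>I. card (B i))" using assms(1) by (rule card_UN_le)
  finally show ?thesis by (simp flip: of_nat_sum)
qed

lemma card_UN_le_mult:
  assumes "finite I" "A \<subseteq> (\<Union>i\<in>I. B i)" "\<And>i. i \<in> I \<Longrightarrow> finite (B i)"
    "\<And>i. i \<in> I \<Longrightarrow> real (card (B i)) \<le> c"
  shows "real (card A) \<le> real (card I) * c"
  using card_UN_le_sum[OF assms(1-3)] sum_bounded_above[of I "\<lambda>i. real (card (B i))" c] assms(4)
  by fastforce

text \<open>One branching step: a set \<open>B\<close> that meets \<open>U\<close> in too small a
  dimension forces every \<open>F\<close> above \<open>U\<close> through one of the few extensions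
  of \<open>U\<close> inside \<open>Z\<close>. The bound \<open>c\<close> is asked for all
  extensions since \<open>Z\<close> is not visible to the caller.\<close>

lemma card_above_branch:
  fixes U B :: "('a::{finite,field}^'n) set"
  assumes U: "vec.subspace U" and B: "vec.subspace B"
    and tB: "t \<le> vec.dim B" and lt: "vec.dim (U \<inter> B) < t"
    and G: "\<And>F. F \<in> \<G> \<Longrightarrow> vec.subspace F \<and> t \<le> vec.dim (F \<inter> B)"
    and c: "\<And>S. S \<in> exts U UNIV \<Longrightarrow> real (card {F \<in> \<G>. S \<subseteq> F}) \<le> c"
  shows "real (card {F \<in> \<G>. U \<subseteq> F}) \<le> qint (real CARD('a)) (vec.dim B - t + 1) * c"
proof -
  obtain Z where Z: "vec.subspace Z" "U \<subseteq> Z" "vec.dim Z = vec.dim U + (vec.dim B - t + 1)"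
    "\<forall>F. vec.subspace F \<longrightarrow> U \<subseteq> F \<longrightarrow> t \<le> vec.dim (F \<inter> B) \<longrightarrow> (\<exists>S\<in>exts U Z. S \<subseteq> F)"
    using ex_branching_space[OF U B tB lt] by metis
  have "real (card {F \<in> \<G>. U \<subseteq> F}) \<le> real (card (exts U Z)) * c"
  proof (rule card_UN_le_mult)
    show "{F \<in> \<G>. U \<subseteq> F} \<subseteq> (\<Union>S\<in>exts U Z. {F \<in> \<G>. S \<subseteq> F})"
      using Z(4) G by fastforce
  qed (auto intro!: c simp: exts_def)
  then show ?thesis using card_exts[OF U Z(1,2)] Z(3) by simp
qed

lemma dim_kernel_on:
  fixes g :: "'a::field^'n \<Rightarrow> 'a" and X :: "('a^'n) set"
  assumes X: "vec.subspace X"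
    and g: "\<And>x y. g (x + y) = g x + g y" "\<And>c x. g (c *s x) = c * g x"
    and y: "y \<in> X" "g y \<noteq> 0"
  shows "vec.subspace {x \<in> X. g x = 0}" "vec.dim {x \<in> X. g x = 0} + 1 = vec.dim X"
proof -
  have g0: "g 0 = 0" using g(2)[of 0 0] by simp
  then show sub: "vec.subspace {x \<in> X. g x = 0}"
    using X by (auto simp: vec.subspace_def g)
  have "X = vec.span (insert y {x \<in> X. g x = 0})" (is "X = ?Y")
  proof (intro equalityI subsetI)
    fix x assume "x \<in> X"
    have "g (x - (g x / g y) *s y) = 0"
      using g(1)[of "x - (g x / g y) *s y" "(g x / g y) *s y"] y by (simp add: g)
    then have "x - (g x / g y) *s y \<in> {x \<in> X. g x = 0}"
      using X y \<open>x \<in> X\<close> by (auto intro!: vec.subspace_diff vec.subspace_scale)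
    then show "x \<in> ?Y" by (auto simp: vec.span_insert intro: vec.span_base)
  next
    fix x assume "x \<in> ?Y"
    then show "x \<in> X"
      using X y vec.span_minimal[of "insert y {x \<in> X. g x = 0}" X] by auto
  qed
  then have "vec.dim X = vec.dim (insert y {x \<in> X. g x = 0})"
    by (metis vec.dim_span)
  then show "vec.dim {x \<in> X. g x = 0} + 1 = vec.dim X"
    using y by (simp add: vec.dim_insert vec.span_eq_iff[THEN iffD2, OF sub])
qed

section \<open>Totally isotropic subspaces and covers\<close>

locale symplectic_space =
  fixes f :: "'a::{finite,field}^'n \<Rightarrow> 'a^'n \<Rightarrow> 'a" and \<nu> :: nat and q :: real
  assumes dimV: "CARD('n) = 2 * \<nu>" and form: "symplectic_form f" and q_def: "q = real CARD('a)"
begin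

lemma form_simps [simp]:
  "f (x + y) z = f x z + f y z" "f x (y + z) = f x y + f x z"
  "f (c *s x) y = c * f x y" "f x (c *s y) = c * f x y" "f x x = 0"
  using form by (auto simp: symplectic_form_def)

lemma form_0 [simp]: "f 0 y = 0" "f x 0 = 0"
  using form_simps(3)[of 0 0] form_simps(4)[of _ 0 0] by simp_all

lemma form_nondeg: "x \<noteq> 0 \<Longrightarrow> \<exists>y. f x y \<noteq> 0"
  using form by (auto simp: symplectic_form_def)

lemma form_skew: "f x y = - f y x"
  using form_simps(5)[of "x + y"] form_simps(5)[of x] form_simps(5)[of y] unfolding form_simps(1,2)
  by (simp add: eq_neg_iff_add_eq_0 add.commute)

lemma q_ge_2: "q \<ge> 2"
proof -
  have "card {0::'a, 1} \<le> CARD('a)" by (rule card_mono) auto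
  then show ?thesis by (simp add: q_def)
qed

section \<open>Orthogonal complements and totally isotropic extensions\<close>

definition perp :: "('a^'n) set \<Rightarrow> ('a^'n) set" where
  "perp U = {x. \<forall>u\<in>U. f u x = 0}"

lemma subspace_perp: "vec.subspace (perp U)"
  by (auto simp: vec.subspace_def perp_def)

text \<open>Counts the pairs \<open>(u, x)\<close> with \<open>u\<close> in \<open>U\<close> and
  \<open>f u x = 0\<close> in two ways. For \<open>x\<close> outside \<open>perp U\<close> the
  \<open>u\<close> form a hyperplane of \<open>U\<close>; for \<open>u\<close> nonzero the
  \<open>x\<close> form a hyperplane of the whole space, by non-degeneracy. Comparing both counts
  isolates the size of \<open>perp U\<close>.\<close>

lemma dim_perp:
  assumes U: "vec.subspace U"
  shows "vec.dim (perp U) + vec.dim U = 2 * \<nu>"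
proof -
  have q: "q > 1" using q_ge_2 by simp
  have card: "real (card X) = q ^ vec.dim X" if "vec.subspace X" for X :: "('a^'n) set"
    using card_subspace[OF that] by (simp add: q_def)
  define s where "s = vec.dim U"
  have dimU: "vec.dim (UNIV :: ('a^'n) set) = 2 * \<nu>"
    by (simp only: vec_dim_card dimV)
  have U0: "0 \<in> U" using U by (rule vec.subspace_0)
  have "(\<Sum>x\<in>UNIV. real (card {u \<in> U. f u x = 0})) = (\<Sum>u\<in>U. real (card {x. f u x = 0}))"
  proof -
    have "(\<Sum>x\<in>UNIV. real (card {u \<in> U. f u x = 0})) =
      (\<Sum>x\<in>UNIV. \<Sum>u\<in>U. if f u x = 0 then 1 else 0)"
      by (simp add: sum.If_cases Int_def)
    also have "\<dots> = (\<Sum>u\<in>U. \<Sum>x\<in>UNIV. if f u x = 0 then 1 else 0)"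
      by (rule sum.swap)
    finally show ?thesis by (simp add: sum.If_cases Int_def)
  qed
  \<comment> \<open>The factor \<open>q\<close> turns the size q^(s-1) of a hyperplane into q^s, so
    that no exponent has to be subtracted.\<close>
  moreover have "q * real (card {u \<in> U. f u x = 0}) =
      q ^ s + (if x \<in> perp U then (q - 1) * q ^ s else 0)" for x
  proof (cases "x \<in> perp U")
    case True
    then have "{u \<in> U. f u x = 0} = U" by (auto simp: perp_def)
    then show ?thesis using True card[OF U] by (simp add: s_def algebra_simps)
  next
    case False
    then obtain u where u: "u \<in> U" "f u x \<noteq> 0" by (auto simp: perp_def)
    have "vec.subspace {u \<in> U. f u x = 0}" "vec.dim {u \<in> U. f u x = 0} + 1 = vec.dim U"
      using dim_kernel_on[of U "\<lambda>u. f u x"] U u by auto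
    then show ?thesis using False card by (simp add: s_def flip: power_Suc)
  qed
  moreover have "q * real (card {x. f u x = 0}) =
      q ^ (2 * \<nu>) + (if u = 0 then (q - 1) * q ^ (2 * \<nu>) else 0)" for u
  proof (cases "u = 0")
    case True
    then show ?thesis by (simp add: q_def dimV algebra_simps)
  next
    case False
    then obtain y where u: "f u y \<noteq> 0" using form_nondeg by blast
    have "vec.subspace {x. f u x = 0}" "vec.dim {x. f u x = 0} + 1 = 2 * \<nu>"
      using dim_kernel_on[of UNIV "\<lambda>x. f u x" y] u dimU by auto
    then show ?thesis using False card by (simp flip: power_Suc)
  qed
  ultimately have "(\<Sum>x\<in>UNIV. q ^ s + (if x \<in> perp U then (q - 1) * q ^ s else 0)) =
    (\<Sum>u\<in>U. q ^ (2 * \<nu>) + (if u = 0 then (q - 1) * q ^ (2 * \<nu>) else 0))"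
    by (metis (mono_tags, lifting) sum.cong sum_distrib_left)
  then have "q ^ (2 * \<nu>) * q ^ s + real (card (perp U)) * ((q - 1) * q ^ s) =
    q ^ s * q ^ (2 * \<nu>) + (q - 1) * q ^ (2 * \<nu>)"
    using U0 card[OF U] by (simp add: sum.distrib sum.If_cases s_def q_def dimV)
  then have "(q - 1) * (q ^ vec.dim (perp U) * q ^ s) = (q - 1) * q ^ (2 * \<nu>)"
    using card[OF subspace_perp[of U]] by (simp add: algebra_simps)
  then have "q ^ (vec.dim (perp U) + s) = q ^ (2 * \<nu>)"
    using q by (simp add: power_add)
  then show ?thesis using q by (simp add: s_def power_inject_exp)
qed

lemma PmD:
  assumes "F \<in> Pm f m"
  shows "vec.subspace F" "vec.dim F = m" "\<And>x y. x \<in> F \<Longrightarrow> y \<in> F \<Longrightarrow> f x y = 0"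
  using assms by (auto simp: Pm_def totally_isotropic_def)

lemma PmI:
  "vec.subspace F \<Longrightarrow> vec.dim F = m \<Longrightarrow> (\<And>x y. x \<in> F \<Longrightarrow> y \<in> F \<Longrightarrow> f x y = 0) \<Longrightarrow> F \<in> Pm f m"
  by (auto simp: Pm_def totally_isotropic_def)

lemma Pm_subspace: "F \<in> Pm f m \<Longrightarrow> vec.subspace U \<Longrightarrow> U \<subseteq> F \<Longrightarrow> vec.dim U = k \<Longrightarrow> U \<in> Pm f k"
  by (auto simp: Pm_def totally_isotropic_def)

lemma Pm_subset_perp: "F \<in> Pm f m \<Longrightarrow> U \<subseteq> F \<Longrightarrow> F \<subseteq> perp U"
  by (auto simp: Pm_def totally_isotropic_def perp_def)

lemma Pm_span_Un:
  assumes U: "U \<in> Pm f a" and W: "W \<in> Pm f b" and "W \<subseteq> perp U"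
    and "vec.dim (vec.span (U \<union> W)) = c"
  shows "vec.span (U \<union> W) \<in> Pm f c"
proof (rule PmI)
  fix x y assume "x \<in> vec.span (U \<union> W)" "y \<in> vec.span (U \<union> W)"
  moreover have "vec.span (U \<union> W) = {x + y |x y. x \<in> U \<and> y \<in> W}"
    using PmD(1)[OF U] PmD(1)[OF W] by (auto simp: vec.span_Un vec.span_eq_iff[THEN iffD2])
  ultimately obtain u w u' w' where
    *: "x = u + w" "y = u' + w'" "u \<in> U" "u' \<in> U" "w \<in> W" "w' \<in> W" by auto
  then have "f u u' = 0" "f w w' = 0" "f u w' = 0" "f u' w = 0"
    using PmD(3)[OF U] PmD(3)[OF W] assms(3) by (auto simp: perp_def)
  then show "f x y = 0"
    using form_skew[of w u'] * by simp
qed (use assms in auto)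

text \<open>One new vector orthogonal to \<open>U\<close> keeps the space totally isotropic because
  the form is alternating. So the extensions that matter number [2 nu - 2s], the factor in
  \<open>N_rec\<close>.\<close>

lemma exts_perp_Pm:
  assumes U: "U \<in> Pm f s" and S: "S \<in> exts U (perp U)"
  shows "S \<in> Pm f (s + 1)"
proof -
  have S': "vec.subspace S" "U \<subseteq> S" "S \<subseteq> perp U" "vec.dim S = s + 1"
    using S PmD[OF U] by (auto simp: exts_def)
  then obtain x where x: "x \<in> S" "x \<notin> U" using PmD[OF U] by (metis Suc_eq_plus1 n_not_Suc_n subsetI subset_antisym)
  have Seq: "S = vec.span (insert x U)"
    using exts_eq_span[OF PmD(1)[OF U] S x] .
  show ?thesis
  proof (rule PmI)
    fix y z assume yz: "y \<in> S" "z \<in> S"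
    have "\<exists>c u. v = c *s x + u \<and> u \<in> U" if "v \<in> S" for v
    proof -
      have "vec.span U = U" using PmD(1)[OF U] by simp
      moreover obtain c where "v - c *s x \<in> vec.span U"
        using \<open>v \<in> S\<close> unfolding Seq vec.span_insert by auto
      ultimately have "v - c *s x \<in> U" by metis
      then show ?thesis by (intro exI[of _ c] exI[of _ "v - c *s x"]) auto
    qed
    with yz obtain c d u w where
      *: "y = c *s x + u" "z = d *s x + w" "u \<in> U" "w \<in> U" by metis
    have "f u x = 0" "f w x = 0" "f u w = 0"
      using * x S' PmD(3)[OF U] by (auto simp: perp_def)
    then show "f y z = 0" using form_skew[of x w] * by simp
  qed (use S' in auto)
qed

text \<open>The recursion of the overview solved as a product. The value 0 for \<open>s > m\<close>,
  where the empty product would be 1, is deliberate: \<open>N (t + 2) p\<close> also occurs for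
  \<open>p = t + 1\<close>.\<close>

definition N :: "nat \<Rightarrow> nat \<Rightarrow> real" where
  "N s m = (if s \<le> m then \<Prod>i\<in>{s..<m}. qint q (2 * \<nu> - 2 * i) / qint q (m - i) else 0)"

text \<open>Free of division and valid for all \<open>s\<close>: at \<open>s = m\<close> the left
  side vanishes through \<open>qint q 0\<close>, the right side through
  \<open>N (Suc m) m = 0\<close>.\<close>

lemma N_rec: "N s m * qint q (m - s) = qint q (2 * \<nu> - 2 * s) * N (Suc s) m"
proof (cases "s < m")
  case True
  then have "{s..<m} = insert s {Suc s..<m}" by auto
  then show ?thesis
    using True qint_pos[of q "m - s"] q_ge_2 by (simp add: N_def)
qed (auto simp: N_def)

lemma N_self [simp]: "N m m = 1"
  by (simp add: N_def)

lemma N_nonneg: "N s m \<ge> 0"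
  unfolding N_def using q_ge_2 by (auto intro!: prod_nonneg divide_nonneg_nonneg qint_nonneg)

lemma N_pos: "s \<le> m \<Longrightarrow> m \<le> \<nu> \<Longrightarrow> N s m > 0"
  unfolding N_def using q_ge_2 by (auto intro!: prod_pos divide_pos_pos qint_pos)

text \<open>Every totally isotropic space above \<open>U\<close> lies in \<open>perp U\<close>, so
  the double count over \<open>exts U (perp U)\<close> reproduces \<open>N_rec\<close>.\<close>

lemma card_Pm_above:
  "U \<in> Pm f s \<Longrightarrow> real (card {F \<in> Pm f m. U \<subseteq> F}) = N s m"
proof (induction "m - s" arbitrary: s U)
  case 0
  \<comment> \<open>The subtraction is truncated, so this case also contains \<open>s > m\<close>,
    where nothing of dimension \<open>m\<close> lies above \<open>U\<close>.\<close>
  show ?case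
  proof (cases "s = m")
    case True
    have "F = U" if "F \<in> Pm f m" "U \<subseteq> F" for F
      using vec.subspace_dim_equal[of U F] that PmD[of _ m] 0 True by simp
    then have "{F \<in> Pm f m. U \<subseteq> F} = {U}" using 0 True by auto
    then show ?thesis using True by simp
  next
    case False
    have "\<not> U \<subseteq> F" if "F \<in> Pm f m" for F
      using vec.dim_subset[of U F] that PmD(2)[of _ m] PmD(2)[OF 0(2)] 0(1) False by force
    then have "{F \<in> Pm f m. U \<subseteq> F} = {}" by auto
    then show ?thesis using 0(1) False by (simp only: N_def) simp
  qed
next
  case (Suc j)
  have U: "vec.subspace U" "vec.dim U = s" using PmD[OF Suc.prems] by auto
  have "(\<Sum>S\<in>exts U (perp U). real (card {F \<in> Pm f m. S \<subseteq> F})) =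
    real (card {F \<in> Pm f m. U \<subseteq> F}) * qint q (m - s)"
    using sum_card_above_exts[OF U(1), of "Pm f m" m "perp U"] U(2) Pm_subset_perp PmD
    by (simp add: q_def)
  moreover have "real (card {F \<in> Pm f m. S \<subseteq> F}) = N (s + 1) m" if "S \<in> exts U (perp U)" for S
    using Suc exts_perp_Pm[OF Suc.prems that] by simp
  moreover have "real (card (exts U (perp U))) = qint q (2 * \<nu> - 2 * s)"
    using card_exts[OF U(1) subspace_perp Pm_subset_perp[OF Suc.prems order_refl]]
      arg_cong[OF dim_perp[OF U(1)], of "\<lambda>n. qint q (n - 2 * s)"] U(2) by (simp add: q_def)
  ultimately have "N s m * qint q (m - s) = real (card {F \<in> Pm f m. U \<subseteq> F}) * qint q (m - s)"
    by (simp add: N_rec)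
  moreover have "qint q (m - s) > 0" using Suc q_ge_2 by (intro qint_pos) auto
  ultimately show ?case by simp
qed

text \<open>If \<open>U\<close> is not totally isotropic then no member lies above it and the count
  is 0.\<close>

lemma card_above_le:
  assumes "\<G> \<subseteq> Pm f m" "vec.subspace U" "vec.dim U = s"
  shows "real (card {F \<in> \<G>. U \<subseteq> F}) \<le> N s m"
proof (cases "U \<in> Pm f s")
  case True
  have "card {F \<in> \<G>. U \<subseteq> F} \<le> card {F \<in> Pm f m. U \<subseteq> F}"
    using assms by (intro card_mono) auto
  then show ?thesis using card_Pm_above[OF True, of m] by simp
next
  case False
  then have "{F \<in> \<G>. U \<subseteq> F} = {}"
    using assms Pm_subspace by blast
  then show ?thesis by (simp only: card.empty of_nat_0 N_nonneg)
qed

text \<open>As long as \<open>U\<close> has dimension below \<open>\<tau>\<close> it is no cover of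
  \<open>\<G>2\<close>, so some \<open>B\<close> there splits the members above \<open>U\<close>;
  each level costs one factor \<open>qint q (r - t + 1)\<close>, and \<open>card_above_le\<close>
  ends the recursion at dimension \<open>\<tau>\<close>. In the applications \<open>K\<close> is the
  common subspace \<open>T\<close>, or empty when covers are not restricted.\<close>

lemma cover_bound:
  assumes "\<G>1 \<subseteq> Pm f p" "\<G>2 \<subseteq> Pm f r" "t \<le> r" "cross_t_intersecting t \<G>1 \<G>2"
    and cov: "\<And>U k. U \<in> Pm f k \<Longrightarrow> K \<subseteq> U \<Longrightarrow> k < \<tau> \<Longrightarrow> \<exists>B\<in>\<G>2. vec.dim (U \<inter> B) < t"
    and "vec.subspace U" "K \<subseteq> U" "vec.dim U \<le> \<tau>"
  shows "real (card {F \<in> \<G>1. U \<subseteq> F}) \<le> qint q (r - t + 1) ^ (\<tau> - vec.dim U) * N \<tau> p"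
  using assms(6-)
proof (induction "\<tau> - vec.dim U" arbitrary: U)
  case 0
  then show ?case using card_above_le[OF assms(1), of U \<tau>] by simp
next
  case (Suc j)
  show ?case
  proof (cases "{F \<in> \<G>1. U \<subseteq> F} = {}")
    case True
    then show ?thesis
      using q_ge_2 by (simp only: card.empty of_nat_0) (intro mult_nonneg_nonneg zero_le_power qint_nonneg N_nonneg, simp)
  next
    case False
    then obtain F where F: "F \<in> Pm f p" "U \<subseteq> F" using assms(1) by auto
    have "U \<in> Pm f (vec.dim U)" using Pm_subspace[OF F(1) _ F(2)] Suc by simp
    then obtain B where B: "B \<in> \<G>2" "vec.dim (U \<inter> B) < t"
      using cov[of U "vec.dim U"] Suc.hyps(2) Suc.prems(2) by (metis zero_less_Suc zero_less_diff)
    then have B': "vec.subspace B" "vec.dim B = r" using assms(2) PmD by auto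
    have "real (card {F \<in> \<G>1. U \<subseteq> F}) \<le>
      qint (real CARD('a)) (vec.dim B - t + 1) * (qint q (r - t + 1) ^ j * N \<tau> p)"
    proof (rule card_above_branch)
      fix S assume S: "S \<in> exts U UNIV"
      then have "\<tau> - vec.dim S = j" using Suc.hyps(2) by (auto simp: exts_def)
      then show "real (card {F \<in> \<G>1. S \<subseteq> F}) \<le> qint q (r - t + 1) ^ j * N \<tau> p"
        using Suc S Suc.hyps(1)[of S] by (auto simp: exts_def)
    next
      fix F assume "F \<in> \<G>1"
      then show "vec.subspace F \<and> t \<le> vec.dim (F \<inter> B)"
        using assms(1,4) B PmD by (auto simp: cross_t_intersecting_def)
    qed (use Suc B B' assms in auto)
    also have "\<dots> = qint q (r - t + 1) ^ Suc j * N \<tau> p"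
      using B' by (simp add: q_def)
    finally show ?thesis using Suc.hyps(2) by simp
  qed
qed

text \<open>Each member of \<open>\<G>1\<close> contains a \<open>t\<close>-dimensional subspace of
  the cover \<open>C\<close>, and there are \<open>qbinom q k t\<close> of these.\<close>

lemma card_le_by_cover:
  assumes G1: "\<G>1 \<subseteq> Pm f p" and C: "C \<in> Pm f k" "t \<le> k"
    and cov: "\<And>F. F \<in> \<G>1 \<Longrightarrow> t \<le> vec.dim (C \<inter> F)"
    and c: "\<And>U. vec.subspace U \<Longrightarrow> vec.dim U = t \<Longrightarrow> real (card {F \<in> \<G>1. U \<subseteq> F}) \<le> c"
  shows "real (card \<G>1) \<le> qbinom q k t * c"
proof -
  let ?I = "{W. vec.subspace W \<and> {0} \<subseteq> W \<and> W \<subseteq> C \<and> vec.dim W = t}"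
  have "real (card \<G>1) \<le> real (card ?I) * c"
  proof (rule card_UN_le_mult)
    show "\<G>1 \<subseteq> (\<Union>W\<in>?I. {F \<in> \<G>1. W \<subseteq> F})"
    proof
      fix F assume F: "F \<in> \<G>1"
      then have "vec.subspace (C \<inter> F)" using C G1 PmD by (blast intro: vec.subspace_inter)
      then obtain W where "vec.subspace W" "W \<subseteq> C \<inter> F" "vec.dim W = t"
        using ex_subspace_between[of "{0}" "C \<inter> F" t] cov[OF F] vec.subspace_0 by auto
      then show "F \<in> (\<Union>W\<in>?I. {F \<in> \<G>1. W \<subseteq> F})"
        using F vec.subspace_0 by auto
    qed
  qed (auto intro!: c)
  also have "real (card ?I) = qbinom q k t"
    using card_subspaces_between[of "{0}" C t] PmD[OF C(1)] vec.subspace_0[of C] by (simp add: q_def)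
  finally show ?thesis .
qed

end

section \<open>Structure of cross-intersecting pairs\<close>

context symplectic_space
begin

text \<open>Members of \<open>\<G>1\<close> are themselves covers of \<open>\<G>2\<close>, so a
  cover of least dimension exists and that dimension is at most \<open>p\<close>.\<close>

lemma ex_min_cover:
  assumes "\<G>1 \<subseteq> Pm f p" "\<G>1 \<noteq> {}" "cross_t_intersecting t \<G>1 \<G>2" "\<And>F. F \<in> \<G>1 \<Longrightarrow> K \<subseteq> F"
  obtains \<tau> U where "U \<in> Pm f \<tau>" "K \<subseteq> U" "\<tau> \<le> p" "\<forall>B\<in>\<G>2. t \<le> vec.dim (U \<inter> B)"
    "\<forall>W k. W \<in> Pm f k \<longrightarrow> K \<subseteq> W \<longrightarrow> k < \<tau> \<longrightarrow> (\<exists>B\<in>\<G>2. vec.dim (W \<inter> B) < t)"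
proof -
  define P where "P k \<longleftrightarrow> (\<exists>U\<in>Pm f k. K \<subseteq> U \<and> (\<forall>B\<in>\<G>2. t \<le> vec.dim (U \<inter> B)))" for k
  obtain F where F: "F \<in> \<G>1" using assms(2) by auto
  have "P p" unfolding P_def
    using F assms by (intro bexI[of _ F]) (auto simp: cross_t_intersecting_def)
  then have "P (Least P)" "Least P \<le> p" by (auto intro: LeastI Least_le)
  then obtain U where "U \<in> Pm f (Least P)" "K \<subseteq> U" "\<forall>B\<in>\<G>2. t \<le> vec.dim (U \<inter> B)"
    unfolding P_def by blast
  moreover have "\<exists>B\<in>\<G>2. vec.dim (W \<inter> B) < t" if "W \<in> Pm f k" "K \<subseteq> W" "k < Least P" for W k
    using not_less_Least[OF that(3)] that(1,2) by (auto simp: P_def not_le)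
  ultimately show ?thesis using that \<open>Least P \<le> p\<close> by blast
qed

lemma subspace_PmI: "U \<in> Pm f k \<Longrightarrow> W \<in> Pm f l \<Longrightarrow> vec.subspace (U \<inter> W)"
  using PmD(1) by (blast intro: vec.subspace_inter)

lemma dim_inter_less:
  assumes "T \<in> Pm f t" "vec.subspace B" "\<not> T \<subseteq> B"
  shows "vec.dim (T \<inter> B) < t"
proof -
  have "vec.dim (T \<inter> B) < vec.dim T"
    using assms PmD(1)[OF assms(1)] by (intro dim_strict_mono vec.subspace_inter) auto
  then show ?thesis using PmD(2)[OF assms(1)] by simp
qed

text \<open>\<open>S\<close> is only one dimension larger than \<open>T\<close>, so its intersection
  with \<open>B\<close> exceeds that of \<open>T\<close> by at most one. As \<open>T\<close> is not
  inside \<open>B\<close>, all inequalities become equalities and \<open>S\<close> is the sum of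
  \<open>T\<close> and \<open>S \<inter> B\<close>. This confines all
  \<open>(t + 1)\<close>-dimensional covers above \<open>T\<close> to \<open>T + B\<close>.\<close>

lemma cover_Suc_inter:
  assumes T: "T \<in> Pm f t" "\<not> T \<subseteq> B" and S: "S \<in> Pm f (t + 1)" "T \<subseteq> S"
    and B: "B \<in> Pm f r" and cov: "t \<le> vec.dim (S \<inter> B)"
  shows "vec.dim (T \<inter> B) + 1 = t" "vec.dim (S \<inter> B) = t" "S \<subseteq> vec.span (T \<union> B)"
proof -
  note sub = PmD(1)[OF T(1)] PmD(1)[OF S(1)] PmD(1)[OF B]
  have eq: "T \<inter> (S \<inter> B) = T \<inter> B" using S by blast
  have "vec.dim T + vec.dim (S \<inter> B) \<le> vec.dim S + vec.dim (T \<inter> (S \<inter> B))"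
    using sub S by (intro dim_inter_ge vec.subspace_inter) auto
  then have "vec.dim (S \<inter> B) \<le> 1 + vec.dim (T \<inter> B)"
    using PmD(2)[OF T(1)] PmD(2)[OF S(1)] eq by simp
  moreover have "vec.dim (T \<inter> B) < t" using T sub by (intro dim_inter_less)
  ultimately show *: "vec.dim (T \<inter> B) + 1 = t" "vec.dim (S \<inter> B) = t" using cov by auto
  have "vec.dim (vec.span (T \<union> (S \<inter> B))) + vec.dim (T \<inter> B) = t + t"
    using dim_span_Un[of T "S \<inter> B"] sub * PmD(2)[OF T(1)] eq by (simp add: vec.subspace_inter)
  then have "vec.dim (vec.span (T \<union> (S \<inter> B))) = vec.dim S"
    using * PmD(2)[OF S(1)] by simp
  moreover have "vec.span (T \<union> (S \<inter> B)) \<subseteq> S" using sub S by (intro vec.span_minimal) auto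
  ultimately have "vec.span (T \<union> (S \<inter> B)) = S"
    using vec.subspace_dim_equal[of "vec.span (T \<union> (S \<inter> B))" S] sub by simp
  moreover have "vec.span (T \<union> (S \<inter> B)) \<subseteq> vec.span (T \<union> B)" by (rule vec.span_mono) auto
  ultimately show "S \<subseteq> vec.span (T \<union> B)" by simp
qed

text \<open>Branching at \<open>T\<close> over \<open>B0\<close> yields
  \<open>qint q (r - t + 1)\<close> extensions. One that is a cover contributes at most
  \<open>N (t + 1) p\<close>; any other branches once more, which produces the square in the error
  term. The set \<open>SS\<close> only has to include all covers of dimension \<open>t + 1\<close>
  above \<open>T\<close>.\<close>

lemma card_le_above_plus_covers:
  assumes T: "T \<in> Pm f t" and G: "\<G>1 \<subseteq> Pm f p" "\<G>2 \<subseteq> Pm f r" "t \<le> r"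
    and cross: "cross_t_intersecting t \<G>1 \<G>2"
    and above: "\<And>F. F \<in> \<G>1 \<Longrightarrow> T \<subseteq> F" and B0: "B0 \<in> \<G>2" "\<not> T \<subseteq> B0"
    and SS: "\<And>S. S \<in> Pm f (t + 1) \<Longrightarrow> T \<subseteq> S \<Longrightarrow> (\<And>B. B \<in> \<G>2 \<Longrightarrow> t \<le> vec.dim (S \<inter> B)) \<Longrightarrow> S \<in> SS"
  shows "real (card \<G>1) \<le> real (card SS) * N (t + 1) p + (qint q (r - t + 1))\<^sup>2 * N (t + 2) p"
proof -
  note T' = PmD(1,2)[OF T]
  have B0': "vec.subspace B0" "vec.dim B0 = r" using B0 G PmD by auto
  have lt: "vec.dim (T \<inter> B0) < t" using B0 B0' T by (intro dim_inter_less)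
  have tB0: "t \<le> vec.dim B0" using B0' G(3) by simp
  obtain Z where Z0: "vec.subspace Z" "T \<subseteq> Z" "vec.dim Z = vec.dim T + (vec.dim B0 - t + 1)"
    "\<forall>F. vec.subspace F \<longrightarrow> T \<subseteq> F \<longrightarrow> t \<le> vec.dim (F \<inter> B0) \<longrightarrow> (\<exists>S\<in>exts T Z. S \<subseteq> F)"
    by (rule ex_branching_space[OF T'(1) B0'(1) tB0 lt])
  note Z = Z0(1,2) Z0(3)[unfolded T'(2) B0'(2)] Z0(4)
  have nonneg: "N a b \<ge> 0" "qint q a \<ge> 0" for a b using N_nonneg qint_nonneg q_ge_2 by auto
  have "real (card \<G>1) \<le> (\<Sum>S\<in>exts T Z. real (card {F \<in> \<G>1. S \<subseteq> F}))"
  proof (rule card_UN_le_sum)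
    show "\<G>1 \<subseteq> (\<Union>S\<in>exts T Z. {F \<in> \<G>1. S \<subseteq> F})"
    proof
      fix F assume F: "F \<in> \<G>1"
      then obtain S where "S \<in> exts T Z" "S \<subseteq> F"
        using Z(4) above cross B0 G PmD(1) by (auto simp: cross_t_intersecting_def) (meson subsetD)
      with F show "F \<in> (\<Union>S\<in>exts T Z. {F \<in> \<G>1. S \<subseteq> F})" by auto
    qed
  qed auto
  also have "\<dots> \<le> (\<Sum>S\<in>exts T Z. (if S \<in> SS then N (t + 1) p else 0) + qint q (r - t + 1) * N (t + 2) p)"
  proof (rule sum_mono)
    fix S assume S: "S \<in> exts T Z"
    then have S': "vec.subspace S" "T \<subseteq> S" "vec.dim S = t + 1" using T' by (auto simp: exts_def)
    show "real (card {F \<in> \<G>1. S \<subseteq> F}) \<le>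
      (if S \<in> SS then N (t + 1) p else 0) + qint q (r - t + 1) * N (t + 2) p"
    proof (cases "S \<in> SS")
      case True
      then show ?thesis using card_above_le[OF G(1) S'(1,3)] nonneg by (simp add: add_increasing2)
    next
      case False
      show ?thesis
      proof (cases "S \<in> Pm f (t + 1)")
        case True
        then obtain B where B: "B \<in> \<G>2" "vec.dim (S \<inter> B) < t"
          using SS[OF True S'(2)] False not_le by blast
        have B': "vec.subspace B" "vec.dim B = r" using B G PmD by auto
        have "real (card {F \<in> \<G>1. S \<subseteq> F}) \<le> qint (real CARD('a)) (vec.dim B - t + 1) * N (t + 2) p"
        proof (rule card_above_branch)
          fix S' assume "S' \<in> exts S UNIV"
          then show "real (card {F \<in> \<G>1. S' \<subseteq> F}) \<le> N (t + 2) p"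
            using S' card_above_le[OF G(1), of S' "t + 2"] by (auto simp: exts_def)
        next
          fix F assume "F \<in> \<G>1"
          then show "vec.subspace F \<and> t \<le> vec.dim (F \<inter> B)"
            using G B cross PmD by (auto simp: cross_t_intersecting_def)
        qed (use S' B B' G in auto)
        then show ?thesis using B' False by (simp add: q_def)
      next
        case not_ti: False
        then have "{F \<in> \<G>1. S \<subseteq> F} = {}" using G(1) S' Pm_subspace by blast
        then have "real (card {F \<in> \<G>1. S \<subseteq> F}) = 0" by simp
        then show ?thesis using False nonneg by (simp only: if_False add_0 mult_nonneg_nonneg)
      qed
    qed
  qed
  also have "\<dots> = real (card (exts T Z \<inter> SS)) * N (t + 1) p +
      real (card (exts T Z)) * (qint q (r - t + 1) * N (t + 2) p)"
    by (simp add: sum.distrib sum.If_cases Int_def)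
  also have "real (card (exts T Z)) = qint q (r - t + 1)"
    using card_exts[OF T'(1) Z(1,2)] Z(3) T'(2) by (simp add: q_def)
  also have "real (card (exts T Z \<inter> SS)) * N (t + 1) p \<le> real (card SS) * N (t + 1) p"
    using nonneg by (intro mult_right_mono) (auto intro!: card_mono)
  finally show ?thesis by (simp add: power2_eq_square)
qed

text \<open>A member not above \<open>T\<close> meets the cover \<open>S\<close> in one of the
  \<open>q * qint q t\<close> hyperplanes \<open>W\<close> of \<open>S\<close> other than
  \<open>T\<close>. The second cover \<open>Y\<close> meets \<open>W\<close> in dimension below
  \<open>t\<close>, so the members above \<open>W\<close> branch over \<open>Y\<close> and are of
  lower order.\<close>

lemma card_le_above_plus_hyperplanes:
  assumes T: "T \<in> Pm f t" and S: "S \<in> Pm f (t + 1)" "T \<subseteq> S" and G: "\<G> \<subseteq> Pm f r"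
    and covS: "\<And>B. B \<in> \<G> \<Longrightarrow> t \<le> vec.dim (S \<inter> B)"
    and Y: "Y \<in> Pm f k" "t < k" "k \<le> p" "T \<subseteq> Y" "\<not> S \<subseteq> Y"
    and covY: "\<And>B. B \<in> \<G> \<Longrightarrow> t \<le> vec.dim (Y \<inter> B)"
  shows "real (card \<G>) \<le> N t r + q * qint q t * qint q (p - t + 1) * N (t + 1) r"
proof -
  have q: "q > 0" using q_ge_2 by simp
  have nonneg: "N a b \<ge> 0" "qint q a \<ge> 0" for a b using N_nonneg qint_nonneg q by auto
  note T' = PmD(1,2)[OF T] and S' = PmD(1,2)[OF S(1)] and Y' = PmD(1,2)[OF Y(1)]
  define hyps where "hyps = {W. vec.subspace W \<and> {0} \<subseteq> W \<and> W \<subseteq> S \<and> vec.dim W = t}"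
  have "vec.dim (S \<inter> Y) < t + 1"
    using dim_inter_less[OF S(1) Y'(1) Y(5)] .
  \<comment> \<open>The intersection contains \<open>T\<close> and has dimension at most
    \<open>t\<close>. Hence a hyperplane of \<open>S\<close> inside \<open>Y\<close> can only be
    \<open>T\<close>.\<close>
  then have SY: "S \<inter> Y = T"
    using vec.subspace_dim_equal[of T "S \<inter> Y"] T' S' Y' S Y by (simp add: vec.subspace_inter)
  have "T \<in> hyps" using T' S vec.subspace_0 by (auto simp: hyps_def)
  moreover have "real (card hyps) = qint q (Suc t)"
    using card_subspaces_between[of "{0}" S t] S' vec.subspace_0[of S] q
    by (simp add: hyps_def qbinom_hyperplanes flip: q_def)
  ultimately have "real (card (hyps - {T})) = qint q (Suc t) - 1"
    by (simp add: card_Diff_singleton)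
      (metis One_nat_def Suc_leI card_gt_0_iff empty_iff finite of_nat_1 of_nat_diff)
  also have "\<dots> = q * qint q t"
    unfolding qint_def by (subst sum.lessThan_Suc_shift) (simp add: sum_distrib_left)
  finally have card_hyps: "real (card (hyps - {T})) = q * qint q t" .
  have "\<G> \<subseteq> {F \<in> \<G>. T \<subseteq> F} \<union> (\<Union>W\<in>hyps - {T}. {F \<in> \<G>. W \<subseteq> F})"
  proof
    fix B assume B: "B \<in> \<G>"
    show "B \<in> {F \<in> \<G>. T \<subseteq> F} \<union> (\<Union>W\<in>hyps - {T}. {F \<in> \<G>. W \<subseteq> F})"
    proof (cases "T \<subseteq> B")
      case False
      have BP: "B \<in> Pm f r" using B G by auto
      have "vec.dim (S \<inter> B) = t" using cover_Suc_inter(2)[OF T False S BP covS[OF B]] .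
      then have "S \<inter> B \<in> hyps - {T}"
        using subspace_PmI[OF S(1) BP] vec.subspace_0 False by (auto simp: hyps_def)
      then show ?thesis using B by blast
    qed (use B in auto)
  qed
  then have "card \<G> \<le> card ({F \<in> \<G>. T \<subseteq> F} \<union> (\<Union>W\<in>hyps - {T}. {F \<in> \<G>. W \<subseteq> F}))"
    by (intro card_mono) auto
  also have "\<dots> \<le> card {F \<in> \<G>. T \<subseteq> F} + card (\<Union>W\<in>hyps - {T}. {F \<in> \<G>. W \<subseteq> F})"
    by (rule card_Un_le)
  finally have "real (card \<G>) \<le> real (card {F \<in> \<G>. T \<subseteq> F}) +
      real (card (\<Union>W\<in>hyps - {T}. {F \<in> \<G>. W \<subseteq> F}))" by linarith
  also have "real (card {F \<in> \<G>. T \<subseteq> F}) \<le> N t r"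
    using card_above_le[OF G T'] .
  also have "real (card (\<Union>W\<in>hyps - {T}. {F \<in> \<G>. W \<subseteq> F})) \<le>
      real (card (hyps - {T})) * (qint q (k - t + 1) * N (t + 1) r)"
  proof (rule card_UN_le_mult)
    fix W assume W: "W \<in> hyps - {T}"
    then have W': "vec.subspace W" "W \<subseteq> S" "vec.dim W = t" "W \<noteq> T" by (auto simp: hyps_def)
    have "\<not> W \<subseteq> Y"
      using vec.subspace_dim_equal[OF W'(1) T'(1)] W' SY T' by auto
    then have lt: "vec.dim (W \<inter> Y) < t"
      using dim_inter_less[OF Pm_subspace[OF S(1) W'(1,2,3)] Y'(1)] by simp
    have "real (card {F \<in> \<G>. W \<subseteq> F}) \<le> qint (real CARD('a)) (vec.dim Y - t + 1) * N (t + 1) r"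
    proof (rule card_above_branch)
      fix S' assume "S' \<in> exts W UNIV"
      then show "real (card {F \<in> \<G>. S' \<subseteq> F}) \<le> N (t + 1) r"
        using W' card_above_le[OF G, of S' "t + 1"] by (auto simp: exts_def)
    next
      fix F assume "F \<in> \<G>"
      then show "vec.subspace F \<and> t \<le> vec.dim (F \<inter> Y)"
        using G covY PmD by (auto simp: Int_commute)
    qed (use W' Y' lt Y in auto)
    then show "real (card {F \<in> \<G>. W \<subseteq> F}) \<le> qint q (k - t + 1) * N (t + 1) r"
      using Y' by (simp add: q_def)
  qed auto
  also have "\<dots> = q * qint q t * N (t + 1) r * qint q (k - t + 1)"
    by (simp add: card_hyps)
  also have "\<dots> \<le> q * qint q t * N (t + 1) r * qint q (p - t + 1)"
    using q nonneg Y unfolding qint_def by (intro mult_left_mono sum_mono2 mult_nonneg_nonneg) (auto simp: sum_nonneg)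
  finally show ?thesis by (simp add: mult_ac)
qed

text \<open>No order between \<open>p\<close> and \<open>r\<close> is assumed, so that either of the
  two given families can take the role of \<open>\<G>1\<close>.\<close>

lemma structure_above:
  assumes T: "T \<in> Pm f t" and G: "\<G>1 \<subseteq> Pm f p" "\<G>2 \<subseteq> Pm f r" and tpr: "t \<ge> 1" "t < p" "t < r"
    and cross: "cross_t_intersecting t \<G>1 \<G>2"
    and all_above: "\<forall>F\<in>\<G>1. T \<subseteq> F" and ne: "\<G>1 \<noteq> {}" and B0: "B0 \<in> \<G>2" "\<not> T \<subseteq> B0"
  shows "(\<exists>\<tau>. t + 2 \<le> \<tau> \<and> \<tau> \<le> p \<and> real (card \<G>1) \<le> qint q (r - t + 1) ^ (\<tau> - t) * N \<tau> p \<and>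
        real (card \<G>2) \<le> qbinom q \<tau> t * N t r)
    \<or> (real (card \<G>1) \<le> qint q (r - t) * N (t + 1) p + (qint q (r - t + 1))\<^sup>2 * N (t + 2) p \<and>
       real (card \<G>2) \<le> N t r + q * qint q t * qint q (p - t + 1) * N (t + 1) r)
    \<or> (\<exists>S\<in>Pm f (t + 1). \<G>1 \<subseteq> C3 f S p \<and> \<G>2 \<subseteq> C4 f S r t)
    \<or> (\<exists>M\<in>Pm f (r + 1). T \<subseteq> M \<and> \<G>1 \<subseteq> C1 f M T p t \<and> \<G>2 \<subseteq> C2 f M T r)"
proof -
  have q: "q > 0" using q_ge_2 by simp
  have above: "\<And>F. F \<in> \<G>1 \<Longrightarrow> T \<subseteq> F" using all_above by blast
  note T' = PmD(1,2)[OF T]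
  have B0P: "B0 \<in> Pm f r" using B0 G by auto
  note B0' = PmD(1,2)[OF B0P]
  define SS where "SS = {S \<in> Pm f (t + 1). T \<subseteq> S \<and> (\<forall>B\<in>\<G>2. t \<le> vec.dim (S \<inter> B))}"
  have SSD: "S \<in> Pm f (t + 1)" "T \<subseteq> S" "\<And>B. B \<in> \<G>2 \<Longrightarrow> t \<le> vec.dim (S \<inter> B)" if "S \<in> SS" for S
    using that by (auto simp: SS_def)
  show ?thesis
  proof (cases "SS = {}")
    case True
    obtain \<tau> U where U: "U \<in> Pm f \<tau>" "T \<subseteq> U" "\<tau> \<le> p" "\<forall>B\<in>\<G>2. t \<le> vec.dim (U \<inter> B)"
      and min: "\<forall>W k. W \<in> Pm f k \<longrightarrow> T \<subseteq> W \<longrightarrow> k < \<tau> \<longrightarrow> (\<exists>B\<in>\<G>2. vec.dim (W \<inter> B) < t)"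
      by (rule ex_min_cover[OF G(1) ne cross above])
    have t\<tau>: "t \<le> \<tau>" using vec.dim_subset[OF U(2)] T' PmD(2)[OF U(1)] by simp
    have "\<tau> \<noteq> t"
    proof
      assume "\<tau> = t"
      then have "U = T" using vec.subspace_dim_equal[of T U] U T' PmD[OF U(1)] by auto
      then show False using U(4) B0(1) dim_inter_less[OF T B0'(1) B0(2)] by fastforce
    qed
    moreover have "\<tau> \<noteq> t + 1" using True U by (auto simp: SS_def)
    ultimately have "t + 2 \<le> \<tau>" using t\<tau> by simp
    moreover have "real (card {F \<in> \<G>1. T \<subseteq> F}) \<le> qint q (r - t + 1) ^ (\<tau> - vec.dim T) * N \<tau> p"
      using tpr t\<tau> T' by (intro cover_bound[OF G _ cross, where K = T] min[rule_format]) auto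
    moreover have "{F \<in> \<G>1. T \<subseteq> F} = \<G>1" using above by auto
    moreover have "real (card \<G>2) \<le> qbinom q \<tau> t * N t r"
      using card_le_by_cover[OF G(2) U(1) t\<tau> U(4)[rule_format]] card_above_le[OF G(2)] by blast
    ultimately show ?thesis using U(3) T' by auto
  next
    case False
    then obtain S0 where S0: "S0 \<in> SS" by auto
    note S0' = SSD[OF S0]
    define M where "M = vec.span (\<Union>SS)"
    have M: "vec.subspace M" "\<And>S. S \<in> SS \<Longrightarrow> S \<subseteq> M"
      using vec.span_superset[of "\<Union>SS"] by (auto simp: M_def)
    then have TM: "T \<subseteq> M" using S0 S0' by blast
    have M_sub: "M \<subseteq> vec.span (T \<union> B)" if "B \<in> \<G>2" "\<not> T \<subseteq> B" for B
      unfolding M_def using cover_Suc_inter(3)[OF T that(2) SSD(1,2) _ SSD(3)[OF _ that(1)]] that G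
      by (intro vec.span_minimal) auto
    have dim_TB: "vec.dim (vec.span (T \<union> B)) = r + 1" if "B \<in> \<G>2" "\<not> T \<subseteq> B" for B
    proof -
      have BP: "B \<in> Pm f r" using G that by auto
      have "vec.dim (T \<inter> B) + 1 = t"
        using cover_Suc_inter(1)[OF T that(2) S0'(1,2) BP S0'(3)[OF that(1)]] .
      then show ?thesis using dim_span_Un[OF T'(1) PmD(1)[OF BP]] T' PmD(2)[OF BP] by simp
    qed
    show ?thesis
    proof (cases "vec.dim M = r + 1")
      case True
      have M_eq: "M = vec.span (T \<union> B)" if "B \<in> \<G>2" "\<not> T \<subseteq> B" for B
        using vec.subspace_dim_equal[OF M(1) _ M_sub[OF that]] True dim_TB[OF that] by simp
      have B_sub: "B \<subseteq> M" if "B \<in> \<G>2" "\<not> T \<subseteq> B" for B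
        using M_eq[OF that] vec.span_superset[of "T \<union> B"] by blast
      \<comment> \<open>Every cover in \<open>SS\<close> is totally isotropic and contains
        \<open>T\<close>, so \<open>M\<close> is orthogonal to \<open>T\<close>. Since
        \<open>B0\<close> lies in \<open>M\<close>, the sum of \<open>T\<close> and
        \<open>B0\<close> is totally isotropic.\<close>
      have "M \<subseteq> perp T"
        unfolding M_def using Pm_subset_perp SSD by (intro vec.span_minimal subspace_perp) blast
      then have MP: "M \<in> Pm f (r + 1)"
        using Pm_span_Un[OF T B0P, of "r + 1"] M_eq[OF B0] True B_sub[OF B0] by auto
      moreover have "\<G>1 \<subseteq> C1 f M T p t"
      proof
        fix F assume F: "F \<in> \<G>1"
        then have FP: "F \<in> Pm f p" "T \<subseteq> F" "t \<le> vec.dim (F \<inter> B0)"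
          using G above cross B0 by (auto simp: cross_t_intersecting_def)
        \<comment> \<open>Inside \<open>F \<inter> M\<close> lie \<open>T\<close> and
          \<open>F \<inter> B0\<close>, both of dimension at least \<open>t\<close>, with an
          intersection of dimension below \<open>t\<close>; so \<open>F \<inter> M\<close> has
          dimension at least \<open>t + 1\<close>.\<close>
        have "vec.dim T + vec.dim (F \<inter> B0) \<le> vec.dim (F \<inter> M) + vec.dim (T \<inter> (F \<inter> B0))"
          using FP TM B_sub[OF B0] T'(1) PmD(1)[OF FP(1)] M(1) B0'(1)
          by (intro dim_inter_ge vec.subspace_inter) auto
        moreover have "vec.dim (T \<inter> (F \<inter> B0)) < t"
          using dim_inter_less[OF T, of "F \<inter> B0"] PmD(1)[OF FP(1)] B0'(1) B0 by (auto simp: vec.subspace_inter)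
        ultimately show "F \<in> C1 f M T p t"
          using FP T' by (simp add: C1_def)
      qed
      moreover have "\<G>2 \<subseteq> C2 f M T r"
      proof
        fix B assume B: "B \<in> \<G>2"
        then have "B \<in> Pm f r" using G by auto
        then show "B \<in> C2 f M T r"
          using B_sub[OF B] PmD(1,2) by (auto simp: C2_def subspaces_of_def)
      qed
      ultimately show ?thesis using TM by blast
    next
      case dimM: False
      have "vec.dim M \<le> r + 1" using vec.dim_subset[OF M_sub[OF B0]] dim_TB[OF B0] by simp
      with dimM have dimM: "vec.dim M \<le> r" by simp
      have "SS \<subseteq> exts T M"
      proof
        fix S assume S: "S \<in> SS"
        show "S \<in> exts T M"
          using SSD(2)[OF S] PmD(1,2)[OF SSD(1)[OF S]] M(2)[OF S] T' by (simp add: exts_def)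
      qed
      then have "card SS \<le> card (exts T M)" by (intro card_mono) auto
      then have "real (card SS) \<le> qint q (vec.dim M - t)"
        using card_exts[OF T'(1) M(1) TM] T' by (simp flip: q_def)
      also have "\<dots> \<le> qint q (r - t)"
        unfolding qint_def using dimM q by (intro sum_mono2) auto
      finally have "real (card SS) * N (t + 1) p \<le> qint q (r - t) * N (t + 1) p"
        using N_nonneg by (intro mult_right_mono)
      moreover have "real (card \<G>1) \<le> real (card SS) * N (t + 1) p + (qint q (r - t + 1))\<^sup>2 * N (t + 2) p"
        using tpr by (intro card_le_above_plus_covers[OF T G _ cross above B0]) (auto simp: SS_def)
      ultimately have c1: "real (card \<G>1) \<le> qint q (r - t) * N (t + 1) p + (qint q (r - t + 1))\<^sup>2 * N (t + 2) p"
        by linarith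
      show ?thesis
      \<comment> \<open>Members of \<open>\<G>1\<close> are covers above \<open>T\<close> of
        dimension \<open>p > t\<close>. If no such cover avoids \<open>S0\<close>, then
        \<open>S0\<close> lies in all of them.\<close>
      proof (cases "\<exists>Y k. Y \<in> Pm f k \<and> t < k \<and> k \<le> p \<and> T \<subseteq> Y \<and> \<not> S0 \<subseteq> Y \<and> (\<forall>B\<in>\<G>2. t \<le> vec.dim (Y \<inter> B))")
        case True
        then show ?thesis
          using c1 card_le_above_plus_hyperplanes[OF T S0'(1,2) G(2) S0'(3)] by blast
      next
        case False
        have "S0 \<subseteq> F \<and> F \<in> Pm f p" if F: "F \<in> \<G>1" for F
        proof -
          have "F \<in> Pm f p" "\<forall>B\<in>\<G>2. t \<le> vec.dim (F \<inter> B)"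
            using F G cross by (auto simp: cross_t_intersecting_def)
          then show ?thesis using False tpr above[OF F] by blast
        qed
        then have "\<G>1 \<subseteq> C3 f S0 p" by (auto simp: C3_def)
        moreover have "\<G>2 \<subseteq> C4 f S0 r t"
          using S0'(3) G(2) by (auto simp: C4_def Int_commute)
        ultimately show ?thesis using S0'(1) by blast
      qed
    qed
  qed
qed

text \<open>A cover of dimension \<open>t\<close> would lie in every member of the family it covers,
  so both minimal covers are larger. A member of either family contains a \<open>t\<close>-subspace
  of the minimal cover of that family, and branching over the other family continues up to the
  dimension of the other cover.\<close>

lemma card_le_two_covers:
  assumes G: "\<G>1 \<subseteq> Pm f p" "\<G>2 \<subseteq> Pm f r" "t \<le> p" "t \<le> r" and ne: "\<G>1 \<noteq> {}" "\<G>2 \<noteq> {}"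
    and cross: "cross_t_intersecting t \<G>1 \<G>2"
    and n1: "\<And>T. T \<in> Pm f t \<Longrightarrow> \<exists>F\<in>\<G>1. \<not> T \<subseteq> F" and n2: "\<And>T. T \<in> Pm f t \<Longrightarrow> \<exists>F\<in>\<G>2. \<not> T \<subseteq> F"
  shows "\<exists>\<tau>1 \<tau>2. t < \<tau>1 \<and> \<tau>1 \<le> r \<and> t < \<tau>2 \<and> \<tau>2 \<le> p \<and>
    real (card \<G>1) \<le> qbinom q \<tau>1 t * (qint q (r - t + 1) ^ (\<tau>2 - t) * N \<tau>2 p) \<and>
    real (card \<G>2) \<le> qbinom q \<tau>2 t * (qint q (p - t + 1) ^ (\<tau>1 - t) * N \<tau>1 r)"
proof -
  have cross': "cross_t_intersecting t \<G>2 \<G>1"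
    unfolding cross_t_intersecting_def
    by (subst Int_commute) (use cross in \<open>auto simp: cross_t_intersecting_def\<close>)
  have gt: "t < \<tau>" if U: "U \<in> Pm f \<tau>" "\<And>B. B \<in> \<G> \<Longrightarrow> t \<le> vec.dim (U \<inter> B)"
    and n: "\<And>T. T \<in> Pm f t \<Longrightarrow> \<exists>F\<in>\<G>. \<not> T \<subseteq> F" and "\<G> \<noteq> {}" "\<G> \<subseteq> Pm f k" for U \<tau> \<G> k
  proof -
    obtain B where B: "B \<in> \<G>" using \<open>\<G> \<noteq> {}\<close> by auto
    have "t \<le> \<tau>" using U(2)[OF B] vec.dim_subset[of "U \<inter> B" U] PmD(2)[OF U(1)] by simp
    moreover have "\<tau> \<noteq> t"
    proof
      assume "\<tau> = t"
      then obtain F where F: "F \<in> \<G>" "\<not> U \<subseteq> F" using n[of U] U(1) by auto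
      have "vec.dim (U \<inter> F) < t"
        using dim_inter_less[of U t F] U(1) F \<open>\<tau> = t\<close> \<open>\<G> \<subseteq> Pm f k\<close> PmD(1) by blast
      then show False using U(2)[OF F(1)] by simp
    qed
    ultimately show ?thesis by simp
  qed
  obtain \<tau>2 U2 where U2: "U2 \<in> Pm f \<tau>2" "\<tau>2 \<le> p" "\<forall>B\<in>\<G>2. t \<le> vec.dim (U2 \<inter> B)"
    and min2: "\<forall>W k. W \<in> Pm f k \<longrightarrow> {} \<subseteq> W \<longrightarrow> k < \<tau>2 \<longrightarrow> (\<exists>B\<in>\<G>2. vec.dim (W \<inter> B) < t)"
    by (rule ex_min_cover[OF G(1) ne(1) cross, of "{}"]) auto
  obtain \<tau>1 U1 where U1: "U1 \<in> Pm f \<tau>1" "\<tau>1 \<le> r" "\<forall>B\<in>\<G>1. t \<le> vec.dim (U1 \<inter> B)"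
    and min1: "\<forall>W k. W \<in> Pm f k \<longrightarrow> {} \<subseteq> W \<longrightarrow> k < \<tau>1 \<longrightarrow> (\<exists>B\<in>\<G>1. vec.dim (W \<inter> B) < t)"
    by (rule ex_min_cover[OF G(2) ne(2) cross', of "{}"]) auto
  have t1: "t < \<tau>1" using gt[OF U1(1) U1(3)[rule_format] n1 ne(1) G(1)] by simp
  have t2: "t < \<tau>2" using gt[OF U2(1) U2(3)[rule_format] n2 ne(2) G(2)] by simp
  have "real (card \<G>1) \<le> qbinom q \<tau>1 t * (qint q (r - t + 1) ^ (\<tau>2 - t) * N \<tau>2 p)"
  proof (rule card_le_by_cover[OF G(1) U1(1) _ U1(3)[rule_format]])
    fix U :: "('a^'n) set" assume "vec.subspace U" "vec.dim U = t"
    then show "real (card {F \<in> \<G>1. U \<subseteq> F}) \<le> qint q (r - t + 1) ^ (\<tau>2 - t) * N \<tau>2 p"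
      using cover_bound[OF G(1,2,4) cross min2[rule_format], of U] t2 by auto
  qed (use t1 in auto)
  moreover have "real (card \<G>2) \<le> qbinom q \<tau>2 t * (qint q (p - t + 1) ^ (\<tau>1 - t) * N \<tau>1 r)"
  proof (rule card_le_by_cover[OF G(2) U2(1) _ U2(3)[rule_format]])
    fix U :: "('a^'n) set" assume "vec.subspace U" "vec.dim U = t"
    then show "real (card {F \<in> \<G>2. U \<subseteq> F}) \<le> qint q (p - t + 1) ^ (\<tau>1 - t) * N \<tau>1 r"
      using cover_bound[OF G(2,1,3) cross' min1[rule_format], of U] t1 by auto
  qed (use t2 in auto)
  ultimately show ?thesis using t1 t2 U1(2) U2(2) by blast
qed

end

section \<open>Size estimates\<close>

lemma qint_add: "qint q (a + b) = qint q a + q ^ a * qint q b"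
  by (induction b) (auto simp: qint_Suc algebra_simps power_add)

lemma qint_mono: "q \<ge> 0 \<Longrightarrow> a \<le> b \<Longrightarrow> qint q a \<le> qint q b"
  unfolding qint_def by (intro sum_mono2) auto

lemma qint_less_power:
  assumes "q \<ge> 2"
  shows "qint q k < q ^ k"
proof (induction k)
  case (Suc k)
  have "2 * q ^ k \<le> q * q ^ k" using assms by (intro mult_right_mono) auto
  then show ?case using Suc by (simp add: qint_Suc)
qed simp

text \<open>The source of nearly all powers of 2 in the estimates; \<open>two_power_le\<close> later
  trades them for powers of \<open>q\<close>.\<close>

lemma qint_Suc_le: "q \<ge> 2 \<Longrightarrow> qint q (Suc k) \<le> 2 * q ^ k"
  using qint_less_power[of q k] by (simp add: qint_Suc)

lemma qint_Suc_ge: "q \<ge> 0 \<Longrightarrow> q ^ k \<le> qint q (Suc k)"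
  using qint_nonneg[of q k] by (simp add: qint_Suc)

lemma qint_Suc_eq: "qint q (Suc k) = q * qint q k + 1"
  using qint_add[of q 1 k] by simp

lemma qint_mult_power_le:
  assumes "q \<ge> 0" "a \<le> b"
  shows "qint q a * q ^ (b - a) \<le> qint q b"
  using qint_add[of q "b - a" a] qint_nonneg[OF assms(1), of "b - a"] assms by (simp add: mult.commute)

text \<open>The ratio is [\<tau>+1] / [\<tau>+1-t]. Its numerator is [t] + q^t [\<tau>+1-t], where
  [t] < q^t and the bracket is at least 1.\<close>

lemma qbinom_Suc_le:
  assumes q: "q \<ge> 2" and "t \<le> \<tau>"
  shows "qbinom q (Suc \<tau>) t \<le> 2 * q ^ t * qbinom q \<tau> t"
proof -
  have pos: "qint q (Suc \<tau> - t) > 0" using q assms by (intro qint_pos) auto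
  have "qint q 1 \<le> qint q (Suc \<tau> - t)" using q assms by (intro qint_mono) auto
  then have "qint q t * 1 \<le> q ^ t * qint q (Suc \<tau> - t)"
    using qint_less_power[OF q, of t] q by (intro mult_mono) auto
  moreover have "qint q (Suc \<tau>) = qint q t + q ^ t * qint q (Suc \<tau> - t)"
    using qint_add[of q t "Suc \<tau> - t"] assms by simp
  ultimately have "qint q (Suc \<tau>) \<le> 2 * q ^ t * qint q (Suc \<tau> - t)" by simp
  then have "qint q (Suc \<tau>) * qbinom q \<tau> t \<le> 2 * q ^ t * qint q (Suc \<tau> - t) * qbinom q \<tau> t"
    using q by (intro mult_right_mono qbinom_nonneg) auto
  then have "qbinom q (Suc \<tau>) t * qint q (Suc \<tau> - t) \<le> 2 * q ^ t * qbinom q \<tau> t * qint q (Suc \<tau> - t)"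
    using qbinom_Suc_left[of q t \<tau>] q assms by (simp add: mult_ac)
  then show ?thesis using pos by simp
qed

context symplectic_space
begin

text \<open>The quotient [2 nu - 2s] / [m - s] in \<open>N_rec\<close> is at least q to the
  difference of the two arguments.\<close>

lemma N_Suc_le:
  assumes "s < m" "m + s \<le> 2 * \<nu>"
  shows "N (Suc s) m * q ^ (2 * \<nu> - s - m) \<le> N s m"
proof -
  have q: "q > 0" using q_ge_2 by simp
  have eq: "2 * \<nu> - 2 * s - (m - s) = 2 * \<nu> - s - m" using assms by simp
  have "qint q (m - s) * q ^ (2 * \<nu> - 2 * s - (m - s)) \<le> qint q (2 * \<nu> - 2 * s)"
    using q assms by (intro qint_mult_power_le) auto
  then have "qint q (m - s) * q ^ (2 * \<nu> - s - m) * N (Suc s) m \<le> qint q (2 * \<nu> - 2 * s) * N (Suc s) m"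
    unfolding eq by (intro mult_right_mono N_nonneg)
  also have "\<dots> = N s m * qint q (m - s)" by (rule N_rec[symmetric])
  finally show ?thesis using qint_pos[OF q, of "m - s"] assms by (simp add: mult_ac)
qed

lemma N_Suc_power_le:
  assumes "s < m" "k + m + s \<le> 2 * \<nu>"
  shows "q ^ k * N (Suc s) m \<le> N s m"
proof -
  have "q ^ k * N (Suc s) m \<le> q ^ (2 * \<nu> - s - m) * N (Suc s) m"
    using assms q_ge_2 by (intro mult_right_mono power_increasing N_nonneg) auto
  then show ?thesis using N_Suc_le[of s m] assms by (simp add: mult.commute)
qed

text \<open>The form in which the estimates spend the gain of one dimension: \<open>k\<close> is
  limited by the dimension hypothesis, and \<open>c\<close> is the coefficient left over.\<close>

lemma power_N_Suc_le:
  assumes "s < m" "k + m + s \<le> 2 * \<nu>" "c \<ge> 0" "X \<le> c * q ^ k" 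
  shows "X * N (Suc s) m \<le> c * N s m"
proof -
  have "X * N (Suc s) m \<le> c * q ^ k * N (Suc s) m"
    using assms by (intro mult_right_mono N_nonneg)
  also have "\<dots> \<le> c * N s m"
    using mult_left_mono[OF N_Suc_power_le[OF assms(1,2)] assms(3)] by (simp add: mult_ac)
  finally show ?thesis .
qed

lemma q_simps: "q > 0" "q \<ge> 0" "q \<ge> 1" "q \<ge> 2" "q \<noteq> 0"
  using q_ge_2 by auto

lemma qint_le: "qint q k \<le> q ^ k"
  using qint_less_power[OF q_ge_2, of k] by simp

lemma two_power_le: "2 ^ k * q ^ n \<le> q ^ (k + n)"
  using q_simps unfolding power_add by (intro mult_right_mono power_mono) auto

text \<open>Collects the factors by cover instead of by family: the binomial comes from the bound on
  the family being covered, the other factors from branching in the opposite family. The product of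
  the two bounds thus splits into one factor for each \<open>\<tau>\<close>.\<close>

definition cover_estimate :: "nat \<Rightarrow> nat \<Rightarrow> nat \<Rightarrow> nat \<Rightarrow> real" where
  "cover_estimate t p r \<tau> = qbinom q \<tau> t * qint q (r - t + 1) ^ (\<tau> - t) * N \<tau> p"

text \<open>A larger cover costs at most (2 q^t) (2 q^(r-t)) = 4 q^r, while \<open>N\<close>
  decreases by q^(r+2) at least. The smallest admissible \<open>\<tau>\<close> is therefore the
  worst.\<close>

lemma cover_estimate_Suc_le:
  assumes H: "t < r" "2 * p + r + t + 3 \<le> 2 * \<nu>" and \<tau>: "t \<le> \<tau>" "\<tau> < p"
  shows "cover_estimate t p r (Suc \<tau>) \<le> cover_estimate t p r \<tau>"
proof -
  define c where "c = qint q (r - t + 1) ^ (\<tau> - t)"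
  have c: "c \<ge> 0" unfolding c_def using q_simps by (intro zero_le_power qint_nonneg)
  have b: "qbinom q \<tau> t \<ge> 0" using q_simps by (intro qbinom_nonneg)
  have "cover_estimate t p r (Suc \<tau>) =
      qbinom q (Suc \<tau>) t * qint q (Suc (r - t)) * (c * N (Suc \<tau>) p)"
    using \<tau> by (simp add: cover_estimate_def c_def Suc_diff_le)
  also have "\<dots> \<le> (2 * q ^ t * qbinom q \<tau> t) * (2 * q ^ (r - t)) * (c * N (Suc \<tau>) p)"
    using q_simps \<tau> c b
    by (intro mult_right_mono mult_mono qbinom_Suc_le qint_Suc_le mult_nonneg_nonneg N_nonneg qint_nonneg) auto
  also have "\<dots> = qbinom q \<tau> t * c * ((4 * q ^ r) * N (Suc \<tau>) p)"
    proof -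
      have pw: "q ^ t * q ^ (r - t) = q ^ r" using H by (simp flip: power_add)
      show ?thesis by (simp only: flip: pw) (simp add: mult_ac)
    qed
  also have "\<dots> \<le> qbinom q \<tau> t * c * (1 * N \<tau> p)"
    using b c H \<tau> two_power_le[of 2 r] by (intro mult_left_mono power_N_Suc_le[where k = "2 + r"]) auto
  finally show ?thesis by (simp add: cover_estimate_def c_def)
qed

lemma cover_estimate_le:
  assumes H: "t < r" "2 * p + r + t + 3 \<le> 2 * \<nu>" and \<tau>: "t \<le> k" "k \<le> \<tau>" "\<tau> \<le> p"
  shows "cover_estimate t p r \<tau> \<le> cover_estimate t p r k"
  using \<tau>(2,3)
proof (induction \<tau> rule: dec_induct)
  case (step n)
  then show ?case using cover_estimate_Suc_le[OF H, of n] \<tau> by simp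
qed simp

text \<open>At \<tau>1 = \<tau>2 = t + 1 the four brackets give at most 16 q^(p+r), and exchanging
  N(t+1, r) for N(t, r) gains q^(p+r+3), so that the constant 2 is left.\<close>

lemma two_covers_estimate:
  assumes H: "t < p" "t < r" "2 * p + r + t + 3 \<le> 2 * \<nu>" "2 * r + p + t + 3 \<le> 2 * \<nu>"
    and \<tau>: "t < \<tau>1" "\<tau>1 \<le> r" "t < \<tau>2" "\<tau>2 \<le> p"
  shows "cover_estimate t p r \<tau>2 * cover_estimate t r p \<tau>1 \<le> 2 * (N (t + 1) p * N t r)"
proof -
  have e: "cover_estimate t p r (t + 1) = qint q (Suc t) * qint q (Suc (r - t)) * N (Suc t) p" for p r
    using q_simps qbinom_hyperplanes[of q t] by (simp add: cover_estimate_def)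
  have nn: "cover_estimate t p r \<tau> \<ge> 0" for p r \<tau>
    unfolding cover_estimate_def using q_simps
    by (intro mult_nonneg_nonneg N_nonneg qbinom_nonneg zero_le_power qint_nonneg) auto
  have "cover_estimate t p r \<tau>2 * cover_estimate t r p \<tau>1 \<le>
      cover_estimate t p r (t + 1) * cover_estimate t r p (t + 1)"
    using H \<tau> nn by (intro mult_mono cover_estimate_le) auto
  also have "\<dots> = (qint q (Suc t) * qint q (Suc t) * (qint q (Suc (r - t)) * qint q (Suc (p - t))))
      * N (Suc t) r * N (Suc t) p"
    by (simp only: e mult_ac)
  also have "\<dots> \<le> 2 * N t r * N (Suc t) p"
  proof (intro mult_right_mono N_nonneg power_N_Suc_le[where k = "3 + (p + r)"])
    have "qint q (Suc t) * qint q (Suc t) * (qint q (Suc (r - t)) * qint q (Suc (p - t))) \<le>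
      (2 * q ^ t) * (2 * q ^ t) * ((2 * q ^ (r - t)) * (2 * q ^ (p - t)))"
      using q_simps by (intro mult_mono qint_Suc_le mult_nonneg_nonneg qint_nonneg) auto
    also have "\<dots> = 2 * (2 ^ 3 * q ^ (p + r))"
    proof -
      have "t + (t + (r - t + (p - t))) = p + r" using H by simp
      then have pw: "q ^ t * (q ^ t * (q ^ (r - t) * q ^ (p - t))) = q ^ (p + r)"
        by (simp only: flip: power_add)
      show ?thesis by (simp only: flip: pw) (simp add: mult_ac)
    qed
    also have "\<dots> \<le> 2 * q ^ (3 + (p + r))"
      using two_power_le[of 3 "p + r"] by simp
    finally show "qint q (Suc t) * qint q (Suc t) * (qint q (Suc (r - t)) * qint q (Suc (p - t))) \<le> \<dots>" .
  qed (use H in auto)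
  finally show ?thesis by (simp add: mult_ac)
qed

text \<open>The worst case is \<tau> = t + 2. There the binomial is [t+2] [t+1] / [2], and [2] >= 3
  bounds it by 4/3 q^(2t+1). With 2 q^(r-t) for one branching factor and a gain of q^(t+r+3), a
  factor 4/3 * 2 / 4 = 2/3 remains beside the other branching factor.\<close>

lemma no_small_cover_estimate:
  assumes H: "t < p" "t < r" "2 * p + r + t + 3 \<le> 2 * \<nu>" "2 * r + p + t + 3 \<le> 2 * \<nu>"
    and \<tau>: "t + 2 \<le> \<tau>" "\<tau> \<le> p"
  shows "cover_estimate t p r \<tau> * N t r \<le> 2 / 3 * qint q (r - t + 1) * (N (t + 1) p * N t r)"
proof -
  have b3: "3 * qbinom q (t + 2) t \<le> 4 * q ^ (2 * t + 1)"
  proof -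
    have "3 * qbinom q (t + 2) t \<le> qint q 2 * qbinom q (t + 2) t"
      using q_simps by (intro mult_right_mono qbinom_nonneg) (auto simp: numeral_2_eq_2 qint_Suc)
    also have "\<dots> = qint q (Suc (Suc t)) * qint q (Suc t)"
      using qbinom_Suc_left[of q t "Suc t"] qbinom_hyperplanes[of q t] q_simps
      by (simp add: mult.commute numeral_2_eq_2)
    also have "\<dots> \<le> (2 * q ^ Suc t) * (2 * q ^ t)"
      using q_simps by (intro mult_mono qint_Suc_le qint_nonneg) auto
    also have "\<dots> = 4 * q ^ (Suc t + t)" unfolding power_add by simp
    also have "Suc t + t = 2 * t + 1" by simp
    finally show ?thesis .
  qed
  have "cover_estimate t p r \<tau> \<le> cover_estimate t p r (t + 2)"
    using H \<tau> by (intro cover_estimate_le) auto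
  also have "\<dots> = qint q (Suc (r - t)) * ((qbinom q (t + 2) t * qint q (Suc (r - t))) * N (Suc (Suc t)) p)"
    by (simp add: cover_estimate_def power2_eq_square mult_ac)
  also have "\<dots> \<le> qint q (Suc (r - t)) * (2 / 3 * N (Suc t) p)"
  proof (intro mult_left_mono power_N_Suc_le[where k = "2 + (t + 1 + r)"])
    have "3 * (qbinom q (t + 2) t * qint q (Suc (r - t))) \<le> (4 * q ^ (2 * t + 1)) * (2 * q ^ (r - t))"
      using mult_mono[OF b3 qint_Suc_le[of q "r - t"]] q_simps by (simp add: qint_nonneg mult_ac)
    also have "\<dots> = 2 * (2 ^ 2 * q ^ (t + 1 + r))"
    proof -
      have "2 * t + 1 + (r - t) = t + 1 + r" using H by simp
      then have pw: "q ^ (2 * t + 1) * q ^ (r - t) = q ^ (t + 1 + r)"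
        by (simp only: flip: power_add)
      show ?thesis by (simp only: flip: pw) (simp add: mult_ac)
    qed
    also have "\<dots> \<le> 2 * q ^ (2 + (t + 1 + r))"
      using two_power_le[of 2 "t + 1 + r"] by linarith
    finally show "qbinom q (t + 2) t * qint q (Suc (r - t)) \<le> 2 / 3 * q ^ (2 + (t + 1 + r))" by simp
  qed (use H \<tau> q_simps in \<open>auto intro: qint_nonneg\<close>)
  finally have "cover_estimate t p r \<tau> * N t r \<le> qint q (Suc (r - t)) * (2 / 3 * N (Suc t) p) * N t r"
    by (intro mult_right_mono N_nonneg)
  then show ?thesis by (simp add: mult_ac)
qed

text \<open>In units of \<open>x\<close> and \<open>y\<close> the second summands are at most 1/4
  and \<open>d\<close>. As [r-t] d <= 1/4 and d/4 <= 1/32, the excess over [r-t] is at most 17/32,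
  below 5/8.\<close>

lemma small_span_estimate:
  assumes H: "1 \<le> t" "t < p" "t < r" "2 * p + r + t + 3 \<le> 2 * \<nu>" "2 * r + p + t + 3 \<le> 2 * \<nu>"
  shows "(qint q (r - t) * N (t + 1) p + (qint q (r - t + 1))\<^sup>2 * N (t + 2) p) *
      (N t r + q * qint q t * qint q (p - t + 1) * N (t + 1) r) \<le> (qint q (r - t) + 5 / 8) * (N (t + 1) p * N t r)"
proof -
  define x y where "x = N (t + 1) p" and "y = N t r"
  have xy: "x \<ge> 0" "y \<ge> 0" unfolding x_def y_def by (rule N_nonneg)+
  \<comment> \<open>The maximum makes one \<open>d\<close> serve both orders of \<open>p\<close> and
    \<open>r\<close>; the exponent p + r + t + 3 + max p r is what the two dimension hypotheses
    allow together.\<close>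
  define d where "d = 1 / q ^ (1 + max p r)"
  have \<epsilon>: "(qint q (r - t + 1))\<^sup>2 * N (t + 2) p \<le> 1 / 4 * x"
  proof (cases "t + 1 < p")
    case True
    have "(qint q (Suc (r - t)))\<^sup>2 * N (Suc (Suc t)) p \<le> 1 / 4 * N (Suc t) p"
    proof (rule power_N_Suc_le[where k = "4 + 2 * (r - t)"])
      have "(qint q (Suc (r - t)))\<^sup>2 \<le> (2 * q ^ (r - t))\<^sup>2"
        using q_simps by (intro power_mono qint_Suc_le qint_nonneg)
      also have "\<dots> = 1 / 4 * (2 ^ 4 * q ^ (2 * (r - t)))"
        by (simp add: power_mult_distrib power_mult mult.commute flip: power_mult)
      also have "\<dots> \<le> 1 / 4 * q ^ (4 + 2 * (r - t))"
        using two_power_le[of 4 "2 * (r - t)"] by linarith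
      finally show "(qint q (Suc (r - t)))\<^sup>2 \<le> 1 / 4 * q ^ (4 + 2 * (r - t))" .
    qed (use H True in auto)
    then show ?thesis by (simp add: x_def)
  next
    case False
    then have "N (t + 2) p = 0" using H by (simp add: N_def)
    then show ?thesis using xy by simp
  qed
  have "(q * qint q t * qint q (Suc (p - t))) * N (Suc t) r \<le> d * N t r"
  proof (rule power_N_Suc_le[where k = "1 + (1 + p + (1 + max p r))"])
    have "q * qint q t * qint q (Suc (p - t)) \<le> q * q ^ t * (2 * q ^ (p - t))"
      using q_simps by (intro mult_mono qint_Suc_le qint_nonneg qint_le mult_nonneg_nonneg) auto
    also have "\<dots> = 2 ^ 1 * q ^ (1 + p)"
    proof -
      have "q * (q ^ t * q ^ (p - t)) = q ^ (1 + p)" using H by (simp flip: power_add)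
      then show ?thesis by (simp add: mult_ac)
    qed
    also have "\<dots> \<le> q ^ (1 + (1 + p))" by (rule two_power_le)
    also have "\<dots> = d * q ^ (1 + (1 + p + (1 + max p r)))"
      using q_simps by (simp add: d_def power_add)
    finally show "q * qint q t * qint q (Suc (p - t)) \<le> d * q ^ (1 + (1 + p + (1 + max p r)))" .
  qed (use H q_simps in \<open>auto simp: d_def\<close>)
  then have \<delta>: "q * qint q t * qint q (p - t + 1) * N (t + 1) r \<le> d * y" by (simp add: y_def)
  have d0: "d \<ge> 0" using q_simps by (simp add: d_def)
  have "2 ^ 3 * q ^ 0 \<le> q ^ (3 + 0)" by (rule two_power_le)
  also have "\<dots> \<le> q ^ (1 + max p r)" using q_simps H by (intro power_increasing) auto
  finally have d8: "d \<le> 1 / 8" using q_simps by (simp add: d_def field_simps)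
  have "4 * qint q (r - t) \<le> 2 ^ 2 * q ^ (r - t)" using qint_le by simp
  also have "\<dots> \<le> q ^ (2 + (r - t))" by (rule two_power_le)
  also have "\<dots> \<le> q ^ (1 + max p r)" using q_simps H by (intro power_increasing) auto
  finally have d4: "qint q (r - t) * d \<le> 1 / 4" using q_simps by (simp add: d_def field_simps)
  have "(qint q (r - t) * N (t + 1) p + (qint q (r - t + 1))\<^sup>2 * N (t + 2) p) *
      (N t r + q * qint q t * qint q (p - t + 1) * N (t + 1) r) \<le>
    (qint q (r - t) * x + 1 / 4 * x) * (y + d * y)"
    unfolding x_def[symmetric] y_def[symmetric]
    by (rule mult_mono[OF add_mono[OF order_refl \<epsilon>] add_mono[OF order_refl \<delta>]])
      (use xy q_simps in \<open>simp_all add: qint_nonneg N_nonneg\<close>)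
  also have "\<dots> = (qint q (r - t) + 1 / 4 + (qint q (r - t) * d + d / 4)) * (x * y)"
    by (simp add: algebra_simps)
  also have "\<dots> \<le> (qint q (r - t) + 5 / 8) * (x * y)"
    using d4 d8 xy by (intro mult_right_mono) auto
  finally show ?thesis by (simp add: x_def y_def)
qed

lemma N_ge_1:
  assumes "s \<le> m" "m \<le> \<nu>"
  shows "N s m \<ge> 1"
proof -
  have "(\<Prod>i\<in>{s..<m}. qint q (2 * \<nu> - 2 * i) / qint q (m - i)) \<ge> 1"
  proof (rule prod_ge_1)
    fix i assume i: "i \<in> {s..<m}"
    then have "qint q (m - i) \<le> qint q (2 * \<nu> - 2 * i)" using assms q_simps by (intro qint_mono) auto
    then show "1 \<le> qint q (2 * \<nu> - 2 * i) / qint q (m - i)"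
      using qint_pos[of q "m - i"] q_simps i by simp
  qed
  then show ?thesis using assms by (simp add: N_def)
qed

text \<open>The hyperplanes that \<open>C2\<close> adds to the spaces above \<open>T\<close> are
  fewer than q^(r+1), whereas N(t, r) is at least q^(r+p+3).\<close>

lemma hyperplane_bonus_le:
  assumes H: "1 \<le> t" "t < r" "2 * r + p + t + 3 \<le> 2 * \<nu>"
  shows "q ^ (r + 1 - t) * qint q t * q ^ (p + 2) \<le> N t r"
proof -
  have "N (Suc t) r \<ge> 1" using H by (intro N_ge_1) auto
  have "q ^ (r + 1 - t) * qint q t * q ^ (p + 2) \<le> q ^ (r + 1 - t) * q ^ t * q ^ (p + 2)"
    using q_simps by (intro mult_right_mono mult_left_mono qint_le) auto
  also have "\<dots> = q ^ (r + p + 3)"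
  proof -
    have "r + 1 - t + t + (p + 2) = r + p + 3" using H by simp
    then show ?thesis by (metis power_add)
  qed
  also have "\<dots> \<le> q ^ (r + p + 3) * N (Suc t) r"
    using \<open>N (Suc t) r \<ge> 1\<close> q_simps by simp
  also have "\<dots> \<le> N t r" using H by (intro N_Suc_power_le) auto
  finally show ?thesis .
qed

end

section \<open>The extremal families\<close>

context symplectic_space
begin

lemma N_Suc_less:
  assumes "s < m" "m \<le> \<nu>"
  shows "N (Suc s) m < N s m"
proof -
  have "q ^ 1 * N (Suc s) m \<le> N s m" using assms by (intro N_Suc_power_le) auto
  moreover have "N (Suc s) m > 0" using assms by (intro N_pos) auto
  moreover from this have "1 * N (Suc s) m < q ^ 1 * N (Suc s) m"
    using q_ge_2 by (intro mult_strict_right_mono) auto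
  ultimately show ?thesis by linarith
qed

text \<open>Otherwise all spaces above \<open>U\<close> would lie above a space of one dimension
  more, contradicting the strict decrease of \<open>N\<close>.\<close>

lemma ex_Pm_avoiding:
  assumes U: "U \<in> Pm f s" and "s < m" "m \<le> \<nu>" "x \<notin> U"
  shows "\<exists>F\<in>Pm f m. U \<subseteq> F \<and> x \<notin> F"
proof (rule ccontr)
  assume "\<not> ?thesis"
  then have x: "x \<in> F" if "F \<in> Pm f m" "U \<subseteq> F" for F using that by blast
  define S where "S = vec.span (insert x U)"
  have S: "S \<in> exts U UNIV"
    unfolding S_def using PmD(1)[OF U] \<open>x \<notin> U\<close> by (intro span_insert_exts) auto
  have "S \<subseteq> F" if "F \<in> Pm f m" "U \<subseteq> F" for F
    unfolding S_def using that x[OF that] PmD(1) by (intro vec.span_minimal) auto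
  then have "{F \<in> Pm f m. U \<subseteq> F} \<subseteq> {F \<in> Pm f m. S \<subseteq> F}" by blast
  then have "card {F \<in> Pm f m. U \<subseteq> F} \<le> card {F \<in> Pm f m. S \<subseteq> F}"
    by (intro card_mono) auto
  then have "N s m \<le> real (card {F \<in> Pm f m. S \<subseteq> F})" using card_Pm_above[OF U, of m] by simp
  also have "\<dots> \<le> N (Suc s) m"
    using S PmD(2)[OF U] by (intro card_above_le) (auto simp: exts_def)
  finally show False using N_Suc_less[of s m] assms by simp
qed

lemma ex_Pm: "m \<le> \<nu> \<Longrightarrow> \<exists>F. F \<in> Pm f m"
proof -
  assume m: "m \<le> \<nu>"
  have "{0} \<in> Pm f 0" by (intro PmI) auto
  then have "real (card {F \<in> Pm f m. {0} \<subseteq> F}) > 0"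
    using card_Pm_above[of "{0}" 0 m] N_pos[of 0 m] m by simp
  then show ?thesis by (force simp: card_gt_0_iff)
qed

lemma Pm_eq_of_subset:
  "T \<in> Pm f t \<Longrightarrow> T' \<in> Pm f t \<Longrightarrow> T \<subseteq> T' \<Longrightarrow> T = T'"
  using vec.subspace_dim_equal[of T T'] PmD(1,2) by auto

text \<open>Used for non-triviality: a common subspace of all totally isotropic spaces above
  \<open>T\<close> can only be \<open>T\<close>.\<close>

lemma common_subspace_unique:
  assumes "T \<in> Pm f t" "T' \<in> Pm f t" "t < m" "m \<le> \<nu>"
    and "\<And>F. F \<in> Pm f m \<Longrightarrow> T \<subseteq> F \<Longrightarrow> T' \<subseteq> F"
  shows "T' = T"
  using ex_Pm_avoiding[OF assms(1,3,4)] Pm_eq_of_subset[OF assms(2,1)] assms(5) by blast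

lemma card_hyperplanes:
  assumes "S \<in> Pm f (Suc k)"
  shows "real (card {W. vec.subspace W \<and> W \<subseteq> S \<and> vec.dim W = k}) = qint q (Suc k)"
proof -
  have "{W. vec.subspace W \<and> W \<subseteq> S \<and> vec.dim W = k} =
    {W. vec.subspace W \<and> {0} \<subseteq> W \<and> W \<subseteq> S \<and> vec.dim W = k}"
    using vec.subspace_0 by auto
  then show ?thesis
    using card_subspaces_between[of "{0}" S k] PmD[OF assms] vec.subspace_0[of S] q_simps
    by (simp add: qbinom_hyperplanes flip: q_def)
qed

lemma card_hyperplanes_not_above:
  assumes T: "T \<in> Pm f t" and M: "M \<in> Pm f (r + 1)" and TM: "T \<subseteq> M" and "t \<le> r"
  shows "real (card {W \<in> subspaces_of M r. \<not> T \<subseteq> W}) = q ^ (r + 1 - t) * qint q t"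
proof -
  have "{W \<in> subspaces_of M r. \<not> T \<subseteq> W} =
    subspaces_of M r - {W. vec.subspace W \<and> T \<subseteq> W \<and> W \<subseteq> M \<and> vec.dim W = r}"
    by (auto simp: subspaces_of_def)
  moreover have sub: "{W. vec.subspace W \<and> T \<subseteq> W \<and> W \<subseteq> M \<and> vec.dim W = r} \<subseteq> subspaces_of M r"
    by (auto simp: subspaces_of_def)
  moreover have "card {W. vec.subspace W \<and> T \<subseteq> W \<and> W \<subseteq> M \<and> vec.dim W = r} \<le> card (subspaces_of M r)"
    using sub by (intro card_mono) auto
  moreover have "real (card (subspaces_of M r)) = qint q (r + 1)"
    using card_hyperplanes[of M r] M by (simp add: subspaces_of_def)
  moreover have "real (card {W. vec.subspace W \<and> T \<subseteq> W \<and> W \<subseteq> M \<and> vec.dim W = r}) = qint q (r + 1 - t)"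
    using card_subspaces_between[of T M r] PmD[OF T] PmD[OF M] TM \<open>t \<le> r\<close> q_simps
    by (simp add: Suc_diff_le qbinom_hyperplanes flip: q_def)
  ultimately have "real (card {W \<in> subspaces_of M r. \<not> T \<subseteq> W}) = qint q (r + 1) - qint q (r + 1 - t)"
    by (simp add: card_Diff_subset)
  also have "\<dots> = q ^ (r + 1 - t) * qint q t"
    using qint_add[of q "r + 1 - t" t] \<open>t \<le> r\<close> by simp
  finally show ?thesis .
qed

lemma card_C2:
  assumes T: "T \<in> Pm f t" and M: "M \<in> Pm f (r + 1)" and TM: "T \<subseteq> M" and "t \<le> r"
  shows "real (card (C2 f M T r)) = N t r + q ^ (r + 1 - t) * qint q t"
proof -
  have "C2 f M T r = {F \<in> Pm f r. T \<subseteq> F} \<union> {W \<in> subspaces_of M r. \<not> T \<subseteq> W}"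
    using Pm_subspace[OF M] by (auto simp: C2_def subspaces_of_def)
  moreover have "card ({F \<in> Pm f r. T \<subseteq> F} \<union> {W \<in> subspaces_of M r. \<not> T \<subseteq> W}) =
    card {F \<in> Pm f r. T \<subseteq> F} + card {W \<in> subspaces_of M r. \<not> T \<subseteq> W}"
    by (intro card_Un_disjoint) auto
  ultimately show ?thesis
    using card_Pm_above[OF T, of r] card_hyperplanes_not_above[OF assms] by simp
qed

lemma card_C3: "S \<in> Pm f (t + 1) \<Longrightarrow> real (card (C3 f S p)) = N (t + 1) p"
  using card_Pm_above[of S "t + 1" p] by (simp add: C3_def)

lemma card_Pm_above_not_above:
  assumes "W \<in> Pm f s" "S \<in> Pm f s'" "W \<subseteq> S"
  shows "real (card {F \<in> Pm f r. W \<subseteq> F \<and> \<not> S \<subseteq> F}) = N s r - N s' r"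
proof -
  have "{F \<in> Pm f r. W \<subseteq> F \<and> \<not> S \<subseteq> F} = {F \<in> Pm f r. W \<subseteq> F} - {F \<in> Pm f r. S \<subseteq> F}" by auto
  moreover have "{F \<in> Pm f r. S \<subseteq> F} \<subseteq> {F \<in> Pm f r. W \<subseteq> F}" using assms by auto
  moreover from this have "card {F \<in> Pm f r. S \<subseteq> F} \<le> card {F \<in> Pm f r. W \<subseteq> F}"
    by (intro card_mono) auto
  ultimately show ?thesis
    using card_Pm_above[OF assms(1), of r] card_Pm_above[OF assms(2), of r] by (simp add: card_Diff_subset)
qed

text \<open>Members not above \<open>S\<close> are sorted by \<open>F \<inter> S\<close>, which is
  then one of the [t+1] hyperplanes of \<open>S\<close>. Writing [t+1] - 1 as q[t] gives the stated
  correction.\<close>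

lemma card_C4:
  assumes S: "S \<in> Pm f (t + 1)"
  shows "real (card (C4 f S r t)) = qint q (t + 1) * N t r - q * qint q t * N (t + 1) r"
proof -
  note S' = PmD(1,2)[OF S]
  define hyps where "hyps = {W. vec.subspace W \<and> W \<subseteq> S \<and> vec.dim W = t}"
  have hypsD: "W \<in> Pm f t" "W \<subseteq> S" if "W \<in> hyps" for W
    using that Pm_subspace[OF S] by (auto simp: hyps_def)
  have big: "S \<subseteq> F" if "F \<in> Pm f r" "t < vec.dim (F \<inter> S)" for F
  proof -
    have "F \<inter> S = S"
      using vec.subspace_dim_equal[of "F \<inter> S" S] subspace_PmI[OF that(1) S] S' that by auto
    then show ?thesis by blast
  qed
  have "C4 f S r t = {F \<in> Pm f r. S \<subseteq> F} \<union> (\<Union>W\<in>hyps. {F \<in> Pm f r. W \<subseteq> F \<and> \<not> S \<subseteq> F})" (is "_ = ?A \<union> ?B")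
  proof (intro equalityI subsetI)
    fix F assume F: "F \<in> C4 f S r t"
    then have FP: "F \<in> Pm f r" "t \<le> vec.dim (F \<inter> S)" by (auto simp: C4_def)
    show "F \<in> ?A \<union> ?B"
    proof (cases "S \<subseteq> F")
      case False
      then have "vec.dim (F \<inter> S) = t" using big[OF FP(1)] FP(2) False by linarith
      then have "F \<inter> S \<in> hyps" using subspace_PmI[OF FP(1) S] by (auto simp: hyps_def)
      then show ?thesis using FP False by blast
    qed (use FP in auto)
  next
    fix F assume "F \<in> ?A \<union> ?B"
    then obtain W where "F \<in> Pm f r" "W \<subseteq> F" "W \<subseteq> S" "vec.dim W \<ge> t"
      using S' by (auto simp: hyps_def)
    then show "F \<in> C4 f S r t" using vec.dim_subset[of W "F \<inter> S"] by (auto simp: C4_def)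
  qed
  moreover have "card (?A \<union> ?B) = card ?A + card ?B" by (intro card_Un_disjoint) auto
  moreover have "card ?B = (\<Sum>W\<in>hyps. card {F \<in> Pm f r. W \<subseteq> F \<and> \<not> S \<subseteq> F})"
  proof (rule card_UN_disjoint)
    show "\<forall>W\<in>hyps. \<forall>W'\<in>hyps. W \<noteq> W' \<longrightarrow>
      {F \<in> Pm f r. W \<subseteq> F \<and> \<not> S \<subseteq> F} \<inter> {F \<in> Pm f r. W' \<subseteq> F \<and> \<not> S \<subseteq> F} = {}"
    proof (intro ballI impI equals0I)
      fix W W' F assume W: "W \<in> hyps" "W' \<in> hyps" "W \<noteq> W'"
        and F: "F \<in> {F \<in> Pm f r. W \<subseteq> F \<and> \<not> S \<subseteq> F} \<inter> {F \<in> Pm f r. W' \<subseteq> F \<and> \<not> S \<subseteq> F}"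
      then have FP: "F \<in> Pm f r" "W \<subseteq> F \<inter> S" "W' \<subseteq> F \<inter> S" "\<not> S \<subseteq> F" using hypsD by auto
      have "\<not> W' \<subseteq> W" using Pm_eq_of_subset[OF hypsD(1)[OF W(2)] hypsD(1)[OF W(1)]] W(3) by auto
      then have "W \<subset> F \<inter> S" using FP by blast
      then have "t < vec.dim (F \<inter> S)"
        using dim_strict_mono[OF _ subspace_PmI[OF FP(1) S], of W] W by (auto simp: hyps_def)
      then show False using big FP by blast
    qed
  qed auto
  ultimately have "real (card (C4 f S r t)) =
    real (card ?A) + (\<Sum>W\<in>hyps. real (card {F \<in> Pm f r. W \<subseteq> F \<and> \<not> S \<subseteq> F}))"
    by simp
  also have "\<dots> = N (t + 1) r + real (card hyps) * (N t r - N (t + 1) r)"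
    using card_Pm_above[OF S, of r] card_Pm_above_not_above[OF hypsD(1) S hypsD(2)] by simp
  also have "real (card hyps) = qint q (Suc t)"
    using card_hyperplanes[of S t] S by (simp add: hyps_def)
  finally show ?thesis by (simp add: qint_Suc_eq algebra_simps)
qed

lemma C1_eq_UN:
  assumes T: "T \<in> Pm f t" and M: "M \<in> Pm f k" and TM: "T \<subseteq> M"
  shows "C1 f M T p t = (\<Union>S\<in>exts T M. {F \<in> Pm f p. S \<subseteq> F})"
proof (intro equalityI subsetI)
  fix F assume "F \<in> C1 f M T p t"
  then have F: "F \<in> Pm f p" "T \<subseteq> F" "t < vec.dim (F \<inter> M)" by (auto simp: C1_def)
  then have "\<not> F \<inter> M \<subseteq> T" using vec.dim_subset[of "F \<inter> M" T] PmD(2)[OF T] by auto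
  then obtain x where "x \<in> F" "x \<in> M" "x \<notin> T" by auto
  then have "vec.span (insert x T) \<in> exts T M"
    using PmD(1)[OF T] PmD(1)[OF M] TM by (intro span_insert_exts) auto
  moreover have "vec.span (insert x T) \<subseteq> F"
    using PmD(1)[OF F(1)] F(2) \<open>x \<in> F\<close> by (intro vec.span_minimal) auto
  ultimately show "F \<in> (\<Union>S\<in>exts T M. {F \<in> Pm f p. S \<subseteq> F})" using F by blast
next
  fix F assume "F \<in> (\<Union>S\<in>exts T M. {F \<in> Pm f p. S \<subseteq> F})"
  then obtain S where "S \<in> exts T M" "F \<in> Pm f p" "S \<subseteq> F" by blast
  then show "F \<in> C1 f M T p t"
    using vec.dim_subset[of S "F \<inter> M"] PmD(2)[OF T] by (auto simp: C1_def exts_def)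
qed

lemma exts_in_Pm:
  assumes "T \<in> Pm f t" "M \<in> Pm f k" "S \<in> exts T M"
  shows "S \<in> Pm f (t + 1)"
  using assms Pm_subspace[OF assms(2), of S "t + 1"] PmD(2)[OF assms(1)] by (auto simp: exts_def)

lemma card_exts_Pm:
  assumes "T \<in> Pm f t" "M \<in> Pm f k" "T \<subseteq> M"
  shows "real (card (exts T M)) = qint q (k - t)"
  using card_exts[of T M] assms PmD[OF assms(1)] PmD[OF assms(2)] by (simp add: q_def)

text \<open>Two different extensions of \<open>T\<close> span a space of dimension
  \<open>t + 2\<close> inside \<open>M\<close>; this governs the overlaps in \<open>C1\<close> in
  both directions.\<close>

lemma exts_join:
  assumes T: "T \<in> Pm f t" and M: "M \<in> Pm f k" and TM: "T \<subseteq> M"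
    and S: "S \<in> exts T M" "S' \<in> exts T M" "S \<noteq> S'"
  shows "\<exists>R\<in>exts S M. R \<subseteq> vec.span (S \<union> S') \<and> S' \<subseteq> R"
proof -
  note SP = exts_in_Pm[OF T M S(1)] exts_in_Pm[OF T M S(2)]
  have "\<not> S' \<subseteq> S" using Pm_eq_of_subset[OF SP(2,1)] S by auto
  then obtain x where x: "x \<in> S'" "x \<notin> S" by auto
  have sub: "vec.subspace S" "S \<subseteq> M" "S' \<subseteq> M" "T \<subseteq> S" using S by (auto simp: exts_def)
  have R: "vec.span (insert x S) \<in> exts S M"
    using sub x PmD(1)[OF M] by (intro span_insert_exts) auto
  have "x \<notin> T" using x sub by auto
  then have "S' = vec.span (insert x T)" using exts_eq_span[OF PmD(1)[OF T] S(2) x(1)] by simp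
  also have "\<dots> \<subseteq> vec.span (insert x S)" using sub by (intro vec.span_mono) auto
  finally have "S' \<subseteq> vec.span (insert x S)" .
  moreover have "vec.span (insert x S) \<subseteq> vec.span (S \<union> S')"
    using x by (intro vec.span_mono) auto
  ultimately show ?thesis using R by blast
qed

lemma card_C1_le:
  assumes T: "T \<in> Pm f t" and M: "M \<in> Pm f (r + 1)" and TM: "T \<subseteq> M"
  shows "real (card (C1 f M T p t)) \<le> qint q (r + 1 - t) * N (t + 1) p"
proof -
  have "real (card (C1 f M T p t)) \<le> real (card (exts T M)) * N (t + 1) p"
  proof (rule card_UN_le_mult)
    show "C1 f M T p t \<subseteq> (\<Union>S\<in>exts T M. {F \<in> Pm f p. S \<subseteq> F})"
      using C1_eq_UN[OF assms] by simp
    show "real (card {F \<in> Pm f p. S \<subseteq> F}) \<le> N (t + 1) p" if "S \<in> exts T M" for S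
      using card_Pm_above[OF exts_in_Pm[OF T M that], of p] by simp
  qed auto
  then show ?thesis using card_exts_Pm[OF assms] by simp
qed

text \<open>With one extension \<open>S0\<close> fixed, members above another \<open>S\<close> but
  not above \<open>S0\<close> avoid the join \<open>R\<close> of both. Each of the other extensions
  thus loses N(t+2, p), the overlap term that decides the case m2 = 2t.\<close>

lemma card_C1_le_refined:
  assumes T: "T \<in> Pm f t" and M: "M \<in> Pm f (r + 1)" and TM: "T \<subseteq> M" and "t \<le> r"
  shows "real (card (C1 f M T p t)) \<le>
    qint q (r + 1 - t) * N (t + 1) p - (qint q (r + 1 - t) - 1) * N (t + 2) p"
proof -
  have "real (card (exts T M)) > 0"
    unfolding card_exts_Pm[OF assms(1-3)] using q_simps assms by (intro qint_pos) auto
  then obtain S0 where S0: "S0 \<in> exts T M" by (force simp: card_gt_0_iff)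
  note S0P = exts_in_Pm[OF T M S0]
  have "C1 f M T p t \<subseteq> {F \<in> Pm f p. S0 \<subseteq> F} \<union>
    (\<Union>S\<in>exts T M - {S0}. {F \<in> Pm f p. S \<subseteq> F \<and> \<not> S0 \<subseteq> F})" (is "_ \<subseteq> ?A \<union> ?B")
    unfolding C1_eq_UN[OF assms(1-3)] by blast
  then have "card (C1 f M T p t) \<le> card (?A \<union> ?B)" by (intro card_mono) auto
  also have "\<dots> \<le> card ?A + card ?B" by (rule card_Un_le)
  finally have "real (card (C1 f M T p t)) \<le> real (card ?A) + real (card ?B)" by linarith
  also have "real (card ?A) = N (t + 1) p" using card_Pm_above[OF S0P] .
  also have "real (card ?B) \<le> real (card (exts T M - {S0})) * (N (t + 1) p - N (t + 2) p)"
  proof (rule card_UN_le_mult)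
    fix S assume S: "S \<in> exts T M - {S0}"
    then have SP: "S \<in> Pm f (t + 1)" using exts_in_Pm[OF T M] by auto
    obtain R where R: "R \<in> exts S M" "R \<subseteq> vec.span (S \<union> S0)" "S0 \<subseteq> R"
      using exts_join[OF T M TM, of S S0] S S0 by auto
    have RP: "R \<in> Pm f (t + 2)" using exts_in_Pm[OF SP M R(1)] by simp
    have "{F \<in> Pm f p. S \<subseteq> F \<and> \<not> S0 \<subseteq> F} \<subseteq> {F \<in> Pm f p. S \<subseteq> F \<and> \<not> R \<subseteq> F}"
      using R by blast
    then have "card {F \<in> Pm f p. S \<subseteq> F \<and> \<not> S0 \<subseteq> F} \<le> card {F \<in> Pm f p. S \<subseteq> F \<and> \<not> R \<subseteq> F}"
      by (intro card_mono) auto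
    moreover have "S \<subseteq> R" using R by (simp add: exts_def)
    ultimately show "real (card {F \<in> Pm f p. S \<subseteq> F \<and> \<not> S0 \<subseteq> F}) \<le> N (t + 1) p - N (t + 2) p"
      using card_Pm_above_not_above[OF SP RP \<open>S \<subseteq> R\<close>, of p] by linarith
  qed auto
  also have "real (card (exts T M - {S0})) = qint q (r + 1 - t) - 1"
  proof -
    have "card (exts T M) = Suc (card (exts T M - {S0}))" using S0 by (intro card.remove) auto
    then show ?thesis using card_exts_Pm[OF assms(1-3)] by simp
  qed
  finally show ?thesis by (simp add: algebra_simps)
qed

text \<open>Keeps only the members for which \<open>F \<inter> M\<close> is exactly one extension
  \<open>S\<close>. These classes \<open>E S\<close> are disjoint by \<open>exts_join\<close>, and a
  union bound over the extensions of \<open>S\<close> inside \<open>M\<close> controls what is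
  removed.\<close>

lemma card_C1_ge:
  assumes T: "T \<in> Pm f t" and M: "M \<in> Pm f (r + 1)" and TM: "T \<subseteq> M" and "t \<le> r"
  shows "qint q (r + 1 - t) * (N (t + 1) p - qint q (r - t) * N (t + 2) p) \<le> real (card (C1 f M T p t))"
proof -
  define E where "E S = {F \<in> Pm f p. S \<subseteq> F} - (\<Union>R\<in>exts S M. {F \<in> Pm f p. R \<subseteq> F})" for S
  have "(\<Sum>S\<in>exts T M. N (t + 1) p - qint q (r - t) * N (t + 2) p) \<le> (\<Sum>S\<in>exts T M. real (card (E S)))"
  proof (rule sum_mono)
    fix S assume S: "S \<in> exts T M"
    note SP = exts_in_Pm[OF T M S]
    have SM: "S \<subseteq> M" using S by (auto simp: exts_def)
    have "real (card (\<Union>R\<in>exts S M. {F \<in> Pm f p. R \<subseteq> F})) \<le> real (card (exts S M)) * N (t + 2) p"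
    proof (rule card_UN_le_mult)
      show "real (card {F \<in> Pm f p. R \<subseteq> F}) \<le> N (t + 2) p" if "R \<in> exts S M" for R
        using card_Pm_above[OF exts_in_Pm[OF SP M that], of p] by simp
    qed auto
    moreover have "real (card (exts S M)) = qint q (r - t)"
      using card_exts_Pm[OF SP M SM] by simp
    moreover have "card {F \<in> Pm f p. S \<subseteq> F} \<le> card (E S) + card (\<Union>R\<in>exts S M. {F \<in> Pm f p. R \<subseteq> F})"
      unfolding E_def by (rule order_trans[OF _ card_Un_le]) (auto intro!: card_mono)
    ultimately show "N (t + 1) p - qint q (r - t) * N (t + 2) p \<le> real (card (E S))"
      using card_Pm_above[OF SP, of p] by (simp flip: of_nat_add)
  qed
  also have "(\<Sum>S\<in>exts T M. real (card (E S))) = real (card (\<Union>S\<in>exts T M. E S))"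
  proof -
    have "E S \<inter> E S' = {}" if S: "S \<in> exts T M" "S' \<in> exts T M" "S \<noteq> S'" for S S'
    proof (rule equals0I)
      fix F assume F: "F \<in> E S \<inter> E S'"
      obtain R where R: "R \<in> exts S M" "R \<subseteq> vec.span (S \<union> S')"
        using exts_join[OF T M TM S] by blast
      have "vec.span (S \<union> S') \<subseteq> F"
        using F PmD(1) by (intro vec.span_minimal) (auto simp: E_def)
      then have "R \<subseteq> F" using R by blast
      then show False using F R(1) unfolding E_def by blast
    qed
    then have "card (\<Union>S\<in>exts T M. E S) = (\<Sum>S\<in>exts T M. card (E S))"
      by (intro card_UN_disjoint) auto
    then show ?thesis by simp
  qed
  also have "\<dots> \<le> real (card (C1 f M T p t))"
    unfolding C1_eq_UN[OF assms(1-3)] of_nat_le_iff by (intro card_mono) (auto simp: E_def)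
  finally show ?thesis using card_exts_Pm[OF assms(1-3)] by simp
qed

text \<open>A hyperplane \<open>B\<close> of \<open>M\<close> lowers the dimension of
  \<open>A \<inter> M\<close> by at most one, which gives cross intersection. For non-triviality, a
  common subspace would have to be \<open>T\<close>, but some hyperplane of \<open>M\<close> misses
  part of \<open>T\<close>.\<close>

lemma C1_C2_pair:
  assumes T: "T \<in> Pm f t" and M: "M \<in> Pm f (r + 1)" and TM: "T \<subseteq> M"
    and tr: "1 \<le> t" "t < r" "r \<le> \<nu>"
  shows "C1 f M T p t \<subseteq> Pm f p" "C2 f M T r \<subseteq> Pm f r"
    "cross_t_intersecting t (C1 f M T p t) (C2 f M T r)" "\<not> trivial_pair f t (C1 f M T p t) (C2 f M T r)"
proof -
  show "C1 f M T p t \<subseteq> Pm f p" by (auto simp: C1_def)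
  show "C2 f M T r \<subseteq> Pm f r"
    using Pm_subspace[OF M] by (auto simp: C2_def subspaces_of_def)
  show "cross_t_intersecting t (C1 f M T p t) (C2 f M T r)"
    unfolding cross_t_intersecting_def
  proof (intro ballI)
    fix A B assume A: "A \<in> C1 f M T p t" and B: "B \<in> C2 f M T r"
    show "t \<le> vec.dim (A \<inter> B)"
    proof (cases "T \<subseteq> B")
      case True
      then show ?thesis
        using vec.dim_subset[of T "A \<inter> B"] A PmD(2)[OF T] by (auto simp: C1_def)
    next
      case False
      then have B': "vec.subspace B" "B \<subseteq> M" "vec.dim B = r"
        using B by (auto simp: C2_def subspaces_of_def)
      have A': "A \<in> Pm f p" "t + 1 \<le> vec.dim (A \<inter> M)" using A by (auto simp: C1_def)
      have "vec.dim (A \<inter> M) + vec.dim B \<le> vec.dim M + vec.dim ((A \<inter> M) \<inter> B)"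
        using B' PmD(1)[OF M] subspace_PmI[OF A'(1) M] by (intro dim_inter_ge) auto
      also have "vec.dim ((A \<inter> M) \<inter> B) \<le> vec.dim (A \<inter> B)" by (intro vec.dim_subset) auto
      finally show ?thesis using A' B' PmD(2)[OF M] by simp
    qed
  qed
  show "\<not> trivial_pair f t (C1 f M T p t) (C2 f M T r)"
  proof
    assume "trivial_pair f t (C1 f M T p t) (C2 f M T r)"
    then obtain T' where T': "T' \<in> Pm f t" "\<And>F. F \<in> C2 f M T r \<Longrightarrow> T' \<subseteq> F"
      by (auto simp: trivial_pair_def)
    have eq: "T' = T"
      using T' tr by (intro common_subspace_unique[OF T T'(1), of r]) (auto simp: C2_def)
    have "real (card {W \<in> subspaces_of M r. \<not> T \<subseteq> W}) > 0"
      using card_hyperplanes_not_above[OF T M TM] tr q_simps qint_pos[of q t] by simp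
    then obtain W where "W \<in> subspaces_of M r" "\<not> T \<subseteq> W" by (force simp: card_gt_0_iff)
    then show False using T'(2)[of W] eq by (auto simp: C2_def)
  qed
qed

text \<open>All spaces above any hyperplane of \<open>S\<close> belong to \<open>C4\<close>, so a
  common \<open>t\<close>-subspace would have to equal every hyperplane of \<open>S\<close>, and
  there are more than one.\<close>

lemma C3_C4_pair:
  assumes S: "S \<in> Pm f (t + 1)" and tr: "1 \<le> t" "t < r" "r \<le> \<nu>"
  shows "C3 f S p \<subseteq> Pm f p" "C4 f S r t \<subseteq> Pm f r"
    "cross_t_intersecting t (C3 f S p) (C4 f S r t)" "\<not> trivial_pair f t (C3 f S p) (C4 f S r t)"
proof -
  show "C3 f S p \<subseteq> Pm f p" "C4 f S r t \<subseteq> Pm f r" by (auto simp: C3_def C4_def)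
  show "cross_t_intersecting t (C3 f S p) (C4 f S r t)"
    unfolding cross_t_intersecting_def
  proof (intro ballI)
    fix A B assume "A \<in> C3 f S p" "B \<in> C4 f S r t"
    then have "B \<inter> S \<subseteq> A \<inter> B" "t \<le> vec.dim (B \<inter> S)" by (auto simp: C3_def C4_def)
    then show "t \<le> vec.dim (A \<inter> B)"
      using vec.dim_subset[of "B \<inter> S" "A \<inter> B"] by simp
  qed
  show "\<not> trivial_pair f t (C3 f S p) (C4 f S r t)"
  proof
    assume "trivial_pair f t (C3 f S p) (C4 f S r t)"
    then obtain T' where T': "T' \<in> Pm f t" "\<And>F. F \<in> C4 f S r t \<Longrightarrow> T' \<subseteq> F"
      by (auto simp: trivial_pair_def)
    have "T' = W" if W: "vec.subspace W" "W \<subseteq> S" "vec.dim W = t" for W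
    proof (rule common_subspace_unique)
      show "W \<in> Pm f t" using Pm_subspace[OF S W] .
      fix F assume "F \<in> Pm f r" "W \<subseteq> F"
      then have "F \<in> C4 f S r t"
        using vec.dim_subset[of W "F \<inter> S"] W by (auto simp: C4_def)
      then show "T' \<subseteq> F" by (rule T'(2))
    qed (use T' tr in auto)
    then have "{W. vec.subspace W \<and> W \<subseteq> S \<and> vec.dim W = t} \<subseteq> {T'}" by blast
    then have "card {W. vec.subspace W \<and> W \<subseteq> S \<and> vec.dim W = t} \<le> card {T'}"
      by (intro card_mono) auto
    then have "qint q (Suc t) \<le> 1" using card_hyperplanes[of S t] S by simp
    moreover have "qint q (Suc 1) \<le> qint q (Suc t)" using q_simps tr by (intro qint_mono) auto
    ultimately show False using q_simps by (simp add: qint_Suc)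
  qed
qed

text \<open>The 1/8 pays for the overlaps subtracted in \<open>card_C1_ge\<close>; of
  \<open>C2\<close> only the N(t, m2) spaces above \<open>T\<close> are counted here.\<close>

lemma C1_C2_product_ge:
  assumes T: "T \<in> Pm f t" and M: "M \<in> Pm f (m2 + 1)" and TM: "T \<subseteq> M"
    and H: "1 \<le> t" "t < m2" "m2 \<le> m1" "2 * m1 + m2 + t + 3 \<le> 2 * \<nu>"
  shows "(qint q (m2 - t + 1) - 1 / 8) * (N (t + 1) m1 * N t m2) \<le>
    real (card (C1 f M T m1 t)) * real (card (C2 f M T m2))"
proof -
  define x where "x = N (t + 1) m1"
  have x: "x \<ge> 0" unfolding x_def by (rule N_nonneg)
  have err: "qint q (m2 - t + 1) * qint q (m2 - t) * N (t + 2) m1 \<le> 1 / 8 * x"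
  proof (cases "t + 1 < m1")
    case True
    have "(qint q (Suc (m2 - t)) * qint q (m2 - t)) * N (Suc (Suc t)) m1 \<le> 1 / 8 * N (Suc t) m1"
    proof (rule power_N_Suc_le[where k = "4 + 2 * (m2 - t)"])
      have "qint q (Suc (m2 - t)) * qint q (m2 - t) \<le> (2 * q ^ (m2 - t)) * q ^ (m2 - t)"
        using q_simps by (intro mult_mono qint_Suc_le qint_le qint_nonneg) auto
      also have "\<dots> = 1 / 8 * (2 ^ 4 * q ^ (2 * (m2 - t)))" by (simp add: power_even_eq power2_eq_square)
      also have "\<dots> \<le> 1 / 8 * q ^ (4 + 2 * (m2 - t))"
        using two_power_le[of 4 "2 * (m2 - t)"] by linarith
      finally show "qint q (Suc (m2 - t)) * qint q (m2 - t) \<le> 1 / 8 * q ^ (4 + 2 * (m2 - t))" .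
    qed (use H True in auto)
    then show ?thesis by (simp add: x_def)
  next
    case False
    then have "N (t + 2) m1 = 0" using H by (simp add: N_def)
    then show ?thesis using x by simp
  qed
  have "(qint q (m2 - t + 1) - 1 / 8) * x \<le> qint q (m2 - t + 1) * (x - qint q (m2 - t) * N (t + 2) m1)"
    using err by (simp add: algebra_simps)
  also have "\<dots> \<le> real (card (C1 f M T m1 t))"
    using card_C1_ge[OF T M TM, of m1] H by (simp add: x_def Suc_diff_le)
  finally have "(qint q (m2 - t + 1) - 1 / 8) * x \<le> real (card (C1 f M T m1 t))" .
  moreover have "N t m2 \<le> real (card (C2 f M T m2))"
    using card_C2[OF T M TM] H q_simps qint_nonneg[of q t] by simp
  ultimately have "(qint q (m2 - t + 1) - 1 / 8) * x * N t m2 \<le>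
      real (card (C1 f M T m1 t)) * real (card (C2 f M T m2))"
    by (intro mult_mono N_nonneg) auto
  then show ?thesis by (simp add: x_def mult_ac)
qed

lemma C1_C2_product_le:
  assumes T: "T \<in> Pm f t" and M: "M \<in> Pm f (r + 1)" and TM: "T \<subseteq> M"
    and H: "1 \<le> t" "t < r" "2 * r + p + t + 3 \<le> 2 * \<nu>"
  shows "real (card (C1 f M T p t)) * real (card (C2 f M T r)) \<le>
    qint q (r - t + 1) * (1 + 1 / q ^ (p + 2)) * (N (t + 1) p * N t r)"
proof -
  have "real (card (C2 f M T r)) \<le> (1 + 1 / q ^ (p + 2)) * N t r"
    using card_C2[OF T M TM] hyperplane_bonus_le[of t r p] H q_simps by (simp add: field_simps)
  moreover have "real (card (C1 f M T p t)) \<le> qint q (r - t + 1) * N (t + 1) p"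
    using card_C1_le[OF T M TM, of p] H by (simp add: Suc_diff_le)
  ultimately have "real (card (C1 f M T p t)) * real (card (C2 f M T r)) \<le>
      (qint q (r - t + 1) * N (t + 1) p) * ((1 + 1 / q ^ (p + 2)) * N t r)"
    using q_simps by (intro mult_mono mult_nonneg_nonneg N_nonneg qint_nonneg) auto
  then show ?thesis by (simp only: mult_ac)
qed

text \<open>The 1/8 pays for the correction term in \<open>card_C4\<close>; the size of
  \<open>C3\<close> is exact.\<close>

lemma C3_C4_product_ge:
  assumes S: "S \<in> Pm f (t + 1)"
    and H: "1 \<le> t" "t < m2" "m2 \<le> m1" "2 * m1 + m2 + t + 3 \<le> 2 * \<nu>"
  shows "(qint q (t + 1) - 1 / 8) * (N (t + 1) m1 * N t m2) \<le>
    real (card (C3 f S m1)) * real (card (C4 f S m2 t))"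
proof -
  have "(q * qint q t) * N (Suc t) m2 \<le> 1 / 8 * N t m2"
  proof (rule power_N_Suc_le[where k = "3 + Suc t"])
    have "q * qint q t \<le> q * q ^ t" using q_simps by (intro mult_left_mono qint_le) auto
    then show "q * qint q t \<le> 1 / 8 * q ^ (3 + Suc t)" using two_power_le[of 3 "Suc t"] by simp
  qed (use H in auto)
  then have "N (t + 1) m1 * ((qint q (t + 1) - 1 / 8) * N t m2) \<le>
      N (t + 1) m1 * (qint q (t + 1) * N t m2 - q * qint q t * N (t + 1) m2)"
    by (intro mult_left_mono N_nonneg) (simp add: algebra_simps)
  then show ?thesis by (simp add: card_C3[OF S] card_C4[OF S] mult_ac)
qed

lemma C3_C4_product_le:
  assumes S: "S \<in> Pm f (t + 1)"
  shows "real (card (C3 f S p)) * real (card (C4 f S r t)) \<le> qint q (t + 1) * (N (t + 1) p * N t r)"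
proof -
  have "real (card (C4 f S r t)) \<le> qint q (t + 1) * N t r"
    using card_C4[OF S, of r] q_simps by (simp add: qint_nonneg N_nonneg)
  then have "N (t + 1) p * real (card (C4 f S r t)) \<le> N (t + 1) p * (qint q (t + 1) * N t r)"
    by (intro mult_left_mono N_nonneg)
  then show ?thesis by (simp add: card_C3[OF S] mult_ac)
qed

section \<open>Comparing the two extremal products when their leading coefficients agree\<close>

lemma qint_2_step: "qint q (k + 2) = q\<^sup>2 * qint q k + q + 1"
  by (simp add: numeral_2_eq_2 qint_Suc_eq algebra_simps)

text \<open>Both products have leading term (q+1) x y. After multiplication by \<open>D\<close> the
  overlap \<open>D * w\<close> is at most \<open>x\<close>, the terms in q^2 (q+1) D cancel, and q D
  against (q+1)(q^2+q+1) remains.\<close>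

lemma special_C3_C4_less_C1_C2:
  assumes T: "T \<in> Pm f 1" and M: "M \<in> Pm f 3" and TM: "T \<subseteq> M" and S: "S \<in> Pm f 2"
    and m1: "m1 = 2 \<or> m1 = 3" and H: "2 * m1 + 6 \<le> 2 * \<nu>"
  shows "real (card (C3 f S m1)) * real (card (C4 f S 2 1)) <
    real (card (C1 f M T m1 1)) * real (card (C2 f M T 2))"
proof -
  define x w y D where "x = N 2 m1" and "w = N 3 m1" and "y = N 1 2" and "D = qint q (2 * \<nu> - 4)"
  have nn: "w \<ge> 0" "y \<ge> 0" unfolding w_def y_def by (rule N_nonneg)+
  have x: "x > 0" unfolding x_def using m1 H by (intro N_pos) auto
  have q2: "qint q 2 = q + 1" by (simp add: numeral_2_eq_2 qint_Suc)
  have "2 * \<nu> - 2 = 2 * \<nu> - 4 + 2" using H m1 by auto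
  then have Y: "qint q (2 * \<nu> - 2) = q\<^sup>2 * D + q + 1" unfolding D_def using qint_2_step by metis
  have y: "y = q\<^sup>2 * D + q + 1"
    using N_rec[of 1 2] N_self[of 2] unfolding y_def Y[symmetric] by (simp add: numeral_2_eq_2)
  have "x * qint q (m1 - 2) = D * w"
    using N_rec[of 2 m1] by (simp add: x_def w_def D_def)
  \<comment> \<open>Here \<open>m1\<close> being 2 or 3 enters: the factor
    \<open>qint q (m1 - 2)\<close> is 0 or 1.\<close>
  then have wD: "D * w \<le> x" using m1 x by auto
  have "q ^ 5 \<le> q ^ (2 * \<nu> - 5)" using H m1 q_simps by (intro power_increasing) auto
  also have "\<dots> \<le> qint q (Suc (2 * \<nu> - 5))" using q_simps by (intro qint_Suc_ge) auto
  also have "Suc (2 * \<nu> - 5) = 2 * \<nu> - 4" using H m1 by auto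
  finally have D: "q ^ 5 \<le> D" by (simp add: D_def)
  have "q + 1 \<le> q\<^sup>2" "q\<^sup>2 + q + 1 \<le> q ^ 3"
  proof -
    have "2 * q \<le> q * q" using q_simps by (intro mult_right_mono) auto
    then show 1: "q + 1 \<le> q\<^sup>2" unfolding power2_eq_square using q_ge_2 by linarith
    have "2 * q\<^sup>2 \<le> q * q\<^sup>2" using q_simps by (intro mult_right_mono) auto
    then show "q\<^sup>2 + q + 1 \<le> q ^ 3" using 1 by (simp add: power2_eq_square power3_eq_cube)
  qed
  then have "(q + 1) * (q\<^sup>2 + q + 1) \<le> q\<^sup>2 * q ^ 3" using q_simps by (intro mult_mono) auto
  also have "\<dots> = 1 * q ^ 5" by (simp flip: power_add)
  also have "\<dots> < q * q ^ 5" using q_simps by (intro mult_strict_right_mono) auto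
  also have "\<dots> \<le> q * D" using D q_simps by (intro mult_left_mono) auto
  finally have key: "(q + 1) * (q\<^sup>2 + q + 1) < q * D" .
  have Dpos: "D > 0" using D q_simps by (meson less_le_trans zero_less_power)
  have "D * (x * ((q + 1) * y - q)) < D * ((q + 1) * (x - w) * (y + q\<^sup>2))"
  proof -
    have "x * ((q + 1) * (q\<^sup>2 + q + 1)) < x * (q * D)" using key x by (intro mult_strict_left_mono)
    moreover have "(D * w) * ((q + 1) * (y + q\<^sup>2)) \<le> x * ((q + 1) * (y + q\<^sup>2))"
      using wD nn q_simps by (intro mult_right_mono) auto
    ultimately show ?thesis unfolding y by (simp add: algebra_simps power2_eq_square)
  qed
  then have "x * ((q + 1) * y - q) < (q + 1) * (x - w) * (y + q\<^sup>2)" using Dpos by simp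
  moreover have "real (card (C3 f S m1)) * real (card (C4 f S 2 1)) = x * ((q + 1) * y - q)"
    using card_C3[of S 1 m1] card_C4[of S 1 2] S q2 by (simp add: x_def y_def numeral_2_eq_2)
  moreover have "(q + 1) * (x - w) \<le> real (card (C1 f M T m1 1))"
    using card_C1_ge[of T 1 M 2 m1] T M TM q2
    by (simp add: x_def w_def numeral_2_eq_2 numeral_3_eq_3)
  moreover have "real (card (C2 f M T 2)) = y + q\<^sup>2"
    using card_C2[of T 1 M 2] T M TM by (simp add: y_def)
  ultimately show ?thesis
    using nn q_simps mult_right_mono[of "(q + 1) * (x - w)" "real (card (C1 f M T m1 1))" "y + q\<^sup>2"]
    by (auto simp: not_le)
qed

text \<open>The left side represents the hyperplanes added in \<open>C2\<close> and the overlap loss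
  in \<open>C4\<close>, the right side the overlap loss in \<open>C1\<close>. For t = 1 the proof
  needs [m1-2] >= q + 1, hence \<open>4 \<le> m1\<close>.\<close>

lemma balanced_key_ineq:
  assumes H: "1 \<le> t" "2 * t \<le> m1" "2 * m1 + 3 * t + 3 \<le> 2 * \<nu>" and m1: "t = 1 \<Longrightarrow> 4 \<le> m1"
  shows "qint q (t + 1) * q ^ (t + 2) * qint q (2 * \<nu> - 2 * t - 2) + qint q t * N t (2 * t) <
    q\<^sup>2 * qint q (m1 - t - 1) * N t (2 * t)"
proof -
  define D y where "D = qint q (2 * \<nu> - 2 * t - 2)" and "y = N t (2 * t)"
  have D: "D > 0" unfolding D_def using q_simps H by (intro qint_pos) auto
  have y: "y > 0" unfolding y_def using H by (intro N_pos) auto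
  have "2 * \<nu> - 2 * t = 2 * \<nu> - 2 * t - 2 + 2" using H by simp
  then have Y: "qint q (2 * \<nu> - 2 * t) = q\<^sup>2 * D + q + 1" unfolding D_def using qint_2_step by metis
  show ?thesis
  proof (cases "t = 1")
    case True
    have yY: "y = q\<^sup>2 * D + q + 1"
      using N_rec[of 1 2] N_self[of 2] True unfolding y_def Y[symmetric] by (simp add: numeral_2_eq_2)
    have "q + 1 = qint q 2" by (simp add: numeral_2_eq_2 qint_Suc)
    also have "\<dots> \<le> qint q (m1 - t - 1)" using q_simps m1 True by (intro qint_mono) auto
    finally have m: "q\<^sup>2 * (q + 1) * y \<le> q\<^sup>2 * qint q (m1 - t - 1) * y"
      using y by (intro mult_right_mono mult_left_mono) auto
    \<comment> \<open>The factor \<open>q - 1\<close>, at least 1, is inserted to reach a multiple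
      of q^2 D, which \<open>y\<close> dominates.\<close>
    have "(q + 1) * q ^ 3 * D \<le> (q + 1) * q ^ 3 * D * (q - 1)"
      using mult_left_mono[of 1 "q - 1" "(q + 1) * q ^ 3 * D"] q_ge_2 D by simp
    also have "\<dots> = (q\<^sup>2 * (q + 1) - (q + 1) * q) * (q\<^sup>2 * D)"
      by (simp add: power2_eq_square power3_eq_cube algebra_simps)
    also have "\<dots> \<le> (q\<^sup>2 * (q + 1) - (q + 1) * q) * y"
    proof (intro mult_left_mono)
      show "q\<^sup>2 * D \<le> y" using yY q_simps by simp
      have "q * (q + 1) \<le> q\<^sup>2 * (q + 1)" using q_simps by (intro mult_right_mono) (auto simp: power2_eq_square)
      then show "0 \<le> q\<^sup>2 * (q + 1) - (q + 1) * q" by (simp add: mult.commute)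
    qed
    also have "\<dots> < (q\<^sup>2 * (q + 1) - 1) * y"
    proof (intro mult_strict_right_mono y)
      have "3 * 2 \<le> (q + 1) * q" using q_ge_2 by (intro mult_mono) auto
      then show "q\<^sup>2 * (q + 1) - (q + 1) * q < q\<^sup>2 * (q + 1) - 1" by simp
    qed
    finally have "(q + 1) * q ^ 3 * D + y < q\<^sup>2 * (q + 1) * y" by (simp add: algebra_simps)
    also note m
    finally show ?thesis
      using True by (simp add: D_def y_def qint_Suc numeral_2_eq_2 numeral_3_eq_3 add.commute[of 1 q])
  next
    case False
    then have t2: "2 \<le> t" using H by simp
    \<comment> \<open>Two steps of the recursion give y [t] [t-1] >= q^2 D^2. So \<open>y\<close>
      exceeds [t+1] q^(t+2) D, and 1 + [t] <= q^2 [t-1] is all that is left to check.\<close>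
    have "N (Suc (Suc t)) (2 * t) \<ge> 1" using H t2 by (intro N_ge_1) auto
    then have "D * 1 \<le> D * N (Suc (Suc t)) (2 * t)" using D by (intro mult_left_mono) auto
    also have "\<dots> = N (Suc t) (2 * t) * qint q (t - 1)"
      using N_rec[of "Suc t" "2 * t"] by (simp add: D_def)
    finally have "(q\<^sup>2 * D) * D \<le> qint q (2 * \<nu> - 2 * t) * (N (Suc t) (2 * t) * qint q (t - 1))"
      using Y D q_simps by (intro mult_mono) auto
    also have "\<dots> = y * (qint q t * qint q (t - 1))"
      using N_rec[of t "2 * t"] by (simp add: y_def)
    finally have yD: "(q\<^sup>2 * D) * D \<le> y * (qint q t * qint q (t - 1))" .
    have "(qint q (t + 1) * q ^ (t + 2)) * (qint q t * qint q (t - 1)) \<le>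
        ((2 * q ^ t) * q ^ (t + 2)) * (q ^ t * q ^ (t - 1))"
      using q_simps qint_Suc_le[of q t] by (intro mult_mono qint_le mult_nonneg_nonneg qint_nonneg) auto
    also have "\<dots> = 2 ^ 1 * q ^ (4 * t + 1)"
    proof -
      have "t + (t + 2) + (t + (t - 1)) = 4 * t + 1" using t2 by simp
      then have "q ^ t * q ^ (t + 2) * (q ^ t * q ^ (t - 1)) = q ^ (4 * t + 1)"
        by (simp only: flip: power_add)
      then show ?thesis by (simp only: mult.assoc power_one_right)
    qed
    also have "\<dots> \<le> q ^ (1 + (4 * t + 1))" by (rule two_power_le)
    also have "\<dots> < q ^ (2 + (2 * \<nu> - 2 * t - 3))"
      using H t2 q_simps by (intro power_strict_increasing) auto
    also have "\<dots> = q\<^sup>2 * q ^ (2 * \<nu> - 2 * t - 3)" by (simp only: power_add)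
    also have "\<dots> \<le> q\<^sup>2 * qint q (Suc (2 * \<nu> - 2 * t - 3))"
      using q_simps by (intro mult_left_mono qint_Suc_ge) auto
    also have "Suc (2 * \<nu> - 2 * t - 3) = 2 * \<nu> - 2 * t - 2" using H by simp
    finally have "(qint q (t + 1) * q ^ (t + 2)) * (qint q t * qint q (t - 1)) * D < q\<^sup>2 * D * D"
      unfolding D_def[symmetric] using D by (intro mult_strict_right_mono)
    then have "(qint q (t + 1) * q ^ (t + 2) * D) * (qint q t * qint q (t - 1)) < y * (qint q t * qint q (t - 1))"
      using yD by (simp add: mult_ac)
    then have 1: "qint q (t + 1) * q ^ (t + 2) * D < y"
      by (rule mult_right_less_imp_less) (intro mult_nonneg_nonneg qint_nonneg q_simps)
    have "qint q t = q * qint q (t - 1) + 1" using qint_Suc_eq[of q "t - 1"] t2 by simp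
    moreover have "q * 1 + q * qint q (t - 1) \<le> q * (q * qint q (t - 1))"
    proof -
      have "1 \<le> qint q (t - 1)" using qint_mono[of q 1 "t - 1"] t2 q_simps by simp
      moreover from this have "2 * qint q (t - 1) \<le> q * qint q (t - 1)"
        using q_ge_2 by (intro mult_right_mono) auto
      ultimately have "1 + qint q (t - 1) \<le> q * qint q (t - 1)" by linarith
      then have "q * (1 + qint q (t - 1)) \<le> q * (q * qint q (t - 1))"
        using q_simps by (intro mult_left_mono) auto
      then show ?thesis by (simp add: algebra_simps)
    qed
    ultimately have "1 + qint q t \<le> q\<^sup>2 * qint q (t - 1)"
      using q_ge_2 by (simp add: power2_eq_square)
    also have "\<dots> \<le> q\<^sup>2 * qint q (m1 - t - 1)"
      using q_simps H by (intro mult_left_mono qint_mono) auto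
    finally have "(1 + qint q t) * y \<le> q\<^sup>2 * qint q (m1 - t - 1) * y"
      using y by (intro mult_right_mono) auto
    then show ?thesis using 1 by (simp add: D_def y_def algebra_simps)
  qed
qed

text \<open>With B = A - 1 the products are at most (A x - B W)(y + q^(t+1) [t]) and exactly x (A y
  - B v), so the overlap B W y must exceed A x q^(t+1) [t] + B x v. Multiplying by q^2 D and using W
  D = x [m1-t-1] and v q^2 D <= y [t] reduces this to \<open>balanced_key_ineq\<close> times x
  B.\<close>

lemma balanced_C1_C2_less_C3_C4:
  assumes T: "T \<in> Pm f t" and M: "M \<in> Pm f (2 * t + 1)" and TM: "T \<subseteq> M" and S: "S \<in> Pm f (t + 1)"
    and H: "1 \<le> t" "2 * t \<le> m1" "2 * m1 + 3 * t + 3 \<le> 2 * \<nu>" and m1: "t = 1 \<Longrightarrow> 4 \<le> m1"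
  shows "real (card (C1 f M T m1 t)) * real (card (C2 f M T (2 * t))) <
    real (card (C3 f S m1)) * real (card (C4 f S (2 * t) t))"
proof -
  define x W y v D where "x = N (t + 1) m1" and "W = N (t + 2) m1" and "y = N t (2 * t)"
    and "v = N (t + 1) (2 * t)" and "D = qint q (2 * \<nu> - 2 * t - 2)"
  define A B where "A = qint q (t + 1)" and "B = q * qint q t"
  have AB: "A = B + 1" by (simp add: A_def B_def qint_Suc_eq)
  have D: "D > 0" unfolding D_def using q_simps H by (intro qint_pos) auto
  have qt: "qint q t > 0" using q_simps H by (intro qint_pos) auto
  then have B: "B > 0" using q_simps by (simp add: B_def)
  have nn: "W \<ge> 0" "v \<ge> 0" unfolding W_def v_def by (rule N_nonneg)+
  have y: "y > 0" unfolding y_def using H by (intro N_pos) auto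
  have x: "x > 0" unfolding x_def using H by (intro N_pos) auto
  have W: "W * D = x * qint q (m1 - t - 1)"
    using N_rec[of "Suc t" m1] by (simp add: W_def D_def x_def mult.commute)
  have "2 * \<nu> - 2 * t = 2 * \<nu> - 2 * t - 2 + 2" using H by simp
  then have Y: "qint q (2 * \<nu> - 2 * t) = q\<^sup>2 * D + q + 1" unfolding D_def using qint_2_step by metis
  have "v * (q\<^sup>2 * D) \<le> v * qint q (2 * \<nu> - 2 * t)"
    unfolding Y using nn q_simps by (intro mult_left_mono) auto
  also have "\<dots> = y * qint q t"
    using N_rec[of t "2 * t"] by (simp add: v_def y_def mult.commute)
  finally have v: "v * (q\<^sup>2 * D) \<le> y * qint q t" .
  have "(q\<^sup>2 * D) * (A * x * (q ^ (t + 1) * qint q t) + B * x * v) =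
      x * B * (A * q ^ (t + 2) * D) + B * x * (v * (q\<^sup>2 * D))"
    by (simp add: B_def power2_eq_square mult_ac distrib_left)
  also have "\<dots> \<le> x * B * (A * q ^ (t + 2) * D) + B * x * (y * qint q t)"
    using v x B by (intro add_left_mono mult_left_mono) auto
  also have "\<dots> = x * B * (A * q ^ (t + 2) * D + qint q t * y)"
    by (simp add: algebra_simps)
  also have "\<dots> < x * B * (q\<^sup>2 * qint q (m1 - t - 1) * y)"
    unfolding A_def D_def y_def using x B H m1 by (intro mult_strict_left_mono balanced_key_ineq) auto
  also have "\<dots> = (q\<^sup>2 * B * y) * (W * D)"
    unfolding W by (simp add: mult_ac)
  also have "\<dots> = (q\<^sup>2 * D) * (B * W * y)"
    by (simp add: mult_ac)
  finally have key: "A * x * (q ^ (t + 1) * qint q t) + B * x * v < B * W * y"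
    using D q_simps by (simp add: mult_less_cancel_left)
  have "real (card (C1 f M T m1 t)) * real (card (C2 f M T (2 * t))) \<le>
      (A * x - B * W) * (y + q ^ (t + 1) * qint q t)"
  proof (intro mult_mono)
    show "real (card (C1 f M T m1 t)) \<le> A * x - B * W"
      using card_C1_le_refined[OF T M TM, of m1] AB by (simp add: A_def x_def W_def)
    then show "0 \<le> A * x - B * W" by linarith
    show "real (card (C2 f M T (2 * t))) \<le> y + q ^ (t + 1) * qint q t"
      using card_C2[OF T M TM] by (simp add: y_def)
  qed simp
  also have "\<dots> = A * x * y + A * x * (q ^ (t + 1) * qint q t) - B * W * y - B * W * (q ^ (t + 1) * qint q t)"
    by (simp add: algebra_simps)
  also have "\<dots> \<le> A * x * y + A * x * (q ^ (t + 1) * qint q t) - B * W * y"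
    using B nn qt q_simps by simp
  also have "\<dots> < A * x * y - B * x * v" using key by linarith
  also have "\<dots> = x * (A * y - B * v)" by (simp add: algebra_simps)
  also have "\<dots> = real (card (C3 f S m1)) * real (card (C4 f S (2 * t) t))"
    by (simp add: card_C3[OF S] card_C4[OF S] x_def y_def v_def A_def B_def)
  finally show ?thesis .
qed

end

section \<open>Maximal pairs\<close>

context symplectic_space
begin

text \<open>Keeps the two extremal containments and turns each of the other two alternatives into a
  single coefficient, ready to be compared with the maximum.\<close>

lemma structure_above_product:
  assumes T: "T \<in> Pm f t" and G: "\<G>1 \<subseteq> Pm f p" "\<G>2 \<subseteq> Pm f r"
    and H: "1 \<le> t" "t < p" "t < r" "2 * p + r + t + 3 \<le> 2 * \<nu>" "2 * r + p + t + 3 \<le> 2 * \<nu>"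
    and cross: "cross_t_intersecting t \<G>1 \<G>2"
    and above: "\<forall>F\<in>\<G>1. T \<subseteq> F" and ne: "\<G>1 \<noteq> {}" and B0: "B0 \<in> \<G>2" "\<not> T \<subseteq> B0"
  shows "real (card \<G>1) * real (card \<G>2) \<le> 2 / 3 * qint q (r - t + 1) * (N (t + 1) p * N t r)
    \<or> real (card \<G>1) * real (card \<G>2) \<le> (qint q (r - t) + 5 / 8) * (N (t + 1) p * N t r)
    \<or> (\<exists>S\<in>Pm f (t + 1). \<G>1 \<subseteq> C3 f S p \<and> \<G>2 \<subseteq> C4 f S r t)
    \<or> (\<exists>M\<in>Pm f (r + 1). T \<subseteq> M \<and> \<G>1 \<subseteq> C1 f M T p t \<and> \<G>2 \<subseteq> C2 f M T r)"
  using structure_above[OF T G H(1-3) cross above ne B0]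
proof (elim disjE exE conjE)
  fix \<tau> assume \<tau>: "t + 2 \<le> \<tau>" "\<tau> \<le> p"
    and le: "real (card \<G>1) \<le> qint q (r - t + 1) ^ (\<tau> - t) * N \<tau> p"
      "real (card \<G>2) \<le> qbinom q \<tau> t * N t r"
  have "real (card \<G>1) * real (card \<G>2) \<le>
      (qint q (r - t + 1) ^ (\<tau> - t) * N \<tau> p) * (qbinom q \<tau> t * N t r)"
    using q_simps by (intro mult_mono le mult_nonneg_nonneg zero_le_power qint_nonneg N_nonneg) auto
  also have "\<dots> = cover_estimate t p r \<tau> * N t r"
    by (simp only: cover_estimate_def mult_ac)
  also have "\<dots> \<le> 2 / 3 * qint q (r - t + 1) * (N (t + 1) p * N t r)"
    by (rule no_small_cover_estimate[OF H(2-5) \<tau>])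
  finally show ?thesis by blast
next
  assume le: "real (card \<G>1) \<le> qint q (r - t) * N (t + 1) p + (qint q (r - t + 1))\<^sup>2 * N (t + 2) p"
    "real (card \<G>2) \<le> N t r + q * qint q t * qint q (p - t + 1) * N (t + 1) r"
  have "real (card \<G>1) * real (card \<G>2) \<le>
      (qint q (r - t) * N (t + 1) p + (qint q (r - t + 1))\<^sup>2 * N (t + 2) p) *
      (N t r + q * qint q t * qint q (p - t + 1) * N (t + 1) r)"
    using q_simps
    by (intro mult_mono le add_nonneg_nonneg mult_nonneg_nonneg zero_le_power qint_nonneg N_nonneg) auto
  also have "\<dots> \<le> (qint q (r - t) + 5 / 8) * (N (t + 1) p * N t r)"
    by (rule small_span_estimate[OF H])
  finally show ?thesis by blast
qed blast+

end

text \<open>Turns containment in an extremal pair into equality. Positivity is essential: an empty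
  family would leave the inclusion of the other one undetermined.\<close>

lemma subset_eq_of_card_mult_le:
  assumes "finite C" "finite D" "A \<subseteq> C" "B \<subseteq> D" "card C * card D \<le> card A * card B" "0 < card A * card B"
  shows "A = C \<and> B = D"
proof -
  have le: "card A \<le> card C" "card B \<le> card D" using assms by (auto intro: card_mono)
  have pos: "0 < card A" "0 < card B" using assms(6) by auto
  have "card C \<le> card A"
  proof (rule ccontr)
    assume "\<not> card C \<le> card A"
    then have "card A * card B < card C * card B" using pos by simp
    also have "\<dots> \<le> card C * card D" using le by simp
    finally show False using assms(5) by simp
  qed
  moreover have "card D \<le> card B"
  proof (rule ccontr)
    assume "\<not> card D \<le> card B"
    then have "card A * card B < card A * card D" using pos by simp
    also have "\<dots> \<le> card C * card D" using le by simp
    finally show False using assms(5) by simp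
  qed
  ultimately show ?thesis using assms by (simp add: card_seteq)
qed

locale maximal_pair = symplectic_space f \<nu> q
  for f :: "'a::{finite,field}^'n \<Rightarrow> 'a^'n \<Rightarrow> 'a" and \<nu> :: nat and q :: real +
  fixes t m1 m2 :: nat and F1 F2 :: "('a^'n) set set"
  assumes params: "1 \<le> t" "t < m2" "m2 \<le> m1" "2 * m1 + m2 + t + 3 \<le> 2 * \<nu>"
    and F1: "F1 \<subseteq> Pm f m1" and F2: "F2 \<subseteq> Pm f m2"
    and cross: "cross_t_intersecting t F1 F2"
    and nontriv: "\<not> trivial_pair f t F1 F2"
    and maximal: "\<And>G1 G2. G1 \<subseteq> Pm f m1 \<Longrightarrow> G2 \<subseteq> Pm f m2 \<Longrightarrow>
        cross_t_intersecting t G1 G2 \<Longrightarrow> \<not> trivial_pair f t G1 G2 \<Longrightarrow>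
        card G1 * card G2 \<le> card F1 * card F2"
begin

lemma codim_pos: "1 \<le> m2 - t"
  using params by simp

definition base_product :: real where
  "base_product = N (t + 1) m1 * N t m2"

definition val :: real where
  "val = real (card F1) * real (card F2)"

lemma base_product_pos: "base_product > 0"
  unfolding base_product_def using params by (intro mult_pos_pos N_pos) auto

lemma C1_C2_le_max:
  assumes "T \<in> Pm f t" "M \<in> Pm f (m2 + 1)" "T \<subseteq> M"
  shows "card (C1 f M T m1 t) * card (C2 f M T m2) \<le> card F1 * card F2"
  using params by (intro maximal C1_C2_pair[OF assms]) auto

lemma C3_C4_le_max:
  assumes "S \<in> Pm f (t + 1)"
  shows "card (C3 f S m1) * card (C4 f S m2 t) \<le> card F1 * card F2"
  using params by (intro maximal C3_C4_pair[OF assms]) auto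

lemma ex_flag:
  obtains M T where "M \<in> Pm f (m2 + 1)" "T \<in> Pm f t" "T \<subseteq> M"
proof -
  obtain M where M: "M \<in> Pm f (m2 + 1)" using ex_Pm[of "m2 + 1"] params by auto
  obtain T where "vec.subspace T" "T \<subseteq> M" "vec.dim T = t"
    using ex_subspace_between[of "{0}" M t] PmD[OF M] vec.subspace_0[of M] params by auto
  then show ?thesis using that[OF M] Pm_subspace[OF M] by blast
qed

lemma ex_S:
  obtains S where "S \<in> Pm f (t + 1)"
  using ex_Pm[of "t + 1"] params by auto

lemma val_ge_C1_C2: "(qint q (m2 - t + 1) - 1 / 8) * base_product \<le> val"
proof -
  obtain M T where MT: "M \<in> Pm f (m2 + 1)" "T \<in> Pm f t" "T \<subseteq> M" using ex_flag .
  have "(qint q (m2 - t + 1) - 1 / 8) * base_product \<le> real (card (C1 f M T m1 t)) * real (card (C2 f M T m2))"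
    unfolding base_product_def using params by (intro C1_C2_product_ge[OF MT(2,1,3)])
  also have "\<dots> \<le> val"
    using C1_C2_le_max[OF MT(2,1,3)] unfolding val_def of_nat_mult[symmetric] of_nat_le_iff .
  finally show ?thesis .
qed

lemma val_ge_C3_C4: "(qint q (t + 1) - 1 / 8) * base_product \<le> val"
proof -
  obtain S where S: "S \<in> Pm f (t + 1)" using ex_S .
  have "(qint q (t + 1) - 1 / 8) * base_product \<le> real (card (C3 f S m1)) * real (card (C4 f S m2 t))"
    unfolding base_product_def using params by (intro C3_C4_product_ge[OF S])
  also have "\<dots> \<le> val"
    using C3_C4_le_max[OF S] unfolding val_def of_nat_mult[symmetric] of_nat_le_iff .
  finally show ?thesis .
qed

lemma qint_Suc_ge_3: "1 \<le> k \<Longrightarrow> 3 \<le> qint q (k + 1)"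
  using qint_mono[of q "Suc 1" "k + 1"] q_ge_2 by (simp add: qint_Suc)

text \<open>Maximality against the concrete pairs excludes every upper bound whose coefficient is
  below what one of them guarantees.\<close>

lemma val_gt:
  assumes "c < qint q (t + 1) - 1 / 8 \<or> c < qint q (m2 - t + 1) - 1 / 8"
  shows "c * base_product < val"
  using assms
proof
  assume "c < qint q (t + 1) - 1 / 8"
  then have "c * base_product < (qint q (t + 1) - 1 / 8) * base_product" using base_product_pos by (intro mult_strict_right_mono)
  then show ?thesis using val_ge_C3_C4 by linarith
next
  assume "c < qint q (m2 - t + 1) - 1 / 8"
  then have "c * base_product < (qint q (m2 - t + 1) - 1 / 8) * base_product" using base_product_pos by (intro mult_strict_right_mono)
  then show ?thesis using val_ge_C1_C2 by linarith
qed

lemma card_pos: "0 < card F1 * card F2"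
proof -
  have "2 * base_product < val" using qint_Suc_ge_3[OF params(1)] by (intro val_gt) linarith
  then have "0 < val" using base_product_pos by linarith
  then show ?thesis unfolding val_def by (simp add: zero_less_mult_iff)
qed

lemma nonempty: "F1 \<noteq> {}" "F2 \<noteq> {}"
  using card_pos by auto

lemma eq_C1_C2:
  assumes "T \<in> Pm f t" "M \<in> Pm f (m2 + 1)" "T \<subseteq> M" "F1 \<subseteq> C1 f M T m1 t" "F2 \<subseteq> C2 f M T m2"
  shows "F1 = C1 f M T m1 t \<and> F2 = C2 f M T m2"
  using assms C1_C2_le_max[OF assms(1-3)] card_pos by (intro subset_eq_of_card_mult_le) auto

lemma eq_C3_C4:
  assumes "S \<in> Pm f (t + 1)" "F1 \<subseteq> C3 f S m1" "F2 \<subseteq> C4 f S m2 t"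
  shows "F1 = C3 f S m1 \<and> F2 = C4 f S m2 t"
  using assms C3_C4_le_max[OF assms(1)] card_pos by (intro subset_eq_of_card_mult_le) auto

text \<open>Without such a \<open>T\<close> the product is at most 2 units, while [t+1] - 1/8 is at
  least 3 - 1/8.\<close>

lemma ex_common_subspace:
  "\<exists>T\<in>Pm f t. (\<forall>F\<in>F1. T \<subseteq> F) \<or> (\<forall>F\<in>F2. T \<subseteq> F)"
proof (rule ccontr)
  assume "\<not> ?thesis"
  then have n: "\<And>T. T \<in> Pm f t \<Longrightarrow> \<exists>F\<in>F1. \<not> T \<subseteq> F" "\<And>T. T \<in> Pm f t \<Longrightarrow> \<exists>F\<in>F2. \<not> T \<subseteq> F" by blast+
  have "t \<le> m1" "t \<le> m2" using params by auto
  from card_le_two_covers[OF F1 F2 this nonempty cross n]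
  obtain \<tau>1 \<tau>2 where \<tau>: "t < \<tau>1" "\<tau>1 \<le> m2" "t < \<tau>2" "\<tau>2 \<le> m1"
    and le: "real (card F1) \<le> qbinom q \<tau>1 t * (qint q (m2 - t + 1) ^ (\<tau>2 - t) * N \<tau>2 m1)"
      "real (card F2) \<le> qbinom q \<tau>2 t * (qint q (m1 - t + 1) ^ (\<tau>1 - t) * N \<tau>1 m2)"
    by blast
  have "val \<le> (qbinom q \<tau>1 t * (qint q (m2 - t + 1) ^ (\<tau>2 - t) * N \<tau>2 m1)) *
      (qbinom q \<tau>2 t * (qint q (m1 - t + 1) ^ (\<tau>1 - t) * N \<tau>1 m2))"
    unfolding val_def using q_simps
    by (intro mult_mono le mult_nonneg_nonneg zero_le_power qint_nonneg qbinom_nonneg N_nonneg) auto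
  also have "\<dots> = cover_estimate t m1 m2 \<tau>2 * cover_estimate t m2 m1 \<tau>1"
    by (simp only: cover_estimate_def mult_ac)
  also have "\<dots> \<le> 2 * base_product"
    unfolding base_product_def using params \<tau> by (intro two_covers_estimate) auto
  also have "\<dots> < val" using qint_Suc_ge_3[OF params(1)] by (intro val_gt) linarith
  finally show False by simp
qed

lemma not_above:
  assumes "T \<in> Pm f t"
  shows "\<exists>B\<in>F1 \<union> F2. \<not> T \<subseteq> B"
proof (rule ccontr)
  assume "\<not> ?thesis"
  then have "\<forall>F\<in>F1 \<union> F2. T \<subseteq> F" by blast
  then have "trivial_pair f t F1 F2" using assms unfolding trivial_pair_def by (rule bexI)
  with nontriv show False ..
qed

lemma qint_step: "qint q k + 2 \<le> qint q (k + 1)" if "1 \<le> k"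
proof -
  have "q ^ 1 \<le> q ^ k" using that q_simps by (intro power_increasing) auto
  then show ?thesis using q_ge_2 by (simp add: qint_Suc)
qed

lemma extremal_of_common_subspace_F1:
  assumes T: "T \<in> Pm f t" "\<forall>F\<in>F1. T \<subseteq> F"
  shows "(\<exists>S\<in>Pm f (t + 1). F1 = C3 f S m1 \<and> F2 = C4 f S m2 t)
    \<or> (\<exists>M\<in>Pm f (m2 + 1). T \<subseteq> M \<and> F1 = C1 f M T m1 t \<and> F2 = C2 f M T m2)"
proof -
  obtain B where B: "B \<in> F2" "\<not> T \<subseteq> B" using not_above[OF T(1)] T(2) by blast
  have H: "1 \<le> t" "t < m1" "t < m2" "2 * m1 + m2 + t + 3 \<le> 2 * \<nu>" "2 * m2 + m1 + t + 3 \<le> 2 * \<nu>"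
    using params by auto
  have "2 / 3 * qint q (m2 - t + 1) * base_product < val"
    using qint_Suc_ge_3[OF codim_pos] by (intro val_gt disjI2) linarith
  moreover have "(qint q (m2 - t) + 5 / 8) * base_product < val"
    using qint_step[OF codim_pos] by (intro val_gt disjI2) linarith
  ultimately have "(\<exists>S\<in>Pm f (t + 1). F1 \<subseteq> C3 f S m1 \<and> F2 \<subseteq> C4 f S m2 t)
    \<or> (\<exists>M\<in>Pm f (m2 + 1). T \<subseteq> M \<and> F1 \<subseteq> C1 f M T m1 t \<and> F2 \<subseteq> C2 f M T m2)"
    using structure_above_product[OF T(1) F1 F2 H cross T(2) nonempty(1) B]
    unfolding base_product_def[symmetric] val_def[symmetric] by linarith
  then show ?thesis
    using eq_C3_C4 eq_C1_C2[OF T(1)] by blast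
qed

text \<open>\<open>z\<close> is the unit with the roles exchanged. The exact relation z [m1-t] =
  [m2-t] \<open>base_product\<close> makes it at most half the original unit, which excludes the
  exchanged (C3, C4). For the exchanged (C1, C2) it gives [m1-t+1] z <= (q [m2-t] + 1/2)
  \<open>base_product\<close>, whereas the maximum is at least q [m2-t] + 7/8 units.\<close>

lemma no_common_subspace_F2:
  assumes T: "T \<in> Pm f t" and above: "\<forall>F\<in>F2. T \<subseteq> F" and lt: "m2 < m1"
  shows False
proof -
  define z a b where "z = N (t + 1) m2 * N t m1" and "a = qint q (m2 - t)" and "b = qint q (m1 - t)"
  have a: "a \<ge> 1" using qint_mono[of q 1 "m2 - t"] params q_simps by (simp add: a_def)
  have "qint q (m2 - t + 1) \<le> b" unfolding b_def using lt params q_simps by (intro qint_mono) auto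
  then have ab: "q * a + 1 \<le> b" by (simp add: a_def qint_Suc_eq)
  have "2 * a \<le> q * a" using a q_ge_2 by (intro mult_right_mono) auto
  with ab have ab2: "2 * a \<le> b" by simp
  \<comment> \<open>Applying \<open>N_rec\<close> once to each factor moves the same bracket
    [2 nu - 2t] across, so nothing is lost.\<close>
  have "z * b = N (t + 1) m2 * (N t m1 * qint q (m1 - t))" by (simp add: z_def b_def)
  also have "\<dots> = (qint q (2 * \<nu> - 2 * t) * N (Suc t) m2) * N (t + 1) m1" by (simp add: N_rec)
  also have "\<dots> = a * base_product" unfolding N_rec[symmetric] by (simp add: base_product_def a_def)
  finally have zb: "z * b = a * base_product" .
  have z0: "z \<ge> 0" unfolding z_def by (intro mult_nonneg_nonneg N_nonneg)
  have z2: "z \<le> 1 / 2 * base_product"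
  proof -
    have "z * (2 * a) \<le> z * b" using ab2 z0 by (intro mult_left_mono)
    then have "(2 * z) * a \<le> base_product * a" using zb by (simp add: mult_ac)
    then show ?thesis using a by (simp add: mult_le_cancel_right)
  qed
  have b1: "qint q (m1 - t + 1) = q * b + 1" and a1: "qint q (m2 - t + 1) = q * a + 1"
    by (simp_all add: a_def b_def qint_Suc_eq)
  have b1z: "qint q (m1 - t + 1) * z \<le> (q * a + 1 / 2) * base_product"
  proof -
    have "qint q (m1 - t + 1) * z = q * (z * b) + z" unfolding b1 by (simp add: algebra_simps)
    also have "\<dots> \<le> q * (a * base_product) + 1 / 2 * base_product" unfolding zb using z2 by simp
    finally show ?thesis by (simp add: algebra_simps)
  qed
  have qa: "q * a \<ge> 2" using mult_mono[of 2 q 1 a] q_ge_2 a by simp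
  obtain B where B: "B \<in> F1" "\<not> T \<subseteq> B"
    using not_above[OF T] above by blast
  have cross': "cross_t_intersecting t F2 F1"
    unfolding cross_t_intersecting_def
    by (subst Int_commute) (use cross in \<open>auto simp: cross_t_intersecting_def\<close>)
  have H: "1 \<le> t" "t < m2" "t < m1" "2 * m2 + m1 + t + 3 \<le> 2 * \<nu>" "2 * m1 + m2 + t + 3 \<le> 2 * \<nu>"
    using params by auto
  have val: "val = real (card F2) * real (card F1)" by (simp add: val_def)
  show False
    using structure_above_product[OF T F2 F1 H cross' above nonempty(2) B]
    unfolding z_def[symmetric] val[symmetric] b_def[symmetric]
  proof (elim disjE bexE conjE)
    assume "val \<le> 2 / 3 * qint q (m1 - t + 1) * z"
    also have "\<dots> \<le> 2 / 3 * (q * a + 1 / 2) * base_product"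
      using mult_left_mono[OF b1z, of "2 / 3"] by (simp only: mult.assoc)
    also have "\<dots> < val"
    proof (intro val_gt disjI2)
      have gen: "2 / 3 * (w + 1 / 2) < w + 1 - 1 / 8" if "2 \<le> w" for w :: real
        using that by simp
      show "2 / 3 * (q * a + 1 / 2) < qint q (m2 - t + 1) - 1 / 8" unfolding a1 using qa by (rule gen)
    qed
    finally show False by simp
  next
    assume "val \<le> (b + 5 / 8) * z"
    also have "\<dots> = z * b + 5 / 8 * z" by (simp add: algebra_simps)
    also have "\<dots> \<le> (a + 5 / 8) * base_product"
      using z2 base_product_pos unfolding zb by (simp add: algebra_simps)
    also have "\<dots> < val"
      using qint_step[OF codim_pos] unfolding a_def by (intro val_gt disjI2) linarith
    finally show False by simp
  next
    fix S assume S: "S \<in> Pm f (t + 1)" "F2 \<subseteq> C3 f S m2" "F1 \<subseteq> C4 f S m1 t"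
    have "val \<le> real (card (C3 f S m2)) * real (card (C4 f S m1 t))"
      unfolding val using S by (intro mult_mono) (auto intro!: card_mono)
    also have "\<dots> \<le> qint q (t + 1) * z"
      unfolding z_def by (rule C3_C4_product_le[OF S(1)])
    also have "\<dots> \<le> qint q (t + 1) * (1 / 2 * base_product)"
      using z2 q_simps by (intro mult_left_mono qint_nonneg) auto
    also have "\<dots> = (qint q (t + 1) / 2) * base_product" by simp
    also have "\<dots> < val"
      using qint_Suc_ge_3[OF params(1)] by (intro val_gt disjI1) linarith
    finally show False by simp
  next
    fix M assume M: "M \<in> Pm f (m1 + 1)" "T \<subseteq> M" "F2 \<subseteq> C1 f M T m2 t" "F1 \<subseteq> C2 f M T m1"
    \<comment> \<open>The hyperplanes added in \<open>C2\<close> thus contribute at most 1/4, and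
      1/2 + 1/4 stays below the available 7/8.\<close>
    have "4 * qint q (m2 - t + 1) \<le> 4 * (2 * q ^ (m2 - t))"
      using qint_Suc_le[OF q_ge_2, of "m2 - t"] by simp
    also have "\<dots> = 2 ^ 3 * q ^ (m2 - t)" by simp
    also have "\<dots> \<le> q ^ (3 + (m2 - t))" by (rule two_power_le)
    also have "\<dots> \<le> q ^ (m2 + 2)" using q_simps params by (intro power_increasing) auto
    finally have \<kappa>: "qint q (m2 - t + 1) / q ^ (m2 + 2) \<le> 1 / 4"
      using q_simps by (simp add: field_simps)
    have "val \<le> real (card (C1 f M T m2 t)) * real (card (C2 f M T m1))"
      unfolding val using M by (intro mult_mono) (auto intro!: card_mono)
    also have "\<dots> \<le> qint q (m1 - t + 1) * (1 + 1 / q ^ (m2 + 2)) * z"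
      unfolding z_def using params by (intro C1_C2_product_le[OF T M(1,2)]) auto
    also have "\<dots> = (qint q (m1 - t + 1) * z) * (1 + 1 / q ^ (m2 + 2))" by simp
    also have "\<dots> \<le> (q * a + 1 / 2) * base_product * (1 + 1 / q ^ (m2 + 2))"
      using b1z q_simps by (intro mult_right_mono) auto
    also have "\<dots> = (q * a + 1 / 2 + (q * a + 1 / 2) / q ^ (m2 + 2)) * base_product"
      by (simp add: algebra_simps add_divide_distrib)
    also have "\<dots> < val"
    proof (intro val_gt disjI2)
      have "(q * a + 1 / 2) / q ^ (m2 + 2) \<le> qint q (m2 - t + 1) / q ^ (m2 + 2)"
        using q_simps unfolding a1 by (intro divide_right_mono) auto
      with \<kappa> show "q * a + 1 / 2 + (q * a + 1 / 2) / q ^ (m2 + 2) < qint q (m2 - t + 1) - 1 / 8"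
        unfolding a1 by linarith
    qed
    finally show False by simp
  qed
qed

text \<open>For m2 > 2t one has [t+1] <= [m2-t], and this is below [m2-t+1] - 1/8. In the
  exceptional triples both coefficients are [2], and the exact comparison takes over.\<close>

lemma not_C3_C4:
  assumes i: "2 * t < m2 \<or> (m1, m2, t) \<in> {(2, 2, 1), (3, 2, 1)}"
    and S: "S \<in> Pm f (t + 1)" "F1 = C3 f S m1" "F2 = C4 f S m2 t"
  shows False
  using i
proof
  assume m: "2 * t < m2"
  have "val \<le> qint q (t + 1) * base_product"
    unfolding val_def base_product_def unfolding S(2,3) by (rule C3_C4_product_le[OF S(1)])
  also have "\<dots> \<le> qint q (m2 - t) * base_product"
    using m base_product_pos q_simps by (intro mult_right_mono qint_mono) auto
  also have "\<dots> < val"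
    using qint_step[OF codim_pos] by (intro val_gt disjI2) linarith
  finally show False by simp
next
  assume m: "(m1, m2, t) \<in> {(2, 2, 1), (3, 2, 1)}"
  obtain M T where MT: "M \<in> Pm f (m2 + 1)" "T \<in> Pm f t" "T \<subseteq> M" using ex_flag .
  have tm: "t = 1" "m2 = 2" and m1: "m1 = 2 \<or> m1 = 3" using m by auto
  have "2 + 1 = (3 :: nat)" "1 + 1 = (2 :: nat)" by simp_all
  then have "M \<in> Pm f 3" "T \<in> Pm f 1" "S \<in> Pm f 2" using MT(1,2) S(1) unfolding tm by metis+
  moreover have "2 * m1 + 6 \<le> 2 * \<nu>" using params(4) unfolding tm by simp
  ultimately have "real (card (C3 f S m1)) * real (card (C4 f S m2 t)) <
      real (card (C1 f M T m1 t)) * real (card (C2 f M T m2))"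
    unfolding tm by (intro special_C3_C4_less_C1_C2 MT(3) m1)
  then have "card (C3 f S m1) * card (C4 f S m2 t) < card (C1 f M T m1 t) * card (C2 f M T m2)"
    unfolding of_nat_mult[symmetric] of_nat_less_iff .
  also have "\<dots> \<le> card F1 * card F2" by (rule C1_C2_le_max[OF MT(2,1,3)])
  also have "\<dots> = card (C3 f S m1) * card (C4 f S m2 t)" by (simp only: S(2,3))
  finally show False by simp
qed

text \<open>For m2 < 2t the coefficient A = [m2-t+1] is at most [t], and the hyperplanes in
  \<open>C2\<close> add at most q/8. The gap [t+1] - [t] = q^t >= q leaves room for this and for the
  1/8. Only m2 = 2t requires the refined comparison.\<close>

lemma not_C1_C2:
  assumes ii: "m2 \<le> 2 * t" "(m1, m2, t) \<notin> {(2, 2, 1), (3, 2, 1)}"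
    and MT: "M \<in> Pm f (m2 + 1)" "T \<in> Pm f t" "T \<subseteq> M" and F: "F1 = C1 f M T m1 t" "F2 = C2 f M T m2"
  shows False
proof (cases "m2 = 2 * t")
  case True
  obtain S where S: "S \<in> Pm f (t + 1)" using ex_S .
  have "t = 1 \<Longrightarrow> 4 \<le> m1" using ii(2) True params(3) by auto
  then have "real (card (C1 f M T m1 t)) * real (card (C2 f M T m2)) <
      real (card (C3 f S m1)) * real (card (C4 f S m2 t))"
    using balanced_C1_C2_less_C3_C4[OF MT(2) _ MT(3) S, of m1] MT(1) True params by simp
  then have "card (C1 f M T m1 t) * card (C2 f M T m2) < card (C3 f S m1) * card (C4 f S m2 t)"
    unfolding of_nat_mult[symmetric] of_nat_less_iff .
  also have "\<dots> \<le> card F1 * card F2" by (rule C3_C4_le_max[OF S])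
  also have "\<dots> = card (C1 f M T m1 t) * card (C2 f M T m2)" by (simp only: F)
  finally show False by simp
next
  case False
  define A where "A = qint q (m2 - t + 1)"
  have "8 * A \<le> 8 * (2 * q ^ (m2 - t))"
    using qint_Suc_le[OF q_ge_2, of "m2 - t"] by (simp add: A_def)
  also have "\<dots> = 2 ^ 4 * q ^ (m2 - t)" by simp
  also have "\<dots> \<le> q ^ (4 + (m2 - t))" by (rule two_power_le)
  also have "\<dots> \<le> 2 ^ 0 * q ^ (m1 + 3)" using q_simps params by (simp add: power_increasing)
  also have "\<dots> = q * q ^ (m1 + 2)" by (simp add: eval_nat_numeral)
  finally have "A / q ^ (m1 + 2) \<le> q / 8" using q_simps by (simp add: field_simps)
  moreover have "A \<le> qint q t" unfolding A_def using ii False q_simps by (intro qint_mono) auto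
  moreover have "qint q (t + 1) \<ge> qint q t + q"
    using power_increasing[of 1 t q] params q_simps by (simp add: qint_Suc)
  ultimately have lt: "A + A / q ^ (m1 + 2) < qint q (t + 1) - 1 / 8" using q_ge_2 by linarith
  have "val \<le> A * (1 + 1 / q ^ (m1 + 2)) * base_product"
    unfolding val_def base_product_def A_def unfolding F using params by (intro C1_C2_product_le[OF MT(2,1,3)]) auto
  also have "\<dots> = (A + A / q ^ (m1 + 2)) * base_product" by (simp add: algebra_simps)
  also have "\<dots> < val" using lt by (intro val_gt disjI1)
  finally show False by simp
qed

lemma classification_of_common_subspace_F1:
  assumes T: "T \<in> Pm f t" "\<forall>F\<in>F1. T \<subseteq> F"
  shows "(m2 > 2 * t \<or> (m1, m2, t) \<in> {(2, 2, 1), (3, 2, 1)} \<longrightarrow>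
       (\<exists>M \<in> Pm f (m2 + 1). \<exists>T. vec.subspace T \<and> vec.dim T = t \<and> T \<subseteq> M \<and>
          F1 = C1 f M T m1 t \<and> F2 = C2 f M T m2))
   \<and> (m2 \<le> 2 * t \<and> (m1, m2, t) \<notin> {(2, 2, 1), (3, 2, 1)} \<longrightarrow>
       (\<exists>S \<in> Pm f (t + 1). F1 = C3 f S m1 \<and> F2 = C4 f S m2 t))"
  using extremal_of_common_subspace_F1[OF T] not_C3_C4 not_C1_C2[OF _ _ _ T(1)] PmD(1,2)[OF T(1)]
  by blast

text \<open>For m1 = m2 the dimension hypothesis and the class of competitors are symmetric. This
  produces the second alternatives of the classification.\<close>

lemma swapped:
  assumes "m1 = m2"
  shows "maximal_pair f \<nu> q t m2 m1 F2 F1"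
proof unfold_locales
  have *: "cross_t_intersecting t B A" if "cross_t_intersecting t A B" for A B :: "('a^'n) set set"
    unfolding cross_t_intersecting_def
    by (subst Int_commute) (use that in \<open>auto simp: cross_t_intersecting_def\<close>)
  have **: "trivial_pair f t A B \<longleftrightarrow> trivial_pair f t B A" for A B
    by (simp add: trivial_pair_def Un_commute)
  show "cross_t_intersecting t F2 F1" by (rule *[OF cross])
  show "\<not> trivial_pair f t F2 F1" using nontriv ** by blast
  show "card G1 * card G2 \<le> card F2 * card F1"
    if "G1 \<subseteq> Pm f m2" "G2 \<subseteq> Pm f m1" "cross_t_intersecting t G1 G2" "\<not> trivial_pair f t G1 G2" for G1 G2
    using maximal[of G2 G1] * that ** assms by (simp add: mult.commute)
qed (use params F1 F2 assms in auto)

lemma classification: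
  "(m2 > 2 * t \<or> (m1, m2, t) \<in> {(2, 2, 1), (3, 2, 1)} \<longrightarrow>
       (\<exists>M \<in> Pm f (m2 + 1). \<exists>T. vec.subspace T \<and> vec.dim T = t \<and> T \<subseteq> M \<and>
          ((F1 = C1 f M T m1 t \<and> F2 = C2 f M T m2) \<or>
           (m1 = m2 \<and> F1 = C2 f M T m1 \<and> F2 = C1 f M T m2 t))))
   \<and>
    (m2 \<le> 2 * t \<and> (m1, m2, t) \<notin> {(2, 2, 1), (3, 2, 1)} \<longrightarrow>
       (\<exists>S \<in> Pm f (t + 1).
          ((F1 = C3 f S m1 \<and> F2 = C4 f S m2 t) \<or>
           (m1 = m2 \<and> F1 = C4 f S m1 t \<and> F2 = C3 f S m2))))"
proof -
  obtain T where T: "T \<in> Pm f t" "(\<forall>F\<in>F1. T \<subseteq> F) \<or> (\<forall>F\<in>F2. T \<subseteq> F)"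
    using ex_common_subspace by blast
  from T(2) show ?thesis
  proof
    assume "\<forall>F\<in>F1. T \<subseteq> F"
    from classification_of_common_subspace_F1[OF T(1) this] show ?thesis by blast
  next
    assume above: "\<forall>F\<in>F2. T \<subseteq> F"
    then have "\<not> m2 < m1" using no_common_subspace_F2[OF T(1) above] by blast
    then have eq: "m1 = m2" using params(3) by simp
    interpret sw: maximal_pair f \<nu> q t m2 m1 F2 F1 by (rule swapped[OF eq])
    from sw.classification_of_common_subspace_F1[OF T(1) above] show ?thesis
      unfolding eq by blast
  qed
qed

end

theorem theorem1p2:
  fixes f :: "'a::{finite,field}^'n \<Rightarrow> 'a^'n \<Rightarrow> 'a"
    and \<nu> m1 m2 t :: nat
    and F1 F2 :: "('a^'n) set set"
  assumes dimV: "CARD('n) = 2 * \<nu>"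
    and f: "symplectic_form f"
    and pos: "\<nu> \<ge> 1" "m1 \<ge> 1" "m2 \<ge> 1" "t \<ge> 1"
    and ord: "m1 \<ge> m2" "m2 \<ge> t + 1"
    and big: "2 * \<nu> \<ge> 2 * m1 + m2 + t + 3"
    and F1: "F1 \<subseteq> Pm f m1" and F2: "F2 \<subseteq> Pm f m2"
    and cross: "cross_t_intersecting t F1 F2"
    and nontriv: "\<not> trivial_pair f t F1 F2"
    and maximal: "\<And>G1 G2. G1 \<subseteq> Pm f m1 \<Longrightarrow> G2 \<subseteq> Pm f m2 \<Longrightarrow>
        cross_t_intersecting t G1 G2 \<Longrightarrow> \<not> trivial_pair f t G1 G2 \<Longrightarrow>
        card G1 * card G2 \<le> card F1 * card F2"
  shows
    "(m2 > 2 * t \<or> (m1, m2, t) \<in> {(2, 2, 1), (3, 2, 1)} \<longrightarrow>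
       (\<exists>M \<in> Pm f (m2 + 1). \<exists>T. vec.subspace T \<and> vec.dim T = t \<and> T \<subseteq> M \<and>
          ((F1 = C1 f M T m1 t \<and> F2 = C2 f M T m2) \<or>
           (m1 = m2 \<and> F1 = C2 f M T m1 \<and> F2 = C1 f M T m2 t))))
   \<and>
    (m2 \<le> 2 * t \<and> (m1, m2, t) \<notin> {(2, 2, 1), (3, 2, 1)} \<longrightarrow>
       (\<exists>S \<in> Pm f (t + 1).
          ((F1 = C3 f S m1 \<and> F2 = C4 f S m2 t) \<or>
           (m1 = m2 \<and> F1 = C4 f S m1 t \<and> F2 = C3 f S m2))))"
proof -
  interpret maximal_pair f \<nu> "real CARD('a)" t m1 m2 F1 F2
    by unfold_locales (use assms in auto)
  show ?thesis by (rule classification)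
qed

end
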